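(* Let $A, B, C \subset \mathbb{R}$ be three pairwise disjoint intervals with $|A|+|B|+|C|=1$, and let $\Omega = A\cup B\cup C$. If $\Omega$ tiles $\mathbb{R}$ by translations, then $\Omega$ is a spectral set.
   Context: Intervals are bounded and of positive length; $|\cdot|$ denotes Lebesgue measure (length). A measurable set $\Omega\subset\mathbb{R}$ of finite positive measure tiles $\mathbb{R}$ by translations if there is a subset $\mathcal{T}\subset\mathbb{R}$ such that the translates $\{\Omega+t : t\in\mathcal{T}\}$ form a partition of $\mathbb{R}$ up to sets of measure zero. $\Omega$ is a spectral set if there is a subset $\Lambda\subset\mathbb{R}$ such that the functions $e_\lambda(x)=|\Omega|^{-1/2}e^{2\pi i\lambda x}\chi_\Omega(x)$, $\lambda\in\Lambda$, form an orthonormal basis of $L^2(\Omega)$. *)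

theory Defs
  imports "HOL-Analysis.Analysis"
begin

text \<open>Intervals are bounded and of positive length; either endpoint may or may not belong
  to the interval.\<close>

definition bounded_interval :: "real set \<Rightarrow> bool" where
  "bounded_interval I \<longleftrightarrow> is_interval I \<and> bounded I \<and> 0 < measure lebesgue I"

definition finite_positive_measure :: "real set \<Rightarrow> bool" where
  "finite_positive_measure \<Omega> \<longleftrightarrow> \<Omega> \<in> lmeasurable \<and> 0 < measure lebesgue \<Omega>"

definition tiles_by_translations :: "real set \<Rightarrow> bool" where
  "tiles_by_translations \<Omega> \<longleftrightarrow> finite_positive_measure \<Omega> \<and>
     (\<exists>T :: real set.
        (\<forall>s\<in>T. \<forall>t\<in>T. s \<noteq> t \<longrightarrow> (+) s ` \<Omega> \<inter> (+) t ` \<Omega> \<in> null_sets lebesgue) \<and>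
        UNIV - (\<Union>t\<in>T. (+) t ` \<Omega>) \<in> null_sets lebesgue)"

text \<open>The space \<open>L\<^sup>2(\<Omega>)\<close> of complex-valued functions is represented by its functions rather
  than by classes modulo equality almost everywhere.\<close>

definition L2_on :: "real set \<Rightarrow> (real \<Rightarrow> complex) set" where
  "L2_on \<Omega> = {f. f \<in> borel_measurable (lebesgue_on \<Omega>) \<and>
                 integrable (lebesgue_on \<Omega>) (\<lambda>x. (norm (f x))\<^sup>2)}"

definition L2_inner :: "real set \<Rightarrow> (real \<Rightarrow> complex) \<Rightarrow> (real \<Rightarrow> complex) \<Rightarrow> complex" where
  "L2_inner \<Omega> f g = (\<integral>x. f x * cnj (g x) \<partial>lebesgue_on \<Omega>)"

definition L2_norm_on :: "real set \<Rightarrow> (real \<Rightarrow> complex) \<Rightarrow> real" where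
  "L2_norm_on \<Omega> f = sqrt (\<integral>x. (norm (f x))\<^sup>2 \<partial>lebesgue_on \<Omega>)"

text \<open>An orthonormal basis in the Hilbert space sense: an orthonormal family whose finite
  complex linear combinations are dense.\<close>

definition orthonormal_basis_L2 ::
    "real set \<Rightarrow> 'i set \<Rightarrow> ('i \<Rightarrow> real \<Rightarrow> complex) \<Rightarrow> bool" where
  "orthonormal_basis_L2 \<Omega> J e \<longleftrightarrow>
     (\<forall>j\<in>J. e j \<in> L2_on \<Omega>) \<and>
     (\<forall>j\<in>J. \<forall>k\<in>J. L2_inner \<Omega> (e j) (e k) = (if j = k then 1 else 0)) \<and>
     (\<forall>f\<in>L2_on \<Omega>. \<forall>\<epsilon>>0. \<exists>F c. finite F \<and> F \<subseteq> J \<and>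
        L2_norm_on \<Omega> (\<lambda>x. f x - (\<Sum>j\<in>F. c j * e j x)) < \<epsilon>)"

definition spectral_exp :: "real set \<Rightarrow> real \<Rightarrow> real \<Rightarrow> complex" where
  "spectral_exp \<Omega> l x =
     complex_of_real (measure lebesgue \<Omega> powr (- 1 / 2)) *
     exp (2 * complex_of_real pi * \<i> * complex_of_real l * complex_of_real x) * indicator \<Omega> x"

definition spectral_set :: "real set \<Rightarrow> bool" where
  "spectral_set \<Omega> \<longleftrightarrow> finite_positive_measure \<Omega> \<and>
     (\<exists>\<Lambda> :: real set. orthonormal_basis_L2 \<Omega> \<Lambda> (spectral_exp \<Omega>))"

end

theory Submission
  imports Defs
begin

text \<open>
  Up to null sets, the translates of \<open>A \<union> B \<union> C\<close> cut the line into consecutive half-open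
  intervals, and each of them carries a letter that tells whether it is a translate of \<open>A\<close>, of
  \<open>B\<close> or of \<open>C\<close> (\<open>tiling_by_intervals\<close>, locale \<open>interval_tiling\<close>).  The tiling is thus a word,
  infinite in both directions.  The main tool for reading it is that two occurrences of one letter
  at distance \<open>d\<close> belong to two tiles that differ by the translation \<open>d\<close>; so every letter
  has two occurrences at distance \<open>d\<close>, and the gap between them must be filled exactly by
  intervals of the three available lengths.  Comparing the gaps leaves three possibilities
  (\<open>trichotomy\<close>).

  If no letter ever follows itself and the lengths are not all equal, then the three letters
  alternate cyclically and the set of translations is invariant under the translation \<open>1\<close>.  If all
  lengths are \<open>1 / 3\<close>, then everything lives on a lattice and one has to know how a set of three
  integers tiles the integers.  In the remaining case the letter \<open>A\<close> that follows itself has length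
  \<open>1 / 2\<close>, the other two lengths \<open>b\<close> and \<open>c\<close> also add up to \<open>1 / 2\<close>, and the word
  consists of blocks of \<open>A\<close> separated by runs in which \<open>B\<close> and \<open>C\<close> alternate.  The point
  of that case is that all these runs have the same orientation (\<open>energy\<close>).  Passing from a block
  of \<open>A\<close> to the corresponding block of \<open>B\<close> or of \<open>C\<close> permutes the blocks, so sums of squares
  of lengths over a period of the tiling (\<open>periodic\<close>) do not change; computing such a sum in two
  ways gives a sum of squares that vanishes, and its terms measure the changes of orientation.

  In each of the three cases there are \<open>N\<close>, one of \<open>1\<close>, \<open>2\<close>, \<open>3\<close>, and a real number \<open>s\<close>
  such that, whenever two points of \<open>A \<union> B \<union> C\<close> (apart from endpoints) differ by
  \<open>m / N\<close> with an integer \<open>m \<noteq> 0\<close>, the number \<open>s * m\<close> is an integer that \<open>N\<close> does not divide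
  (locale \<open>packed_set\<close>).  This alone makes a set of measure \<open>1\<close> spectral, with spectrum
  \<open>{s * j + N * k | j < N}\<close>: a fibre of the set over a point modulo \<open>1 / N\<close> has exactly \<open>N\<close>
  points, almost everywhere, and on it the functions \<open>x \<mapsto> cis (2 * pi * s * j * x)\<close> form,
  up to a scalar, a Fourier matrix.  So Fourier series in the base point and Fourier inversion
  in the fibre together expand every function on the set.
\<close>

section \<open>Exact tilings of the line by three intervals\<close>

datatype letter = LA | LB | LC

lemma UNIV_letter: "(UNIV :: letter set) = {LA, LB, LC}"
  using letter.exhaust by auto

instance letter :: finite
  by standard (simp add: UNIV_letter)

lemma letter_cases3:
  assumes "X \<noteq> Y" "Y \<noteq> Z" "X \<noteq> (Z::letter)"
  shows "i = X \<or> i = Y \<or> i = Z"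
  using assms by (cases X; cases Y; cases Z; cases i) auto

text \<open>Tile \<open>t\<close> consists of the three intervals \<open>[t + l i, t + l i + w i)\<close>, and every point of the
line lies in exactly one interval of exactly one tile.  Half-open intervals let the right end
of one interval be the left end of the next.\<close>
locale interval_tiling =
  fixes l w :: "letter \<Rightarrow> real" and T :: "real set"
  assumes w_pos: "0 < w i"
    and w_sum: "w LA + w LB + w LC = 1"
    and cover: "\<exists>i t. t \<in> T \<and> t + l i \<le> x \<and> x < t + l i + w i"
    and unique: "\<lbrakk>t \<in> T; t + l i \<le> x; x < t + l i + w i; s \<in> T; s + l j \<le> x; x < s + l j + w j\<rbrakk>
                 \<Longrightarrow> i = j \<and> t = s"
begin

definition starts :: "letter \<Rightarrow> real \<Rightarrow> bool" where
  "starts i x \<longleftrightarrow> x - l i \<in> T"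

lemma starts_tile: "t \<in> T \<Longrightarrow> starts i (t + l i)"
  by (simp add: starts_def)

lemma min_width: obtains m where "0 < m" "\<And>j. m \<le> w j"
proof (rule that[of "min (w LA) (min (w LB) (w LC))"])
  show "min (w LA) (min (w LB) (w LC)) \<le> w j" for j by (cases j) auto
qed (use w_pos in auto)

lemma w_sum_perm:
  assumes "X \<noteq> Y" "Y \<noteq> Z" "X \<noteq> Z"
  shows "w X + w Y + w Z = 1"
  using assms w_sum by (cases X; cases Y; cases Z) auto

lemma starts_cover: "\<exists>i y. starts i y \<and> y \<le> x \<and> x < y + w i"
  using cover[of x] by (metis add_diff_cancel_right' starts_def)

lemma starts_unique:
  assumes "starts i x" "starts j y" "x \<le> z" "z < x + w i" "y \<le> z" "z < y + w j"
  shows "i = j \<and> x = y"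
  using unique[of "x - l i" i z "y - l j" j] assms unfolding starts_def by auto

lemma starts_fun: "starts i x \<Longrightarrow> starts j x \<Longrightarrow> i = j"
  using starts_unique[of i x j x x] w_pos by simp

lemma starts_disjoint: "starts i x \<Longrightarrow> starts j y \<Longrightarrow> x < y \<Longrightarrow> x + w i \<le> y"
  using starts_unique[of i x j y y] w_pos[of j] by force

lemma starts_next:
  assumes "starts i x"
  shows "\<exists>j. starts j (x + w i)"
proof -
  obtain j y where y: "starts j y" "y \<le> x + w i" "x + w i < y + w j"
    using starts_cover by blast
  have "y = x + w i"
  proof (rule ccontr)
    assume "y \<noteq> x + w i"
    hence "i = j \<and> x = y"
      using starts_unique[of i x j y "max x y"] assms y w_pos[of i] by auto
    thus False using y by auto
  qed
  thus ?thesis using y by blast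
qed

lemma starts_prev:
  assumes "starts i x"
  shows "\<exists>j. starts j (x - w j)"
proof -
  obtain m where m: "0 < m" "\<And>j. m \<le> w j" using min_width by blast
  obtain j y where y: "starts j y" "y \<le> x - m / 2" "x - m / 2 < y + w j"
    using starts_cover by blast
  have yx: "y + w j \<le> x"
    using starts_disjoint[OF y(1) assms] y(2) m(1) by fastforce
  obtain k where k: "starts k (y + w j)" using starts_next[OF y(1)] by blast
  have "y + w j = x"
  proof (rule ccontr)
    assume "y + w j \<noteq> x"
    hence "y + w j + w k \<le> x" using starts_disjoint[OF k assms] yx by auto
    thus False using y m(2)[of k] m(1) by linarith
  qed
  thus ?thesis using y(1) by (metis add_diff_cancel_right')
qed

lemma starts_prev_unique: "starts i (x - w i) \<Longrightarrow> starts j (x - w j) \<Longrightarrow> i = j"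
  using starts_unique[of i "x - w i" j "x - w j" "max (x - w i) (x - w j)"] w_pos[of i] w_pos[of j]
  by auto

lemma starts_fill:
  assumes "starts i x" "starts j y" "x < y"
  shows "x + w i \<le> y" "\<exists>k. starts k (x + w i)"
  using starts_disjoint[OF assms] starts_next[OF assms(1)] by auto

text \<open>Two occurrences of \<open>X\<close> at distance \<open>d\<close> come from two tiles that differ by \<open>d\<close>, and these
tiles have a \<open>Y\<close> each.\<close>
lemma tile_gap:
  assumes "starts X x" "starts X (x + d)" "0 < d"
  obtains y where "starts Y y" "starts Y (y + d)" "w Y \<le> d"
proof -
  have "starts Y (x - l X + l Y)" "starts Y (x - l X + l Y + d)"
    using assms unfolding starts_def by (auto simp: algebra_simps)
  moreover from this have "w Y \<le> d" using starts_disjoint[of Y "x - l X + l Y" Y "x - l X + l Y + d"] assms by auto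
  ultimately show ?thesis using that by blast
qed

lemma gap_ge: "starts X x \<Longrightarrow> starts X (x + d) \<Longrightarrow> 0 < d \<Longrightarrow> w Y \<le> d"
  using tile_gap by metis

text \<open>If \<open>X\<close> follows itself, then two tiles differ by \<open>w X\<close>, so the other letters repeat at
distance \<open>w X\<close> and are not longer than \<open>X\<close>.  Shorter letters cannot follow themselves,
because then two tiles would overlap in \<open>X\<close>.  If \<open>Y\<close> were as long as \<open>X\<close> and \<open>Z\<close> shorter,
then only \<open>Z\<close> could start the gap between two \<open>Z\<close>.  So both \<open>Y\<close> and \<open>Z\<close> are shorter than
\<open>X\<close>, and the gap of length \<open>w X - w Y\<close> between two \<open>Y\<close> begins with a \<open>Z\<close>.  It cannot
continue with a \<open>Y\<close>, because \<open>Y Z Y\<close> makes two tiles differ by \<open>w Y + w Z\<close>, which would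
be less than \<open>w X\<close>.\<close>
lemma double_letter:
  assumes XYZ: "X \<noteq> Y" "Y \<noteq> Z" "X \<noteq> Z"
    and XX: "starts X x" "starts X (x + w X)"
    and ne: "\<not> (w X = w Y \<and> w Y = w Z)"
  shows "w X = 1 / 2" "w Y + w Z = 1 / 2"
proof -
  have gen: "w Y < w X" if XYZ: "X \<noteq> Y" "Y \<noteq> Z" "X \<noteq> Z"
      and XX: "starts X x" "starts X (x + w X)"
      and ne: "\<not> (w X = w Y \<and> w Y = w Z)" for X Y Z x
  proof (rule ccontr)
    assume "\<not> w Y < w X"
    moreover have le: "w Y \<le> w X" "w Z \<le> w X"
      using gap_ge[OF XX] w_pos by auto
    ultimately have eq: "w Y = w X" and lt: "w Z < w X" using ne by auto
    obtain z where z: "starts Z z" "starts Z (z + w X)" using tile_gap[OF XX w_pos] by blast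
    obtain k where k: "starts k (z + w Z)" using starts_next[OF z(1)] by blast
    have kle: "w k \<le> w X - w Z" using starts_disjoint[OF k z(2)] lt by linarith
    have "k = Z" using letter_cases3[OF XYZ, of k] kle w_pos[of Z] eq by auto
    hence "w X \<le> w Z" using gap_ge[of Z z "w Z" X] z k w_pos by auto
    thus False using lt by simp
  qed
  have lt: "w Y < w X" "w Z < w X"
    using gen[OF XYZ XX ne] gen[OF XYZ(3) XYZ(2)[symmetric] XYZ(1) XX] ne by auto
  have noY: "\<not> (starts Y y \<and> starts Y (y + w Y))" for y
    using gap_ge[of Y y "w Y" X] lt w_pos[of Y] by auto
  have noZ: "\<not> (starts Z y \<and> starts Z (y + w Z))" for y
    using gap_ge[of Z y "w Z" X] lt w_pos[of Z] by auto
  obtain y where y: "starts Y y" "starts Y (y + w X)" using tile_gap[OF XX w_pos] by blast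
  obtain i where i: "starts i (y + w Y)" using starts_next[OF y(1)] by blast
  have ile: "w i \<le> w X - w Y" using starts_disjoint[OF i y(2)] lt by linarith
  have "i = Z" using letter_cases3[OF XYZ, of i] ile w_pos[of Y] noY[of y] y i by auto
  note i = i[unfolded this] and ile = ile[unfolded this]
  obtain j where j: "starts j (y + w Y + w Z)" using starts_next[OF i] by blast
  have "w X = w Y + w Z"
  proof (rule ccontr)
    assume "w X \<noteq> w Y + w Z"
    hence "y + w Y + w Z < y + w X" using ile by auto
    hence jle: "w j + w Y + w Z \<le> w X" using starts_disjoint[OF j y(2)] by linarith
    have "j = Y" using letter_cases3[OF XYZ, of j] jle w_pos[of Y] w_pos[of Z] noZ[of "y + w Y"] i j by auto
    hence "w X \<le> w Y + w Z"
      using gap_ge[of Y y "w Y + w Z" X] y(1) j w_pos[of Y] w_pos[of Z] by (auto simp: add.assoc)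
    thus False using jle w_pos[of j] by auto
  qed
  thus "w X = 1 / 2" "w Y + w Z = 1 / 2" using w_sum_perm[OF XYZ] by auto
qed

text \<open>The pattern \<open>X Y X\<close> makes two tiles differ by \<open>w X + w Y\<close>.  The first claim reads off the gap
between the two corresponding \<open>Y\<close>, which has length \<open>w X\<close>, the second one the gap between
the two \<open>Z\<close>, which has length \<open>w X + w Y - w Z\<close>.  In both cases a gap filled by more than one
interval contains a pattern \<open>i Z i\<close> or \<open>Y Z Y\<close> whose repetition distance is too short for the
remaining letter.\<close>
lemma alternation:
  assumes XYZ: "X \<noteq> Y" "Y \<noteq> Z" "X \<noteq> Z"
    and simple: "\<And>i x. starts i x \<Longrightarrow> \<not> starts i (x + w i)"
    and XYX: "starts X x" "starts Y (x + w X)" "starts X (x + w X + w Y)"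
  shows "\<exists>y i. starts Y y \<and> starts i (y + w Y) \<and> starts Y (y + w Y + w i) \<and> w i = w X \<and> i \<noteq> Y"
    and "w Y = w Z \<or> w X = w Z"
proof -
  have pos: "0 < w X" "0 < w Y" "0 < w Z" using w_pos by auto
  have d: "0 < w X + w Y" using pos by simp
  note XX = XYX(1) XYX(3)[unfolded add.assoc]
  note cs = letter_cases3[OF XYZ]
  show "\<exists>y i. starts Y y \<and> starts i (y + w Y) \<and> starts Y (y + w Y + w i) \<and> w i = w X \<and> i \<noteq> Y"
  proof -
    obtain y where y: "starts Y y" "starts Y (y + (w X + w Y))" using tile_gap[OF XX d] by blast
    obtain i where i: "starts i (y + w Y)" using starts_next[OF y(1)] by blast
    have iY: "i \<noteq> Y" using i y simple by auto
    have ile: "w i \<le> w X" using starts_disjoint[OF i y(2)] pos by linarith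
    have "w i = w X"
    proof (rule ccontr)
      assume ne: "w i \<noteq> w X"
      hence "i = Z" using cs[of i] iY by auto
      note i = i[unfolded this] and ile = ile[unfolded this] and ne = ne[unfolded this]
      obtain j where j: "starts j (y + w Y + w Z)" using starts_next[OF i] by blast
      have jle: "w j + w Z \<le> w X" using starts_disjoint[OF j y(2)] ile ne by linarith
      have "j = Y" using cs[of j] jle pos simple[OF i] j by auto
      note j = j[unfolded this] and jle = jle[unfolded this]
      have XYZle: "w X \<le> w Y + w Z" using gap_ge[of Y y "w Y + w Z" X] y(1) j pos by (auto simp: add.assoc)
      have "w Y + w Z \<noteq> w X"
      proof
        assume "w Y + w Z = w X"
        hence "y + w Y + w Z + w Y = y + (w X + w Y)" by simp
        thus False using simple[OF j] y(2) by metis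
      qed
      thus False using XYZle jle by linarith
    qed
    moreover from this have "starts Y (y + w Y + w i)" using y(2) by (simp add: algebra_simps)
    ultimately show ?thesis using y(1) i iY by blast
  qed
  show "w Y = w Z \<or> w X = w Z"
  proof (rule ccontr)
    assume neg: "\<not> (w Y = w Z \<or> w X = w Z)"
    obtain z where z: "starts Z z" "starts Z (z + (w X + w Y))" using tile_gap[OF XX d] by blast
    have "w Z \<noteq> w X + w Y" using simple[OF z(1)] z(2) by auto
    hence zlt: "w Z < w X + w Y" using starts_disjoint[OF z] pos by simp
    obtain i where i: "starts i (z + w Z)" using starts_next[OF z(1)] by blast
    have iZ: "i \<noteq> Z" using i z simple by auto
    have ile: "w i + w Z \<le> w X + w Y" using starts_disjoint[OF i z(2)] zlt by linarith
    \<comment> \<open>The gap between the two \<open>Z\<close> has a length symmetric in \<open>X\<close> and \<open>Y\<close>;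
      \<open>i\<close> is the one of them that starts it.\<close>
    obtain i' where i': "i' \<noteq> i" "i' \<noteq> Z" "w i + w i' = w X + w Y"
    proof (cases "i = X")
      case True thus ?thesis using that[of Y] XYZ by auto
    next
      case False hence "i = Y" using cs[of i] iZ by auto
      thus ?thesis using that[of X] XYZ by (auto simp: add.commute)
    qed
    note cs' = letter_cases3[OF i'(1)[symmetric] i'(2) iZ]
    have neg': "w i' \<noteq> w Z" using neg i' iZ cs by metis
    obtain j where j: "starts j (z + w Z + w i)" using starts_next[OF i] by blast
    have jlt: "z + w Z + w i < z + (w X + w Y)" using ile neg' i'(3) by linarith
    have jle: "w j + w i + w Z \<le> w X + w Y" using starts_disjoint[OF j z(2)] jlt by linarith
    have "j = Z" using cs'[of j] simple[OF i] j jle i'(3) pos by auto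
    note j = j[unfolded this] and jle = jle[unfolded this]
    obtain k where k: "starts k (z + w Z + w i + w Z)" using starts_next[OF j] by blast
    have "w Z + w i + w Z \<noteq> w X + w Y" using simple[OF j] z(2) by (auto simp: add.assoc)
    hence "z + w Z + w i + w Z < z + (w X + w Y)" using jle by linarith
    hence kle: "w k + w Z + w i + w Z \<le> w X + w Y" using starts_disjoint[OF k z(2)] by linarith
    have "k = i" using cs'[of k] simple[OF j] k kle i'(3) pos w_pos[of i] by auto
    note k = k[unfolded this]
    have "w i' \<le> w i + w Z"
      using gap_ge[of i "z + w Z" "w i + w Z" i'] i k w_pos[of i] pos by (auto simp: add.assoc)
    thus False using kle i'(3) \<open>k = i\<close> pos by auto
  qed
qed

end

section \<open>Periodicity\<close>

lemma periodic_int_multiple: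
  fixes f :: "'a::ring_1 \<Rightarrow> 'b"
  assumes "\<And>x. f (x + d) = f x"
  shows "f (x + of_int k * d) = f x"
proof -
  have nat: "f (x + of_nat n * d) = f x" for n x
  proof (induction n)
    case (Suc n)
    have e: "x + of_nat (Suc n) * d = (x + of_nat n * d) + d" by (simp add: algebra_simps)
    show ?case unfolding e assms Suc ..
  qed simp
  show ?thesis
  proof (cases "k \<ge> 0")
    case True thus ?thesis using nat[of x "nat k"] by simp
  next
    case False thus ?thesis using nat[of "x + of_int k * d" "nat (- k)"] by simp
  qed
qed

lemma int_shift_periodic:
  fixes \<tau> :: real
  assumes "\<And>x. x + \<tau> \<in> E \<longleftrightarrow> x \<in> E"
  shows "x + of_int k * \<tau> \<in> E \<longleftrightarrow> x \<in> E"
  by (rule periodic_int_multiple[of "\<lambda>x. x \<in> E", OF assms])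

lemma no_int_strictly_between: "\<not> (of_int k < (of_int n :: real) \<and> of_int n < (of_int k + 1 :: real))"
proof
  assume n: "of_int k < (of_int n :: real) \<and> of_int n < (of_int k + 1 :: real)"
  have "real_of_int n < of_int (k + 1)" unfolding of_int_add of_int_1 by (rule conjunct2[OF n])
  hence "n < k + 1" by (simp only: of_int_less_iff)
  moreover have "k < n" using n by simp
  ultimately show False by linarith
qed

lemma period_representative:
  fixes \<tau> :: real
  assumes "0 < \<tau>"
  shows "x + of_int (- \<lfloor>x / \<tau>\<rfloor>) * \<tau> \<in> {0..<\<tau>}"
  using floor_divide_lower[OF assms, of x] floor_divide_upper[OF assms, of x]
  by (auto simp: algebra_simps)

text \<open>A bijection between two periodic sets that commutes with the period induces a bijection of the
orbits under the period, so it preserves sums over one period.\<close>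
lemma sum_over_period:
  fixes \<tau> :: real and g :: "real \<Rightarrow> 'b::comm_monoid_add"
  assumes \<tau>: "0 < \<tau>"
    and E: "\<And>x. x + \<tau> \<in> E \<longleftrightarrow> x \<in> E"
    and bij: "bij_betw \<phi> E E'"
    and eqv: "\<And>x. x \<in> E \<Longrightarrow> \<phi> (x + \<tau>) = \<phi> x + \<tau>"
    and g: "\<And>x. x \<in> E' \<Longrightarrow> g (x + \<tau>) = g x"
  shows "(\<Sum>x\<in>E \<inter> {0..<\<tau>}. g (\<phi> x)) = (\<Sum>x\<in>E' \<inter> {0..<\<tau>}. g x)"
proof -
  define r where "r x = x + of_int (- \<lfloor>x / \<tau>\<rfloor>) * \<tau>" for x
  have r_range: "r x \<in> {0..<\<tau>}" for x
    unfolding r_def by (rule period_representative[OF \<tau>])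
  have EI: "x + of_int k * \<tau> \<in> E \<longleftrightarrow> x \<in> E" for x k
    using int_shift_periodic[OF E] .
  have eqvN: "\<phi> (x + real n * \<tau>) = \<phi> x + real n * \<tau>" if "x \<in> E" for x n
  proof (induction n)
    case (Suc n)
    have e: "x + real (Suc n) * \<tau> = (x + real n * \<tau>) + \<tau>" by (simp add: algebra_simps)
    have "x + real n * \<tau> \<in> E" using EI[of x "int n"] that by simp
    from eqv[OF this] show ?case unfolding e Suc by (simp add: algebra_simps)
  qed simp
  have eqvI: "\<phi> (x + of_int k * \<tau>) = \<phi> x + of_int k * \<tau>" if "x \<in> E" for x k
  proof (cases "k \<ge> 0")
    case True thus ?thesis using eqvN[OF that, of "nat k"] by simp
  next
    case False
    thus ?thesis using eqvN[of "x + of_int k * \<tau>" "nat (- k)"] EI[of x k] that by simp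
  qed
  have memE': "x + of_int k * \<tau> \<in> E'" if "x \<in> E'" for x k
  proof -
    obtain y where "y \<in> E" "\<phi> y = x" using bij \<open>x \<in> E'\<close> unfolding bij_betw_def by auto
    thus ?thesis using eqvI[of y k] EI[of y k] bij unfolding bij_betw_def by (metis imageI)
  qed
  have gN: "g (x + real n * \<tau>) = g x" if "x \<in> E'" for x n
  proof (induction n)
    case (Suc n)
    have e: "x + real (Suc n) * \<tau> = (x + real n * \<tau>) + \<tau>" by (simp add: algebra_simps)
    have "x + real n * \<tau> \<in> E'" using memE'[of x "int n"] that by simp
    from g[OF this] show ?case unfolding e Suc .
  qed simp
  have gI: "g (x + of_int k * \<tau>) = g x" if "x \<in> E'" for x k
  proof (cases "k \<ge> 0")
    case True thus ?thesis using gN[OF that, of "nat k"] by simp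
  next
    case False
    thus ?thesis using gN[of "x + of_int k * \<tau>" "nat (- k)"] memE'[OF that, of k] by simp
  qed
  have close: "k = 0" if "x \<in> {0..<\<tau>}" "x + of_int k * \<tau> \<in> {0..<\<tau>}" for x and k :: int
  proof (rule ccontr)
    assume "k \<noteq> 0"
    hence "k \<ge> 1 \<or> k \<le> - 1" by linarith
    thus False
    proof
      assume "k \<ge> 1"
      hence "1 * \<tau> \<le> of_int k * \<tau>" using \<tau> by (intro mult_right_mono) auto
      thus False using that by auto
    next
      assume "k \<le> - 1"
      hence "of_int k \<le> (- 1 :: real)" by linarith
      hence "of_int k * \<tau> \<le> (-1) * \<tau>" using \<tau> by (intro mult_right_mono) auto
      thus False using that by auto
    qed
  qed
  have "bij_betw (\<lambda>x. r (\<phi> x)) (E \<inter> {0..<\<tau>}) (E' \<inter> {0..<\<tau>})"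
    unfolding bij_betw_def
  proof (intro conjI)
    show "inj_on (\<lambda>x. r (\<phi> x)) (E \<inter> {0..<\<tau>})"
    proof (rule inj_onI)
      fix x y assume x: "x \<in> E \<inter> {0..<\<tau>}" and y: "y \<in> E \<inter> {0..<\<tau>}" and eq: "r (\<phi> x) = r (\<phi> y)"
      define k where "k = \<lfloor>\<phi> x / \<tau>\<rfloor> - \<lfloor>\<phi> y / \<tau>\<rfloor>"
      have "\<phi> x = \<phi> y + of_int k * \<tau>" using eq unfolding r_def k_def by (simp add: algebra_simps)
      hence "\<phi> x = \<phi> (y + of_int k * \<tau>)" using eqvI[of y k] y by simp
      hence xy: "x = y + of_int k * \<tau>"
        using bij x y EI[of y k] unfolding bij_betw_def by (auto dest: inj_onD)
      hence "k = 0" using close[of y k] x y by auto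
      thus "x = y" using xy by simp
    qed
    show "(\<lambda>x. r (\<phi> x)) ` (E \<inter> {0..<\<tau>}) = E' \<inter> {0..<\<tau>}"
    proof
      show "(\<lambda>x. r (\<phi> x)) ` (E \<inter> {0..<\<tau>}) \<subseteq> E' \<inter> {0..<\<tau>}"
      proof clarify
        fix x assume x: "x \<in> E"
        have "\<phi> x \<in> E'" using bij x unfolding bij_betw_def by auto
        thus "r (\<phi> x) \<in> E' \<inter> {0..<\<tau>}" using r_range memE' unfolding r_def by blast
      qed
      show "E' \<inter> {0..<\<tau>} \<subseteq> (\<lambda>x. r (\<phi> x)) ` (E \<inter> {0..<\<tau>})"
      proof
        fix z assume z: "z \<in> E' \<inter> {0..<\<tau>}"
        then obtain x where x: "x \<in> E" "z = \<phi> x" using bij unfolding bij_betw_def by auto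
        define y where "y = r x"
        have y: "y \<in> E \<inter> {0..<\<tau>}" unfolding y_def using r_range x EI unfolding r_def by blast
        have e: "\<phi> y = z + of_int (- \<lfloor>x / \<tau>\<rfloor>) * \<tau>" unfolding y_def r_def x(2) by (rule eqvI[OF x(1)])
        define k where "k = - \<lfloor>\<phi> y / \<tau>\<rfloor> - \<lfloor>x / \<tau>\<rfloor>"
        have "r (\<phi> y) = z + of_int k * \<tau>" unfolding r_def k_def e by (simp add: algebra_simps)
        moreover from this have "k = 0" using close[of z k] z r_range[of "\<phi> y"] by auto
        ultimately have "r (\<phi> y) = z" by simp
        thus "z \<in> (\<lambda>x. r (\<phi> x)) ` (E \<inter> {0..<\<tau>})" using y by (auto intro!: image_eqI)
      qed
    qed
  qed
  from sum.reindex_bij_betw[OF this, of g]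
  have "(\<Sum>x\<in>E \<inter> {0..<\<tau>}. g (r (\<phi> x))) = (\<Sum>x\<in>E' \<inter> {0..<\<tau>}. g x)" .
  moreover have "g (r (\<phi> x)) = g (\<phi> x)" if "x \<in> E" for x
    unfolding r_def using gI that bij unfolding bij_betw_def by blast
  ultimately show ?thesis by (metis (no_types, lifting) IntD1 sum.cong)
qed

lemma finite_separated_Int:
  fixes T :: "real set"
  assumes m: "0 < m" and sep: "\<And>s t. s \<in> T \<Longrightarrow> t \<in> T \<Longrightarrow> s < t \<Longrightarrow> s + m \<le> t"
  shows "finite (T \<inter> {a..b})"
proof -
  have "inj_on (\<lambda>t. \<lfloor>t / m\<rfloor>) (T \<inter> {a..b})"
  proof (rule linorder_inj_onI')
    fix s t assume "s \<in> T \<inter> {a..b}" "t \<in> T \<inter> {a..b}" "s < t"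
    hence "s + m \<le> t" using sep by auto
    hence "(s + m) / m \<le> t / m" using m by (intro divide_right_mono) auto
    hence "s / m + 1 \<le> t / m" using m by (simp add: add_divide_distrib)
    hence "\<lfloor>s / m\<rfloor> + 1 \<le> \<lfloor>t / m\<rfloor>" by linarith
    thus "\<lfloor>s / m\<rfloor> \<noteq> \<lfloor>t / m\<rfloor>" by simp
  qed
  moreover have "(\<lambda>t. \<lfloor>t / m\<rfloor>) ` (T \<inter> {a..b}) \<subseteq> {\<lfloor>a / m\<rfloor>..\<lfloor>b / m\<rfloor>}"
    using m by (auto intro!: floor_mono divide_right_mono)
  ultimately show ?thesis by (meson finite_atLeastAtMost_int inj_on_finite)
qed

context interval_tiling
begin

lemma T_separated: "s \<in> T \<Longrightarrow> t \<in> T \<Longrightarrow> s < t \<Longrightarrow> s + w i \<le> t"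
  using starts_disjoint[OF starts_tile starts_tile, of s t i i] by simp

lemma finite_T: "finite (T \<inter> {a..b})"
  by (rule finite_separated_Int[OF w_pos]) (rule T_separated)

text \<open>Two boundaries are joined by a chain of adjacent intervals.\<close>
lemma starts_diff:
  assumes "starts i x" "starts j y" "x \<le> y"
  shows "\<exists>n1 n2 n3. y - x = real n1 * w LA + real n2 * w LB + real n3 * w LC"
proof -
  obtain m where m: "0 < m" "\<And>j. m \<le> w j" using min_width by blast
  have "\<exists>n1 n2 n3. y - x = real n1 * w LA + real n2 * w LB + real n3 * w LC"
    if "starts i x" "x \<le> y" "y - x < real k * m" for k i x
    using that
  proof (induction k arbitrary: i x)
    case (Suc k)
    show ?case
    proof (cases "x = y")
      case True thus ?thesis by (auto intro!: exI[of _ 0])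
    next
      case False
      hence "x < y" using Suc by simp
      from starts_fill[OF Suc(2) assms(2) this]
      obtain k' where k': "starts k' (x + w i)" "x + w i \<le> y" by auto
      have "y - (x + w i) < real k * m" using Suc(4) m(2)[of i] by (simp add: algebra_simps)
      from Suc(1)[OF k' this] obtain n1 n2 n3
        where n: "y - (x + w i) = real n1 * w LA + real n2 * w LB + real n3 * w LC" by blast
      show ?thesis
      proof (cases i)
        case LA thus ?thesis using n
          by (intro exI[of _ "Suc n1"] exI[of _ n2] exI[of _ n3]) (auto simp: algebra_simps)
      next
        case LB thus ?thesis using n
          by (intro exI[of _ n1] exI[of _ "Suc n2"] exI[of _ n3]) (auto simp: algebra_simps)
      next
        case LC thus ?thesis using n
          by (intro exI[of _ n1] exI[of _ n2] exI[of _ "Suc n3"]) (auto simp: algebra_simps)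
      qed
    qed
  qed simp
  moreover obtain k :: nat where "y - x < real k * m" using m(1) reals_Archimedean3 by blast
  ultimately show ?thesis using assms by blast
qed

text \<open>By \<open>starts_diff\<close> only finitely many local configurations of a given size occur; this is the
finiteness behind periodicity.\<close>
lemma finite_differences: "finite {d. 0 \<le> d \<and> d \<le> D \<and> (\<exists>t\<in>T. t + d \<in> T)}"
proof -
  obtain m where m: "0 < m" "\<And>j. m \<le> w j" using min_width by blast
  define K where "K = nat \<lceil>D / m\<rceil>"
  have K: "n \<le> K" if "real n * w i \<le> D" for n i
  proof -
    have "real n * m \<le> D" using that m(2)[of i] by (smt (verit) mult_left_mono of_nat_0_le_iff)
    hence "real n \<le> D / m" using m(1) by (simp add: field_simps)
    thus ?thesis unfolding K_def by linarith
  qed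
  have "{d. 0 \<le> d \<and> d \<le> D \<and> (\<exists>t\<in>T. t + d \<in> T)}
    \<subseteq> (\<lambda>(n1, n2, n3). real n1 * w LA + real n2 * w LB + real n3 * w LC) ` ({..K} \<times> {..K} \<times> {..K})"
  proof clarify
    fix d t assume d: "0 \<le> d" "d \<le> D" "t \<in> T" "t + d \<in> T"
    obtain n1 n2 n3 where n: "d = real n1 * w LA + real n2 * w LB + real n3 * w LC"
      using starts_diff[OF starts_tile[OF d(3), of LA] starts_tile[OF d(4), of LA]] d(1) by auto
    have "0 \<le> real n1 * w LA" "0 \<le> real n2 * w LB" "0 \<le> real n3 * w LC"
      using w_pos by (auto intro!: mult_nonneg_nonneg simp: less_imp_le)
    hence "n1 \<le> K" "n2 \<le> K" "n3 \<le> K" using K n d(2) by (smt (verit))+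
    thus "d \<in> (\<lambda>(n1, n2, n3). real n1 * w LA + real n2 * w LB + real n3 * w LC) ` ({..K} \<times> {..K} \<times> {..K})"
      using n by (auto intro!: image_eqI[of _ _ "(n1, n2, n3)"])
  qed
  thus ?thesis by (rule finite_subset) auto
qed

lemma T_unbounded: "\<exists>t\<in>T. x < t"
proof -
  obtain i t where "t \<in> T" "x + \<bar>l LA + w LA\<bar> + \<bar>l LB + w LB\<bar> + \<bar>l LC + w LC\<bar> < t + l i + w i"
    using cover by blast
  moreover have "l i + w i \<le> \<bar>l LA + w LA\<bar> + \<bar>l LB + w LB\<bar> + \<bar>l LC + w LC\<bar>"
    by (cases i) auto
  ultimately show ?thesis by (intro bexI[of _ t]) auto
qed

lemma infinite_T: "infinite T"
proof
  assume "finite T"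
  then obtain b where "\<forall>t\<in>T. t \<le> b" using bdd_above_finite[of T] unfolding bdd_above_def by blast
  thus False using T_unbounded[of b] by fastforce
qed

end

text \<open>In a tiling, the first tile that is placed to the right of a known configuration is forced:
if two tilings agree far enough to the left of \<open>d\<close>, then the leftmost interval of tile \<open>d\<close>
of the one is covered in the other by a tile placed before \<open>d\<close>, and that tile belongs to both.\<close>
lemma tiling_forward_step:
  assumes "interval_tiling l w T" "interval_tiling l w S"
    and D: "\<And>i j. l i + w i - l j \<le> D"
    and d: "d \<in> T" "d \<notin> S" "y + D \<le> d"
    and agree: "\<And>t. y \<le> t \<Longrightarrow> t < d \<Longrightarrow> t \<in> S \<Longrightarrow> t \<in> T"
  shows False
proof -
  interpret T: interval_tiling l w T by fact
  interpret S: interval_tiling l w S by fact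
  have "\<exists>i. \<forall>j. l i \<le> l j"
    by (rule exI[of _ "if l LA \<le> l LB \<and> l LA \<le> l LC then LA else if l LB \<le> l LC then LB else LC"])
      (rule allI, case_tac j, auto)
  then obtain i where i: "\<And>j. l i \<le> l j" by blast
  obtain j s where s: "s \<in> S" "s + l j \<le> d + l i" "d + l i < s + l j + w j"
    using S.cover by blast
  have "s \<noteq> d" using s d by auto
  hence "s < d" using s(2) i[of j] by simp
  moreover have "y \<le> s" using s(3) D[of j i] d(3) by simp
  ultimately have "s \<in> T" using agree s(1) by auto
  thus False using T.unique[of d i "d + l i" s j] d(1) s T.w_pos[of i] \<open>s \<noteq> d\<close> by simp
qed

text \<open>The mirror image of \<open>tiling_forward_step\<close>.  Since the intervals are closed on the left, the
rightmost interval of tile \<open>d\<close> is tested at a point just below its right end, close enough to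
exclude tiles of the other tiling that precede \<open>d\<close> by a little.\<close>
lemma tiling_backward_step:
  assumes "interval_tiling l w T" "interval_tiling l w S"
    and D: "\<And>i j. l i + w i - l j \<le> D"
    and d: "d \<in> T" "d \<notin> S" "d + D \<le> y"
    and agree: "\<And>t. d < t \<Longrightarrow> t \<le> y \<Longrightarrow> t \<in> S \<Longrightarrow> t \<in> T"
  shows False
proof -
  interpret T: interval_tiling l w T by fact
  interpret S: interval_tiling l w S by fact
  have "\<exists>i. \<forall>j. l j + w j \<le> l i + w i"
    by (rule exI[of _ "if l LA + w LA \<ge> l LB + w LB \<and> l LA + w LA \<ge> l LC + w LC then LA
          else if l LB + w LB \<ge> l LC + w LC then LB else LC"])
      (rule allI, case_tac j, auto)
  then obtain i where i: "\<And>j. l j + w j \<le> l i + w i" by blast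
  define F where "F = S \<inter> {d - 1..d}"
  have F: "finite F" "d \<notin> F" unfolding F_def using S.finite_T d(2) by auto
  obtain \<epsilon> where \<epsilon>: "0 < \<epsilon>" "\<epsilon> \<le> 1" "\<epsilon> \<le> w i" "\<And>t. t \<in> S \<Longrightarrow> \<not> (d - \<epsilon> < t \<and> t < d)"
  proof -
    define \<epsilon> where "\<epsilon> = Min (insert 1 (insert (w i) ((\<lambda>t. d - t) ` F)))"
    have le: "\<epsilon> \<le> 1" "\<epsilon> \<le> w i" "\<And>t. t \<in> F \<Longrightarrow> \<epsilon> \<le> d - t"
      unfolding \<epsilon>_def using F(1) by (intro Min_le; simp)+
    have "t < d" if "t \<in> F" for t
      using that F(2) unfolding F_def by (cases "t = d") auto
    hence "0 < \<epsilon>" unfolding \<epsilon>_def using F(1) T.w_pos[of i] by (subst Min_gr_iff) auto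
    moreover have "\<not> (d - \<epsilon> < t \<and> t < d)" if "t \<in> S" for t
      using le(1) le(3)[of t] that unfolding F_def by force
    ultimately show ?thesis using that le by blast
  qed
  define x where "x = d + l i + w i - \<epsilon> / 2"
  obtain j s where s: "s \<in> S" "s + l j \<le> x" "x < s + l j + w j"
    using S.cover by blast
  have "d - \<epsilon> < s" using s(3) i[of j] \<epsilon>(1) unfolding x_def by simp
  hence "d < s" using \<epsilon>(4)[OF s(1)] s(1) d(2) by (cases "s = d") auto
  moreover have "s \<le> y" using s(2) D[of i j] d(3) \<epsilon>(1) unfolding x_def by simp
  ultimately have "s \<in> T" using agree s(1) by auto
  thus False using T.unique[of d i x s j] d(1) s \<epsilon> \<open>d < s\<close> unfolding x_def by simp
qed

lemma tilings_agree:
  assumes T: "interval_tiling l w T" and S: "interval_tiling l w S"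
    and D: "\<And>i j. l i + w i - l j \<le> D"
    and agree: "\<And>t. y \<le> t \<Longrightarrow> t \<le> y + D \<Longrightarrow> t \<in> T \<longleftrightarrow> t \<in> S"
  shows "T = S"
proof -
  interpret T: interval_tiling l w T by fact
  interpret S: interval_tiling l w S by fact
  have right: "z \<in> T \<longleftrightarrow> z \<in> S" if "y \<le> z" for z
  proof (rule ccontr)
    assume neg: "\<not> (z \<in> T \<longleftrightarrow> z \<in> S)"
    define G where "G = {t \<in> (T \<inter> {y..z}) \<union> (S \<inter> {y..z}). \<not> (t \<in> T \<longleftrightarrow> t \<in> S)}"
    have fin: "finite G"
      by (rule finite_subset[of _ "(T \<inter> {y..z}) \<union> (S \<inter> {y..z})"])
        (use T.finite_T S.finite_T in \<open>auto simp: G_def\<close>)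
    have ne: "G \<noteq> {}" unfolding G_def using neg that by auto
    define d where "d = Min G"
    have d: "d \<in> G" unfolding d_def using Min_in fin ne by blast
    have min: "\<And>t. t \<in> G \<Longrightarrow> d \<le> t" unfolding d_def using fin by auto
    have dy: "y + D \<le> d" using d agree[of d] unfolding G_def by force
    have ag: "t \<in> T \<longleftrightarrow> t \<in> S" if "y \<le> t" "t < d" for t
      using min[of t] that d unfolding G_def by force
    have "d \<in> T \<and> d \<notin> S \<or> d \<in> S \<and> d \<notin> T" using d unfolding G_def by auto
    thus False
      using tiling_forward_step[OF T S D _ _ dy] tiling_forward_step[OF S T D _ _ dy] ag by blast
  qed
  have left: "z \<in> T \<longleftrightarrow> z \<in> S" if "z \<le> y + D" for z
  proof (rule ccontr)
    assume neg: "\<not> (z \<in> T \<longleftrightarrow> z \<in> S)"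
    define G where "G = {t \<in> (T \<inter> {z..y + D}) \<union> (S \<inter> {z..y + D}). \<not> (t \<in> T \<longleftrightarrow> t \<in> S)}"
    have fin: "finite G"
      by (rule finite_subset[of _ "(T \<inter> {z..y + D}) \<union> (S \<inter> {z..y + D})"])
        (use T.finite_T S.finite_T in \<open>auto simp: G_def\<close>)
    have ne: "G \<noteq> {}" unfolding G_def using neg that by auto
    define d where "d = Max G"
    have d: "d \<in> G" unfolding d_def using Max_in fin ne by blast
    have max: "\<And>t. t \<in> G \<Longrightarrow> t \<le> d" unfolding d_def using fin by auto
    have dy: "d + D \<le> y + D" using d agree[of d] unfolding G_def by force
    have ag: "t \<in> T \<longleftrightarrow> t \<in> S" if "d < t" "t \<le> y + D" for t
      using max[of t] that d unfolding G_def by force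
    have "d \<in> T \<and> d \<notin> S \<or> d \<in> S \<and> d \<notin> T" using d unfolding G_def by auto
    thus False
      using tiling_backward_step[OF T S D _ _ dy] tiling_backward_step[OF S T D _ _ dy] ag by blast
  qed
  have "0 < D" using D[of LA LA] T.w_pos[of LA] by simp
  hence "z \<in> T \<longleftrightarrow> z \<in> S" for z
    using left[of z] right[of z] by (cases "y \<le> z") auto
  thus ?thesis by auto
qed

context interval_tiling
begin

lemma shifted_tiling: "interval_tiling l w {x. x + \<tau> \<in> T}"
proof
  show "0 < w i" for i using w_pos .
  show "w LA + w LB + w LC = 1" using w_sum .
  show "\<exists>i t. t \<in> {x. x + \<tau> \<in> T} \<and> t + l i \<le> x \<and> x < t + l i + w i" for x
  proof -
    obtain i t where "t \<in> T" "t + l i \<le> x + \<tau>" "x + \<tau> < t + l i + w i" using cover by blast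
    thus ?thesis by (intro exI[of _ i] exI[of _ "t - \<tau>"]) auto
  qed
  show "i = j \<and> t = s"
    if "t \<in> {x. x + \<tau> \<in> T}" "t + l i \<le> x" "x < t + l i + w i"
      "s \<in> {x. x + \<tau> \<in> T}" "s + l j \<le> x" "x < s + l j + w j" for t i x s j
    using unique[of "t + \<tau>" i "x + \<tau>" "s + \<tau>" j] that by auto
qed

text \<open>Finitely many local configurations and infinitely many tiles: two tiles \<open>s < t\<close> see the same
configuration to their right.  It determines the tiling in both directions, so the tiling is
invariant under \<open>t - s\<close>.\<close>
theorem periodic: "\<exists>\<tau>>0. \<forall>x. x + \<tau> \<in> T \<longleftrightarrow> x \<in> T"
proof -
  define D where "D = (\<Sum>i\<in>UNIV. \<Sum>j\<in>UNIV. \<bar>l i + w i - l j\<bar>)"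
  have D: "l i + w i - l j \<le> D" for i j
  proof -
    have "l i + w i - l j \<le> \<bar>l i + w i - l j\<bar>" by simp
    also have "\<dots> \<le> (\<Sum>j\<in>UNIV. \<bar>l i + w i - l j\<bar>)"
      by (rule member_le_sum) auto
    also have "\<dots> \<le> D" unfolding D_def
      by (rule member_le_sum) (auto intro: sum_nonneg)
    finally show ?thesis .
  qed
  define W where "W t = {d. 0 \<le> d \<and> d \<le> D \<and> t + d \<in> T}" for t
  have "W ` T \<subseteq> Pow {d. 0 \<le> d \<and> d \<le> D \<and> (\<exists>t\<in>T. t + d \<in> T)}" unfolding W_def by auto
  hence "finite (W ` T)" by (rule finite_subset) (simp add: finite_differences)
  hence "\<not> inj_on W T" using infinite_T finite_imageD[of W T] by auto
  then obtain a b where ab: "a \<in> T" "b \<in> T" "a \<noteq> b" "W a = W b"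
    unfolding inj_on_def by blast
  obtain s t where st: "s \<in> T" "t \<in> T" "s < t" "W s = W t"
  proof (cases "a < b")
    case True thus ?thesis using that[of a b] ab by simp
  next
    case False thus ?thesis using that[of b a] ab by simp
  qed
  define \<tau> where "\<tau> = t - s"
  have "T = {x. x + \<tau> \<in> T}"
  proof (rule tilings_agree[of l w _ _ D s])
    show "x \<in> T \<longleftrightarrow> x \<in> {x. x + \<tau> \<in> T}" if "s \<le> x" "x \<le> s + D" for x
    proof -
      have "x - s \<in> W s \<longleftrightarrow> x - s \<in> W t" using st by simp
      thus ?thesis using that unfolding W_def \<tau>_def by (auto simp: algebra_simps)
    qed
  qed (use D shifted_tiling interval_tiling_axioms in auto)
  thus ?thesis using st unfolding \<tau>_def by (intro exI[of _ "t - s"]) auto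
qed

end

section \<open>Integer tiles with two or three elements\<close>

text \<open>The periods of \<open>F\<close> form a group.\<close>
lemma gcd_multiple_invariant:
  fixes F :: "int \<Rightarrow> bool"
  assumes m: "\<And>k. F (k - c * m) = F k" and q: "\<And>k. F (k - c * q) = F k"
    and dvd: "c * gcd m q dvd d"
  shows "F (k - d) = F k"
proof -
  obtain u v where uv: "u * m + v * q = gcd m q" using bezout_int by blast
  obtain j where j: "d = c * gcd m q * j" using dvd by blast
  have e: "k - d = (k + of_int (u * j) * (- (c * m))) + of_int (v * j) * (- (c * q))"
    unfolding j uv[symmetric] by (simp add: algebra_simps)
  show ?thesis
    unfolding e using m q
    by (subst periodic_int_multiple[of F], simp, subst periodic_int_multiple[of F]) simp_all
qed

text \<open>Here \<open>F\<close> is the set of translations of the tile \<open>{0, m}\<close> and of the tile \<open>{0, q}\<close> at the same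
time.  The conclusion says that \<open>m\<close> and \<open>q\<close> contain the same power of \<open>2\<close>: otherwise one
of them is an even multiple of the gcd and therefore a period of \<open>F\<close>.\<close>
lemma two_element_tile:
  fixes F :: "int \<Rightarrow> bool"
  assumes m: "\<And>k. F (k - m) = (\<not> F k)" and q: "\<And>k. F (k - q) = (\<not> F k)"
  shows "\<not> 2 * gcd m q dvd m" "\<not> 2 * gcd m q dvd q"
proof -
  have "F (k - 2 * m) = F k" "F (k - 2 * q) = F k" for k
    using m[of "k - m"] m[of k] q[of "k - q"] q[of k] by (simp_all add: algebra_simps)
  note inv = gcd_multiple_invariant[of F 2 m q, OF this]
  show "\<not> 2 * gcd m q dvd m" using inv[of m 0] m[of 0] by auto
  show "\<not> 2 * gcd m q dvd q" using inv[of q 0] q[of 0] by auto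
qed

text \<open>Here \<open>F\<close> is the set of translations of the tile \<open>{0, m, q}\<close>.  Convolving the indicator function
\<open>f\<close> of \<open>F\<close> three times with the tile gives the constant \<open>9\<close>.  Modulo \<open>3\<close> the cube of
\<open>1 + x ^ m + x ^ q\<close> is \<open>1 + x ^ (3 * m) + x ^ (3 * q)\<close>, so \<open>3\<close> divides the sum of three values of \<open>f\<close>; as
these are \<open>0\<close> or \<open>1\<close>, they coincide.  Thus \<open>3 * m\<close> and \<open>3 * q\<close> are periods of \<open>F\<close>, but
none of \<open>m\<close>, \<open>q\<close>, \<open>m - q\<close> is.\<close>
lemma three_element_tile:
  fixes F :: "int \<Rightarrow> bool"
  assumes E: "\<And>k. of_bool (F k) + of_bool (F (k - m)) + of_bool (F (k - q)) = (1::int)"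
  shows "\<not> 3 * gcd m q dvd m" "\<not> 3 * gcd m q dvd q" "\<not> 3 * gcd m q dvd m - q"
proof -
  define f :: "int \<Rightarrow> int" where "f k = of_bool (F k)" for k
  have f: "f k + f (k - m) + f (k - q) = 1" for k using E unfolding f_def .
  have f01: "f k = 0 \<or> f k = 1" for k unfolding f_def by simp
  have cube: "f (k - 3 * m) = f k \<and> f (k - 3 * q) = f k" for k
  proof -
    have "f k + f (k - m) + f (k - q) = 1"
      "f (k - m) + f (k - 2 * m) + f (k - m - q) = 1"
      "f (k - q) + f (k - m - q) + f (k - 2 * q) = 1"
      "f (k - 2 * m) + f (k - 3 * m) + f (k - 2 * m - q) = 1"
      "f (k - 2 * q) + f (k - m - 2 * q) + f (k - 3 * q) = 1"
      "f (k - m - q) + f (k - 2 * m - q) + f (k - m - 2 * q) = 1"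
      using f[of k] f[of "k - m"] f[of "k - q"] f[of "k - 2 * m"] f[of "k - 2 * q"] f[of "k - m - q"]
      by (simp_all add: algebra_simps)
    hence "f k + f (k - 3 * m) + f (k - 3 * q)
      = 9 - 3 * (f (k - m) + f (k - q) + f (k - 2 * m) + f (k - 2 * q) + 2 * f (k - m - q)
        + f (k - 2 * m - q) + f (k - m - 2 * q))"
      by algebra
    hence "3 dvd f k + f (k - 3 * m) + f (k - 3 * q)" by presburger
    thus ?thesis using f01[of k] f01[of "k - 3 * m"] f01[of "k - 3 * q"] by auto
  qed
  have "F (k - 3 * m) = F k" "F (k - 3 * q) = F k" for k
    using cube[of k] unfolding f_def by (auto split: if_splits simp: of_bool_def)
  note inv = gcd_multiple_invariant[of F 3 m q, OF this]
  have inv: "f (k - d) = f k" if "3 * gcd m q dvd d" for d k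
    using inv[OF that] unfolding f_def by simp
  obtain k where k: "f k = 1"
    using f[of 0] f01[of 0] f01[of "- m"] f01[of "- q"] by auto
  show "\<not> 3 * gcd m q dvd m"
    using inv[of m k] f[of k] k f01[of "k - q"] by auto
  show "\<not> 3 * gcd m q dvd q"
    using inv[of q k] f[of k] k f01[of "k - m"] by auto
  show "\<not> 3 * gcd m q dvd m - q"
    using inv[of "m - q" "k"] f[of "k + q"] f[of "k + m"] k f01[of "k + q"] f01[of "k - m + q"]
    by (auto simp: algebra_simps)
qed

section \<open>Counting patterns over one period\<close>

locale periodic_tiling = interval_tiling +
  fixes \<tau> :: real
  assumes \<tau>_pos: "0 < \<tau>" and T_periodic: "x + \<tau> \<in> T \<longleftrightarrow> x \<in> T"
begin

definition per :: "real set \<Rightarrow> bool" where "per E \<longleftrightarrow> (\<forall>x. x + \<tau> \<in> E \<longleftrightarrow> x \<in> E)"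

definition cnt :: "real set \<Rightarrow> nat" where "cnt E = card (E \<inter> {0..<\<tau>})"

lemma starts_periodic: "starts i (x + \<tau>) \<longleftrightarrow> starts i x"
  using T_periodic[of "x - l i"] unfolding starts_def by (simp add: algebra_simps)

lemma starts_periodic': "starts i (x + \<tau> + d) \<longleftrightarrow> starts i (x + d)"
  "starts i (x + \<tau> - d) \<longleftrightarrow> starts i (x - d)"
  using starts_periodic[of i "x + d"] starts_periodic[of i "x - d"] by (simp_all add: algebra_simps)

lemma cnt_shift:
  assumes "per E"
  shows "cnt {x. x + d \<in> E} = cnt E"
proof -
  have "(\<Sum>x\<in>{x. x + d \<in> E} \<inter> {0..<\<tau>}. 1 :: nat) = (\<Sum>x\<in>E \<inter> {0..<\<tau>}. 1)"
  proof (rule sum_over_period[OF \<tau>_pos])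
    show "x + \<tau> \<in> {x. x + d \<in> E} \<longleftrightarrow> x \<in> {x. x + d \<in> E}" for x
      using assms[unfolded per_def, rule_format, of "x + d"] by (simp add: algebra_simps)
    show "bij_betw (\<lambda>x. x + d) {x. x + d \<in> E} E"
      by (rule bij_betw_byWitness[where f' = "\<lambda>x. x - d"]) auto
  qed auto
  thus ?thesis unfolding cnt_def by simp
qed

lemma finite_starts: "E \<subseteq> Collect (starts i) \<Longrightarrow> finite (E \<inter> {0..<\<tau>})"
proof -
  assume E: "E \<subseteq> Collect (starts i)"
  have "E \<inter> {0..<\<tau>} \<subseteq> (\<lambda>t. t + l i) ` (T \<inter> {- l i..\<tau> - l i})"
  proof
    fix x assume "x \<in> E \<inter> {0..<\<tau>}"
    hence "x - l i \<in> T \<inter> {- l i..\<tau> - l i}" using E unfolding starts_def by auto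
    thus "x \<in> (\<lambda>t. t + l i) ` (T \<inter> {- l i..\<tau> - l i})" by (rule rev_image_eqI) simp
  qed
  thus ?thesis using finite_T finite_subset by blast
qed

text \<open>This is how counting is used: an inclusion of periodic sets that have equally many points in a
period is an equality.\<close>
lemma cnt_eq_imp_eq:
  assumes "per E" "per E'" "E \<subseteq> E'" "E' \<subseteq> Collect (starts i)" "cnt E = cnt E'"
  shows "E = E'"
proof -
  have eq: "E \<inter> {0..<\<tau>} = E' \<inter> {0..<\<tau>}"
    using card_subset_eq[of "E' \<inter> {0..<\<tau>}" "E \<inter> {0..<\<tau>}"] finite_starts[OF assms(4)] assms(3,5)
    unfolding cnt_def by auto
  have "x \<in> E" if "x \<in> E'" for x
  proof -
    define y where "y = x + of_int (- \<lfloor>x / \<tau>\<rfloor>) * \<tau>"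
    have "y \<in> {0..<\<tau>}" unfolding y_def by (rule period_representative[OF \<tau>_pos])
    moreover have "y \<in> E'" unfolding y_def using int_shift_periodic[of \<tau> E'] assms(2) that
      unfolding per_def by blast
    ultimately have "y \<in> E" using eq by blast
    thus "x \<in> E" unfolding y_def using int_shift_periodic[of \<tau> E] assms(1)
      unfolding per_def by blast
  qed
  thus ?thesis using assms(3) by blast
qed

lemma cnt_Un: "E \<subseteq> Collect (starts i) \<Longrightarrow> E' \<subseteq> Collect (starts j) \<Longrightarrow> E \<inter> E' = {} \<Longrightarrow> cnt (E \<union> E') = cnt E + cnt E'"
  unfolding cnt_def Int_Un_distrib2
  by (rule card_Un_disjoint) (auto dest: finite_starts)

definition followed :: "letter \<Rightarrow> letter \<Rightarrow> real set" where
  "followed X Y = {x. starts X x \<and> starts Y (x + w X)}"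

definition preceded :: "letter \<Rightarrow> letter \<Rightarrow> real set" where
  "preceded X Y = {x. starts Y x \<and> starts X (x - w X)}"

lemma per_sets: "per (followed X Y)" "per (preceded X Y)" "per T" "per (Collect (starts i))"
  unfolding per_def followed_def preceded_def
  using starts_periodic starts_periodic' T_periodic by auto

lemma cnt_starts: "cnt (Collect (starts i)) = cnt T"
  using cnt_shift[OF per_sets(3), of "- l i"] by (simp add: starts_def[abs_def])

lemma cnt_preceded: "cnt (preceded X Y) = cnt (followed X Y)"
proof -
  have "preceded X Y = {x. x + (- w X) \<in> followed X Y}" unfolding preceded_def followed_def by auto
  thus ?thesis using cnt_shift[OF per_sets(1)] by metis
qed

text \<open>All letters occur equally often, and each occurrence has exactly one successor and one predecessor
(\<open>column_sum\<close>).  So the numbers of adjacent pairs form a matrix whose rows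
and columns have the same sum.\<close>
lemma row_sum:
  assumes XYZ: "X \<noteq> Y" "Y \<noteq> Z" "X \<noteq> Z"
  shows "cnt (followed i X) + cnt (followed i Y) + cnt (followed i Z) = cnt T"
proof -
  have "Collect (starts i) = (followed i X \<union> followed i Y) \<union> followed i Z"
  proof -
    have "x \<in> followed i X \<union> followed i Y \<union> followed i Z" if x: "starts i x" for x
    proof -
      obtain j where "starts j (x + w i)" using starts_next[OF x] by blast
      thus ?thesis using letter_cases3[OF XYZ, of j] x unfolding followed_def by auto
    qed
    thus ?thesis unfolding followed_def by auto
  qed
  moreover have "cnt ((followed i X \<union> followed i Y) \<union> followed i Z)
     = cnt (followed i X) + cnt (followed i Y) + cnt (followed i Z)"
    using XYZ by (subst cnt_Un[of _ i _ i], (auto simp: followed_def dest: starts_fun)[3],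
        subst cnt_Un[of _ i _ i], auto simp: followed_def dest: starts_fun)
  ultimately show ?thesis using cnt_starts[of i] by simp
qed

lemma column_sum:
  assumes XYZ: "X \<noteq> Y" "Y \<noteq> Z" "X \<noteq> Z"
  shows "cnt (followed X i) + cnt (followed Y i) + cnt (followed Z i) = cnt T"
proof -
  have "Collect (starts i) = (preceded X i \<union> preceded Y i) \<union> preceded Z i"
  proof -
    have "x \<in> preceded X i \<union> preceded Y i \<union> preceded Z i" if x: "starts i x" for x
    proof -
      obtain j where "starts j (x - w j)" using starts_prev[OF x] by blast
      thus ?thesis using letter_cases3[OF XYZ, of j] x unfolding preceded_def by auto
    qed
    thus ?thesis unfolding preceded_def by auto
  qed
  moreover have "cnt ((preceded X i \<union> preceded Y i) \<union> preceded Z i)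
     = cnt (preceded X i) + cnt (preceded Y i) + cnt (preceded Z i)"
    using XYZ by (subst cnt_Un[of _ i _ i], (auto simp: preceded_def dest: starts_prev_unique)[3],
        subst cnt_Un[of _ i _ i], auto simp: preceded_def dest: starts_prev_unique)
  ultimately show ?thesis using cnt_starts[of i] cnt_preceded by simp
qed

text \<open>Suppose that no letter follows itself.  If also no pattern \<open>X Y X\<close> occurs, then any three
consecutive letters are distinct, so a letter recurs after the other two, that is, at distance
\<open>1\<close>.  By \<open>alternation\<close> a pattern \<open>X Y X\<close> forces two lengths to be equal, and it remains to
exclude it when \<open>w Y = w Z\<close> and \<open>w X\<close> is different.  Then every \<open>Y\<close> that is followed by \<open>Z\<close> is
preceded by \<open>X\<close>.  As the matrix of adjacent pairs has zero diagonal, \<open>Y Z\<close> and \<open>X Y\<close> occur equally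
often, so conversely every \<open>X Y\<close> is followed by \<open>Z\<close>.\<close>
lemma no_double_letter_imp_unit_translate:
  assumes simple: "\<And>i x. starts i x \<Longrightarrow> \<not> starts i (x + w i)"
    and ne: "\<not> (w LA = w LB \<and> w LB = w LC)"
    and t: "t \<in> T"
  shows "t + 1 \<in> T"
proof -
  have ne: "\<not> (w X = w Y \<and> w Y = w Z)" if "X \<noteq> Y" "Y \<noteq> Z" "X \<noteq> Z" for X Y Z
    using ne that by (cases X; cases Y; cases Z) auto
  have no_XYX_equal: "\<not> (starts X x \<and> starts Y (x + w X) \<and> starts X (x + w X + w Y))"
    if XYZ: "X \<noteq> Y" "Y \<noteq> Z" "X \<noteq> Z" and eq: "w Y = w Z" for X Y Z x
  proof
    assume XYX: "starts X x \<and> starts Y (x + w X) \<and> starts X (x + w X + w Y)"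
    have sub: "followed Y Z \<subseteq> preceded X Y"
    proof
      fix y assume y: "y \<in> followed Y Z"
      obtain i where i: "starts i (y - w i)" using starts_prev y unfolding followed_def by blast
      have "i \<noteq> Y" using simple[OF i] y unfolding followed_def by auto
      moreover have "i \<noteq> Z"
      proof
        assume "i = Z"
        hence "w Y = w X \<or> w Z = w X"
          using alternation(2)[of Z Y X "y - w Z"] XYZ simple i y unfolding followed_def by auto
        thus False using ne[OF XYZ] eq by auto
      qed
      ultimately have "i = X" using letter_cases3[OF XYZ] by blast
      thus "y \<in> preceded X Y" using i y unfolding followed_def preceded_def by auto
    qed
    have none: "followed i i = {}" for i using simple unfolding followed_def by auto
    have "cnt {} = 0" unfolding cnt_def by simp
    hence "cnt (followed Y Z) = cnt (followed X Y)"
      using row_sum[OF XYZ, of X] column_sum[OF XYZ, of Z] none by simp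
    hence "followed Y Z = preceded X Y"
      using sub cnt_preceded per_sets by (intro cnt_eq_imp_eq[of _ _ Y]) (auto simp: preceded_def)
    moreover have "x + w X \<in> preceded X Y" using XYX unfolding preceded_def by auto
    ultimately have "starts Z (x + w X + w Y)" unfolding followed_def by auto
    thus False using XYX starts_fun XYZ by blast
  qed
  have no_XYX: "\<not> (starts X x \<and> starts Y (x + w X) \<and> starts X (x + w X + w Y))"
    if "X \<noteq> Y" for X Y x
  proof
    assume XYX: "starts X x \<and> starts Y (x + w X) \<and> starts X (x + w X + w Y)"
    obtain Z where Z: "Y \<noteq> Z" "X \<noteq> Z"
    proof -
      have "\<exists>Z. Y \<noteq> Z \<and> X \<noteq> Z" by (cases X; cases Y) blast+
      thus ?thesis using that by blast
    qed
    note XYZ = \<open>X \<noteq> Y\<close> Z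
    note alt = alternation[OF XYZ simple]
    show False
    proof (cases "w Y = w Z")
      case True thus False using no_XYX_equal[OF XYZ] XYX by blast
    next
      case False
      hence XZ: "w X = w Z" using alt(2) XYX by blast
      obtain y i where i: "starts Y y" "starts i (y + w Y)" "starts Y (y + w Y + w i)" "w i = w X" "i \<noteq> Y"
        using alt(1) XYX by blast
      have "i = X \<or> i = Z" using letter_cases3[OF XYZ, of i] i by auto
      thus False using no_XYX_equal[of Y X Z y] no_XYX_equal[of Y Z X y] i XYZ XZ by auto
    qed
  qed
  define X where "X = LA"
  define x where "x = t + l X"
  have x: "starts X x" unfolding x_def using starts_tile[OF t] .
  obtain Y where Y: "starts Y (x + w X)" using starts_next[OF x] by blast
  have XY: "X \<noteq> Y" using simple[OF x] Y by auto
  obtain Z where Z: "starts Z (x + w X + w Y)" using starts_next[OF Y] by blast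
  have YZ: "Y \<noteq> Z" using simple[OF Y] Z by auto
  have XZ: "X \<noteq> Z" using no_XYX[OF XY, of x] x Y Z by auto
  obtain V where V: "starts V (x + w X + w Y + w Z)" using starts_next[OF Z] by blast
  have "V \<noteq> Z" using simple[OF Z] V by auto
  moreover have "V \<noteq> Y" using no_XYX[OF YZ, of "x + w X"] Y Z V by auto
  ultimately have "V = X" using letter_cases3[OF XY YZ XZ] by blast
  moreover have "x + w X + w Y + w Z = x + 1" using w_sum_perm[OF XY YZ XZ] by simp
  ultimately have "starts X (x + 1)" using V by metis
  thus ?thesis unfolding starts_def x_def by (simp add: algebra_simps)
qed

end

section \<open>Tilings by intervals of equal lengths\<close>

context interval_tiling
begin

text \<open>All boundaries of the tiling differ by multiples of \<open>1 / 3\<close>.  The set \<open>F\<close> consists of the \<open>k\<close>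
such that \<open>t + k / 3\<close> is a translation, where \<open>t\<close> is one fixed translation.\<close>
lemma equal_lengths_imp_integer_tile:
  assumes w: "\<And>i. w i = 1 / 3"
  obtains m q :: int and F :: "int \<Rightarrow> bool" where
    "l LB = l LA + of_int m / 3" "l LC = l LA + of_int q / 3"
    "\<And>k. of_bool (F k) + of_bool (F (k - m)) + of_bool (F (k - q)) = (1::int)"
proof -
  have diff: "\<exists>k::int. y - x = of_int k / 3" if st0: "starts i x" "starts j y" for i j x y
  proof -
    have *: "\<exists>k::int. y - x = of_int k / 3" if st: "starts i x" "starts j y" "x \<le> y" for i j x y
    proof -
      obtain n1 n2 n3 where "y - x = real n1 * w LA + real n2 * w LB + real n3 * w LC"
        using starts_diff[OF st] by blast
      thus ?thesis using w by (intro exI[of _ "int (n1 + n2 + n3)"]) (auto simp: field_simps)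
    qed
    show ?thesis
    proof (cases "x \<le> y")
      case False
      then obtain k :: int where "x - y = of_int k / 3" using *[OF st0(2,1)] by auto
      thus ?thesis by (intro exI[of _ "- k"]) auto
    qed (use * st0 in blast)
  qed
  obtain t where t: "t \<in> T" using T_unbounded by blast
  note st = starts_tile[OF t]
  obtain m :: int where m: "l LB = l LA + of_int m / 3" 
  proof -
    obtain k :: int where "(t + l LB) - (t + l LA) = of_int k / 3" using diff[OF st[of LA] st[of LB]] by blast
    thus ?thesis using that[of k] by simp
  qed
  obtain q :: int where q: "l LC = l LA + of_int q / 3" 
  proof -
    obtain k :: int where "(t + l LC) - (t + l LA) = of_int k / 3" using diff[OF st[of LA] st[of LC]] by blast
    thus ?thesis using that[of k] by simp
  qed
  define F where "F k \<longleftrightarrow> t + of_int k / 3 \<in> T" for k :: int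
  have "of_bool (F k) + of_bool (F (k - m)) + of_bool (F (k - q)) = (1::int)" for k
  proof -
    define x where "x = t + l LA + of_int k / 3"
    obtain i y where iy: "starts i y" "y \<le> x" "x < y + w i" using starts_cover by blast
    obtain n :: int where n: "y - (t + l LA) = of_int n / 3" using diff[OF st[of LA] iy(1)] by blast
    have "of_int n \<le> (of_int k :: real)" "of_int k < (of_int (n + 1) :: real)"
      using iy n w[of i] unfolding x_def by (auto simp: field_simps)
    hence "n = k" by linarith
    hence "y = x" using n unfolding x_def by linarith
    hence i: "starts i x" using iy(1) by simp
    have "starts LA x \<longleftrightarrow> F k" "starts LB x \<longleftrightarrow> F (k - m)" "starts LC x \<longleftrightarrow> F (k - q)"
      unfolding starts_def F_def x_def m q by (simp_all add: algebra_simps diff_divide_distrib)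
    moreover have "starts j x \<longleftrightarrow> j = i" for j using i starts_fun by blast
    ultimately show ?thesis by (cases i) auto
  qed
  thus ?thesis using that m q by blast
qed

end

section \<open>Tilings in which one length is one half: chains and runs\<close>

context interval_tiling
begin

text \<open>A chain is a maximal sequence of translations with steps \<open>1 / 2\<close>.  When \<open>w a = 1 / 2\<close>, the letters
\<open>a\<close> of a chain are consecutive, and \<open>chain_stop a u\<close> is the right end of the block that they
form.  The stretch up to the next letter \<open>a\<close> is called a run.\<close>
definition chain_starts :: "real set" where
  "chain_starts = {u \<in> T. u - 1 / 2 \<notin> T}"

definition chain_length :: "real \<Rightarrow> nat" where
  "chain_length u = (LEAST k. u + real k / 2 \<notin> T)"

definition chain_stop :: "letter \<Rightarrow> real \<Rightarrow> real" where
  "chain_stop i u = u + l i + real (chain_length u) / 2"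

text \<open>The tile whose letter \<open>i\<close> is the first \<open>i\<close> in the run after the chain \<open>u\<close>; the run starts
with \<open>i\<close>, or with one \<open>j\<close> followed by \<open>i\<close>.\<close>
definition first_in_run :: "letter \<Rightarrow> letter \<Rightarrow> letter \<Rightarrow> real \<Rightarrow> real" where
  "first_in_run a i j u =
     (if starts i (chain_stop a u) then chain_stop a u - l i else chain_stop a u + w j - l i)"

end

locale half_tiling = periodic_tiling +
  fixes A B C :: letter
  assumes distinct: "A \<noteq> B" "B \<noteq> C" "A \<noteq> C"
    and wA: "w A = 1 / 2"
begin

text \<open>All that is assumed is symmetric in \<open>B\<close> and \<open>C\<close>, so each statement about \<open>B\<close> also yields
the statement with both letters exchanged.\<close>
lemma swap: "half_tiling l w T \<tau> A C B"
  using distinct wA by unfold_locales auto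

lemma w_BC: "w B + w C = 1 / 2"
  using w_sum_perm[OF distinct] wA by simp

lemma w_BC_le: "0 < w B" "w B < 1 / 2" "0 < w C" "w C < 1 / 2"
  using w_pos[of B] w_pos[of C] w_BC by auto

lemmas letters = letter_cases3[OF distinct]

lemma no_repeat: "i \<noteq> A \<Longrightarrow> starts i x \<Longrightarrow> \<not> starts i (x + w i)"
proof
  assume i: "i \<noteq> A" "starts i x" "starts i (x + w i)"
  have "w A \<le> w i" using gap_ge[OF i(2,3), of A] w_pos by simp
  moreover have "w i < 1 / 2" using letters[of i] i(1) w_BC_le by auto
  ultimately show False using wA by simp
qed

text \<open>Two \<open>B\<close> at distance \<open>1 / 2\<close> leave a gap of length \<open>w C\<close>, which only \<open>C\<close> fits.  So
consecutive letters \<open>B\<close> of a chain of translations have exactly one \<open>C\<close> between them.\<close>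
lemma half_step: "starts B y \<Longrightarrow> starts B (y + 1 / 2) \<Longrightarrow> starts C (y + w B)"
proof -
  assume y: "starts B y" "starts B (y + 1 / 2)"
  obtain k where k: "starts k (y + w B)" using starts_next[OF y(1)] by blast
  have "w B + w k \<le> 1 / 2" using starts_disjoint[OF k y(2)] w_BC_le by simp
  hence "k \<noteq> A" using wA w_BC_le by auto
  moreover have "k \<noteq> B" using no_repeat[of B y] distinct y(1) k by auto
  ultimately show ?thesis using k letters[of k] by auto
qed

text \<open>An occurrence of \<open>C B\<close> continues with \<open>C\<close> or with \<open>A\<close>; by \<open>half_step\<close> the patterns \<open>C B C\<close>
correspond to pairs of translations at distance \<open>1 / 2\<close>, that is, to the patterns \<open>A A\<close>.\<close>
lemma cnt_preceded_split: "cnt (preceded C B) = cnt (followed A A) + cnt {x \<in> followed B A. starts C (x - w C)}"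
proof -
  define S where "S = {x \<in> followed B A. starts C (x - w C)}"
  define R where "R = {x. starts B x \<and> starts C (x - w C) \<and> starts C (x + w B)}"
  interpret swap: half_tiling l w T \<tau> A C B by (rule swap)
  have "R = {x. x + (- w C - l C + l A) \<in> followed A A}"
  proof -
    have "x \<in> R \<longleftrightarrow> starts A (x - w C - l C + l A) \<and> starts A (x - w C - l C + l A + w A)" for x
    proof -
      have e: "x - w C + 1 / 2 = x + w B" using w_BC by simp
      have "starts A (x - w C - l C + l A) \<longleftrightarrow> starts C (x - w C)"
        "starts A (x - w C - l C + l A + w A) \<longleftrightarrow> starts C (x + w B)"
        unfolding e[symmetric] starts_def wA by (simp_all add: algebra_simps)
      moreover have "starts B x" if "starts C (x - w C)" "starts C (x + w B)"
        using swap.half_step[of "x - w C"] that unfolding e by simp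
      ultimately show ?thesis unfolding R_def by blast
    qed
    thus ?thesis unfolding followed_def by (auto simp: algebra_simps)
  qed
  hence "cnt R = cnt (followed A A)" using cnt_shift[OF per_sets(1)] by metis
  moreover have "preceded C B = R \<union> S"
  proof -
    have "x \<in> R \<union> S" if x: "x \<in> preceded C B" for x
    proof -
      obtain i where i: "starts i (x + w B)" using starts_next x unfolding preceded_def by blast
      have "i \<noteq> B" using no_repeat[of B x] distinct x i unfolding preceded_def by auto
      thus ?thesis using letters[of i] i x unfolding preceded_def followed_def R_def S_def by auto
    qed
    thus ?thesis unfolding preceded_def R_def S_def followed_def by auto
  qed
  moreover have "R \<inter> S = {}"
    using distinct unfolding R_def S_def followed_def by (auto dest: starts_fun)
  ultimately show ?thesis unfolding S_def[symmetric]
    using cnt_Un[of R B S B] unfolding R_def S_def followed_def by auto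
qed

text \<open>The matrix of adjacent pairs and \<open>cnt_preceded_split\<close> show that the patterns \<open>C B A\<close> and
\<open>B C A\<close> together are as numerous as \<open>B A\<close> and \<open>C A\<close> together.\<close>
lemma followed_A_imp_preceded_C:
  assumes "starts B x" "starts A (x + w B)"
  shows "starts C (x - w C)"
proof -
  interpret swap: half_tiling l w T \<tau> A C B by (rule swap)
  define S where "S = {x \<in> followed B A. starts C (x - w C)}"
  define S' where "S' = {x \<in> followed C A. starts B (x - w B)}"
  have mono: "cnt E \<le> cnt E'" if "E \<subseteq> E'" "E' \<subseteq> Collect (starts i)" for E E' i
    unfolding cnt_def using that by (intro card_mono finite_starts[OF that(2)]) auto
  have le: "cnt S \<le> cnt (followed B A)" "cnt S' \<le> cnt (followed C A)"
    by (rule mono[of _ _ B]; auto simp: S_def followed_def) (rule mono[of _ _ C]; auto simp: S'_def followed_def)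
  have "followed B B = {}" "followed C C = {}" "cnt {} = 0"
    using no_repeat distinct unfolding followed_def cnt_def by auto
  hence "cnt S = cnt (followed B A)"
    using cnt_preceded_split swap.cnt_preceded_split row_sum[OF distinct, of B] row_sum[OF distinct, of C]
      column_sum[OF distinct, of A] le unfolding S_def S'_def cnt_preceded by simp
  moreover have "per S" unfolding per_def S_def followed_def
    using starts_periodic starts_periodic' by auto
  ultimately have "S = followed B A"
    using per_sets by (intro cnt_eq_imp_eq[of _ _ B]) (auto simp: S_def followed_def)
  thus ?thesis using assms unfolding S_def followed_def by blast
qed

lemma no_isolated_B: "starts A x \<Longrightarrow> starts B (x + 1 / 2) \<Longrightarrow> starts C (x + 1 / 2 + w B)"
proof -
  assume x: "starts A x" "starts B (x + 1 / 2)"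
  obtain i where i: "starts i (x + 1 / 2 + w B)" using starts_next[OF x(2)] by blast
  have "i \<noteq> B" using no_repeat[OF _ x(2)] i distinct by auto
  moreover have "i \<noteq> A"
  proof
    assume "i = A"
    hence "starts C (x + 1 / 2 - w C)" using followed_A_imp_preceded_C[OF x(2)] i by simp
    thus False using starts_prev_unique[of A "x + 1 / 2" C] x(1) distinct wA by auto
  qed
  ultimately show ?thesis using letters[of i] i by auto
qed

text \<open>A half-integer sequence of letters \<open>A\<close> that reaches the \<open>B\<close> of some tile \<open>s\<close> would cover it.
So chains are finite in both directions.\<close>
lemma half_lattice_miss:
  assumes "t \<in> T" "s \<in> T"
  shows "t + of_int \<lfloor>2 * (s + l B - t - l A)\<rfloor> / 2 \<notin> T"
proof
  define j where "j = \<lfloor>2 * (s + l B - t - l A)\<rfloor>"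
  assume "t + of_int \<lfloor>2 * (s + l B - t - l A)\<rfloor> / 2 \<in> T"
  hence "starts A (t + of_int j / 2 + l A)" using starts_tile unfolding j_def by blast
  moreover have "of_int j \<le> 2 * (s + l B - t - l A)" "2 * (s + l B - t - l A) < of_int j + 1"
    unfolding j_def by linarith+
  ultimately have "A = B \<and> t + of_int j / 2 + l A = s + l B"
    using starts_tile[OF assms(2), of B] wA w_BC_le
    by (intro starts_unique[of A _ B "s + l B" "s + l B"]) auto
  thus False using distinct by simp
qed

lemma chain_ends: "t \<in> T \<Longrightarrow> \<exists>k. t + real k / 2 \<notin> T"
proof (rule ccontr)
  assume t: "t \<in> T" and "\<nexists>k. t + real k / 2 \<notin> T"
  hence all: "t + real k / 2 \<in> T" for k by blast
  obtain k :: nat where k: "real k > 2 * (l A - l B) + 1" using reals_Archimedean2 by blast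
  define j where "j = \<lfloor>2 * (t + real k / 2 + l B - t - l A)\<rfloor>"
  have "j \<ge> 0" unfolding j_def using k by simp
  hence "t + of_int j / 2 \<in> T" using all[of "nat j"] by simp
  thus False using half_lattice_miss[OF t all[of k]] unfolding j_def by simp
qed

lemma chain_begins:
  assumes t: "t \<in> T"
  obtains u k where "u \<in> chain_starts" "t = u + real k / 2" "\<And>j. j \<le> k \<Longrightarrow> u + real j / 2 \<in> T"
proof -
  have "\<exists>k. t - real k / 2 \<notin> T"
  proof (rule ccontr)
    assume "\<nexists>k. t - real k / 2 \<notin> T"
    hence all: "t - real k / 2 \<in> T" for k by blast
    obtain k :: nat where k: "real k > 2 * (l B - l A) + 1" using reals_Archimedean2 by blast
    define j where "j = \<lfloor>2 * (t - real k / 2 + l B - t - l A)\<rfloor>"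
    have "2 * (t - real k / 2 + l B - t - l A) < 0" using k by (simp add: field_simps)
    hence "j \<le> 0" unfolding j_def by simp
    hence "t + of_int j / 2 \<in> T" using all[of "nat (- j)"] by simp
    thus False using half_lattice_miss[OF t all[of k]] unfolding j_def by simp
  qed
  then obtain k where k: "t - real k / 2 \<notin> T" "\<And>j. j < k \<Longrightarrow> t - real j / 2 \<in> T"
    using exists_least_iff[of "\<lambda>k. t - real k / 2 \<notin> T"] by auto
  have "k \<noteq> 0" using k t by (cases k) auto
  then obtain n where n: "k = Suc n" using not0_implies_Suc by blast
  define u where "u = t - real n / 2"
  have "u \<in> T" unfolding u_def using k(2)[of n] n by simp
  moreover have "u - 1 / 2 \<notin> T" 
  proof -
    have "u - 1 / 2 = t - real (Suc n) / 2" unfolding u_def by (simp add: field_simps)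
    thus ?thesis using k(1) n by simp
  qed
  moreover have "u + real j / 2 \<in> T" if "j \<le> n" for j
  proof -
    have "u + real j / 2 = t - real (n - j) / 2" unfolding u_def using that by (simp add: of_nat_diff field_simps)
    thus ?thesis using k(2)[of "n - j"] n by simp
  qed
  ultimately show ?thesis using that[of u n] unfolding chain_starts_def u_def by simp
qed

lemma chain_length:
  assumes "u \<in> T"
  shows "j < chain_length u \<Longrightarrow> u + real j / 2 \<in> T" "u + real (chain_length u) / 2 \<notin> T"
    "1 \<le> chain_length u"
proof -
  show j: "j < chain_length u \<Longrightarrow> u + real j / 2 \<in> T" for j
    unfolding chain_length_def using not_less_Least by blast
  show e: "u + real (chain_length u) / 2 \<notin> T"
    unfolding chain_length_def using LeastI_ex[OF chain_ends[OF assms]] .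
  show "1 \<le> chain_length u" using e assms by (cases "chain_length u") auto
qed

lemma chain_length_eq:
  assumes "\<And>j. j < n \<Longrightarrow> u + real j / 2 \<in> T" "u + real n / 2 \<notin> T"
  shows "chain_length u = n"
  unfolding chain_length_def
  by (rule Least_equality) (use assms not_less in blast)+

lemma starts_stop:
  assumes "u \<in> chain_starts"
  shows "starts A (chain_stop A u - 1 / 2)" "starts B (chain_stop A u) \<or> starts C (chain_stop A u)"
    "\<not> starts A (chain_stop A u)" "u + l A + 1 / 2 \<le> chain_stop A u"
proof -
  have u: "u \<in> T" using assms unfolding chain_starts_def by auto
  note p = chain_length[OF u]
  define n where "n = chain_length u - 1"
  have n: "chain_length u = Suc n" unfolding n_def using p(3) by simp
  have e: "chain_stop A u - 1 / 2 = (u + real n / 2) + l A"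
    unfolding chain_stop_def n by (simp add: field_simps)
  show st: "starts A (chain_stop A u - 1 / 2)" unfolding e using starts_tile p(1)[of n] n by simp
  show nA: "\<not> starts A (chain_stop A u)"
    using p(2) unfolding starts_def chain_stop_def by (simp add: algebra_simps)
  obtain i where "starts i (chain_stop A u)" using starts_next[OF st] wA by auto
  thus "starts B (chain_stop A u) \<or> starts C (chain_stop A u)" using nA letters[of i] by auto
  show "u + l A + 1 / 2 \<le> chain_stop A u" unfolding chain_stop_def n by (simp add: field_simps)
qed

text \<open>The run after a chain contains exactly one chain of letters \<open>B\<close> and one of letters \<open>C\<close>, both
complete.  The letters \<open>B\<close> that belong to the chain of the first \<open>B\<close> alternate with letters
\<open>C\<close> by \<open>half_step\<close>; the chain cannot extend to the left because the run is preceded by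
\<open>A\<close>, and after its last \<open>B\<close> there is at most one more \<open>C\<close>.  That a \<open>C\<close> occurs at all
is \<open>no_isolated_B\<close>.  So \<open>y\<close> is the right end of the run.\<close>
lemma run_from_B:
  assumes u: "u \<in> chain_starts" and e: "e = chain_stop A u" and B: "starts B e"
  defines "v \<equiv> e - l B" and "v' \<equiv> e + w B - l C"
  defines "y \<equiv> e + w B * real (chain_length v) + w C * real (chain_length v')"
  shows "v \<in> chain_starts" "v' \<in> chain_starts" "y - l A \<in> chain_starts"
    "\<And>z. e \<le> z \<Longrightarrow> z < y \<Longrightarrow> \<not> starts A z" "e + w B < y"
proof -
  interpret swap: half_tiling l w T \<tau> A C B by (rule swap)
  note bc = w_BC w_BC_le
  have preA: "starts A (e - w A)" using starts_stop(1)[OF u] unfolding e wA .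
  have nopre: "\<not> starts C (e - w C)" using starts_prev_unique[OF preA] distinct by blast
  have v: "v \<in> T" unfolding v_def using B unfolding starts_def .
  have Cs: "starts C (e + w B)" using no_isolated_B[of "e - 1 / 2"] preA B wA by simp
  have v': "v' \<in> T" unfolding v'_def using Cs unfolding starts_def .
  have stB: "starts B (e + d) \<longleftrightarrow> v + d \<in> T" for d unfolding v_def starts_def by (simp add: algebra_simps)
  have stC: "starts C (e + w B + d) \<longleftrightarrow> v' + d \<in> T" for d unfolding v'_def starts_def by (simp add: algebra_simps)
  show v_start: "v \<in> chain_starts"
  proof -
    have "v - 1 / 2 \<notin> T"
    proof
      assume "v - 1 / 2 \<in> T"
      hence "starts B (e - 1 / 2)" using stB[of "- 1 / 2"] by simp
      hence "starts C (e - 1 / 2 + w B)" using half_step[of "e - 1 / 2"] B by simp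
      moreover have "e - 1 / 2 + w B = e - w C" using bc by simp
      ultimately show False using nopre by simp
    qed
    thus ?thesis using v unfolding chain_starts_def by simp
  qed
  show v'_start: "v' \<in> chain_starts"
  proof -
    have "v' - 1 / 2 \<notin> T"
    proof
      assume "v' - 1 / 2 \<in> T"
      hence "starts C (e + w B - 1 / 2)" using stC[of "- 1 / 2"] by simp
      moreover have "e + w B - 1 / 2 = e - w C" using bc by simp
      ultimately show False using nopre by simp
    qed
    thus ?thesis using v' unfolding chain_starts_def by simp
  qed
  define n where "n = chain_length v - 1"
  have n: "chain_length v = Suc n" unfolding n_def using chain_length(3)[OF v] by simp
  have Bk: "starts B (e + real k / 2)" if "k \<le> n" for k
    using stB chain_length(1)[OF v, of k] that n by simp
  have noB: "\<not> starts B (e + real (Suc n) / 2)" using stB chain_length(2)[OF v] n by simp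
  have Ck: "starts C (e + w B + real k / 2)" if "k < n" for k
  proof -
    have "starts C (e + real k / 2 + w B)"
      using half_step[OF Bk[of k]] Bk[of "Suc k"] that by (simp add: add_divide_distrib algebra_simps)
    moreover have "e + real k / 2 + w B = e + w B + real k / 2" by simp
    ultimately show ?thesis by simp
  qed
  define x where "x = e + real n / 2 + w B"
  obtain i where i: "starts i x" using starts_next[OF Bk[of n]] unfolding x_def by auto
  have iB: "i \<noteq> B" using no_repeat[OF _ Bk[of n]] i distinct unfolding x_def by auto
  have x': "x = e + w B + real n / 2" unfolding x_def by simp
  \<comment> \<open>The run ends with the last \<open>B\<close> at \<open>x\<close>, or with one more \<open>C\<close> at \<open>x + w C\<close>.\<close>
  have "(y = x \<and> chain_length v' = n \<and> starts A x \<and> starts B (x - w B)) \<or>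
        (y = x + w C \<and> chain_length v' = Suc n \<and> starts A (x + w C) \<and> starts C (x + w C - w C))"
  proof (cases "i = A")
    case True
    have "\<not> starts C x" using i True starts_fun distinct by blast
    hence "chain_length v' = n"
      using stC Ck x' by (intro chain_length_eq) auto
    moreover have "y = x"
    proof -
      have "y = e + (w B + w C) * real n + w B" unfolding y_def n \<open>chain_length v' = n\<close> by (simp add: algebra_simps)
      thus ?thesis unfolding x_def bc by simp
    qed
    ultimately show ?thesis using i True Bk[of n] unfolding x_def by auto
  next
    case False
    hence Cx: "starts C x" using i iB letters[of i] by auto
    have eq: "x + w C = e + real (Suc n) / 2" unfolding x_def using bc by (simp add: add_divide_distrib)
    have "\<not> starts C (x + 1 / 2)"
      using swap.half_step[OF Cx] noB eq by auto
    hence "v' + real (Suc n) / 2 \<notin> T" using stC[of "real (Suc n) / 2"] x' by (simp add: add_divide_distrib algebra_simps)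
    moreover have "v' + real j / 2 \<in> T" if "j < Suc n" for j
      using stC Ck[of j] Cx x' that by (cases "j = n") auto
    ultimately have len: "chain_length v' = Suc n" by (intro chain_length_eq) auto
    have "y = e + (w B + w C) * real (Suc n)" unfolding y_def n len by (simp add: algebra_simps)
    hence y: "y = x + w C" unfolding eq bc by simp
    obtain k where k: "starts k (x + w C)" using starts_next[OF Cx] by blast
    have "k \<noteq> C" using no_repeat[OF _ Cx] k distinct by auto
    moreover have "k \<noteq> B" using k noB eq by auto
    ultimately have "starts A (x + w C)" using k letters[of k] by auto
    thus ?thesis using y len Cx by simp
  qed
  note end_cases = this
  show "y - l A \<in> chain_starts"
  proof -
    have y: "starts A y" "starts B (y - w B) \<or> starts C (y - w C)" using end_cases by auto
    have "\<not> starts A (y - w A)" using y(2) starts_prev_unique distinct by blast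
    hence "y - l A - 1 / 2 \<notin> T" unfolding starts_def wA by (simp add: algebra_simps)
    thus ?thesis using y(1) unfolding starts_def chain_starts_def by simp
  qed
  show "e + w B < y"
  proof -
    have "w B * 1 \<le> w B * real (chain_length v)" "w C * 1 \<le> w C * real (chain_length v')"
      using chain_length(3)[OF v] chain_length(3)[OF v'] bc by (intro mult_left_mono; simp)+
    thus ?thesis using bc unfolding y_def by linarith
  qed
  show "\<not> starts A z" if z: "e \<le> z" "z < y" for z
  proof
    assume A: "starts A z"
    define k where "k = nat \<lfloor>2 * (z - e)\<rfloor>"
    have k: "real k \<le> 2 * (z - e)" "2 * (z - e) < real k + 1"
    proof -
      have "real k = of_int \<lfloor>2 * (z - e)\<rfloor>" unfolding k_def using z(1) by simp
      thus "real k \<le> 2 * (z - e)" "2 * (z - e) < real k + 1" by linarith+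
    qed
    have yn: "y \<le> e + real (Suc n) / 2"
      using end_cases bc unfolding x_def by (auto simp: add_divide_distrib)
    hence kn: "k \<le> n" using k z by (simp add: add_divide_distrib)
    show False
    proof (cases "z < e + real k / 2 + w B")
      case True
      hence "A = B" using starts_unique[OF A Bk[OF kn], of z] wA k by auto
      thus False using distinct by simp
    next
      case False
      have "starts C (e + w B + real k / 2)"
      proof (cases "k < n")
        case True thus ?thesis using Ck by simp
      next
        case f: False
        hence "k = n" using kn by simp
        hence "y \<noteq> x" using False z x_def by auto
        hence "starts C x" using end_cases by auto
        thus ?thesis using x' \<open>k = n\<close> by simp
      qed
      hence "A = C" using starts_unique[OF A, of C "e + w B + real k / 2" z] wA k False bc by auto
      thus False using distinct by simp
    qed
  qed
qed

end

section \<open>Tilings in which one length is one half: all runs have one orientation\<close>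

definition (in interval_tiling) next_chain :: "real \<Rightarrow> real \<Rightarrow> bool" where
  "next_chain u v \<longleftrightarrow> u \<in> chain_starts \<and> v \<in> chain_starts \<and> u < v \<and> (\<forall>t\<in>chain_starts. \<not> (u < t \<and> t < v))"

context half_tiling
begin

text \<open>Here \<open>\<kappa> u\<close> and \<open>\<kappa>' u\<close> are the starts of the chains whose letters \<open>B\<close> and \<open>C\<close> make up the
run after the chain \<open>u\<close>, and \<open>nx u\<close> is the start of the chain after that run.\<close>
definition \<kappa> :: "real \<Rightarrow> real" where "\<kappa> = first_in_run A B C"
definition \<kappa>' :: "real \<Rightarrow> real" where "\<kappa>' = first_in_run A C B"
definition nx :: "real \<Rightarrow> real" where
  "nx u = chain_stop A u + w B * real (chain_length (\<kappa> u)) + w C * real (chain_length (\<kappa>' u)) - l A"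

lemma next_chain_fun: "next_chain u v \<Longrightarrow> next_chain u v' \<Longrightarrow> v = v'"
  unfolding next_chain_def by (meson linorder_less_linear)

lemma \<kappa>_swap: "half_tiling.\<kappa> l w T A C B = \<kappa>'" "half_tiling.\<kappa>' l w T A C B = \<kappa>"
  "half_tiling.nx l w T A C B = nx"
proof -
  interpret swap: half_tiling l w T \<tau> A C B by (rule swap)
  show 1: "swap.\<kappa> = \<kappa>'" "swap.\<kappa>' = \<kappa>" unfolding swap.\<kappa>_def swap.\<kappa>'_def \<kappa>_def \<kappa>'_def by simp_all
  show "swap.nx = nx" unfolding fun_eq_iff swap.nx_def nx_def 1 by simp
qed

lemma chain_starts_in_chain:
  assumes u: "u \<in> chain_starts" and t: "t \<in> chain_starts" "u < t"
  shows "chain_stop A u \<le> t + l A"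
proof (rule ccontr)
  assume neg: "\<not> chain_stop A u \<le> t + l A"
  have uT: "u \<in> T" using u unfolding chain_starts_def by simp
  define j where "j = nat \<lfloor>2 * (t - u)\<rfloor>"
  have rj: "real j = of_int \<lfloor>2 * (t - u)\<rfloor>" unfolding j_def using t by simp
  have j: "real j \<le> 2 * (t - u)" "2 * (t - u) < real j + 1" unfolding rj by linarith+
  have "real j < real (chain_length u)" using j neg unfolding chain_stop_def by simp
  hence jl: "j < chain_length u" by simp
  have A: "starts A (u + real j / 2 + l A)" using chain_length(1)[OF uT jl] starts_tile by blast
  have tT: "t \<in> T" using t unfolding chain_starts_def by simp
  have "u + real j / 2 + l A = t + l A"
    using starts_unique[OF A starts_tile[OF tT, of A], of "t + l A"] wA j by simp
  hence te: "t = u + real j / 2" by simp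
  hence "j \<noteq> 0" using t by auto
  then obtain n where n: "j = Suc n" using not0_implies_Suc by blast
  have "t - 1 / 2 = u + real n / 2" unfolding te n by (simp add: field_simps)
  hence "t - 1 / 2 \<in> T" using chain_length(1)[OF uT, of n] jl n by simp
  thus False using t unfolding chain_starts_def by simp
qed

lemma run_B:
  assumes u: "u \<in> chain_starts" and B: "starts B (chain_stop A u)"
  shows "\<kappa> u \<in> chain_starts" "\<kappa>' u \<in> chain_starts" "next_chain u (nx u)"
    "\<kappa> u + l B = chain_stop A u" "\<kappa>' u + l C = chain_stop A u + w B" "chain_stop A u + w B < nx u + l A"
proof -
  define e where "e = chain_stop A u"
  have nC: "\<not> starts C e" using B starts_fun distinct unfolding e_def by blast
  have k: "\<kappa> u = e - l B" "\<kappa>' u = e + w B - l C"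
    using B nC unfolding \<kappa>_def \<kappa>'_def first_in_run_def e_def by simp_all
  note r = run_from_B[OF u e_def B[folded e_def], folded k]
  have nx: "nx u = e + w B * real (chain_length (\<kappa> u)) + w C * real (chain_length (\<kappa>' u)) - l A"
    unfolding nx_def e_def by simp
  show "\<kappa> u \<in> chain_starts" "\<kappa>' u \<in> chain_starts" using r by auto
  show "\<kappa> u + l B = chain_stop A u" "\<kappa>' u + l C = chain_stop A u + w B"
    unfolding k e_def by simp_all
  show lt: "chain_stop A u + w B < nx u + l A" using r(5) nx unfolding e_def by simp
  show "next_chain u (nx u)" unfolding next_chain_def
  proof (intro conjI ballI u)
    show "nx u \<in> chain_starts" using r(3) nx by simp
    show "u < nx u" using lt starts_stop(4)[OF u] w_BC_le by simp
    show "\<not> (u < t \<and> t < nx u)" if t: "t \<in> chain_starts" for t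
    proof
      assume ut: "u < t \<and> t < nx u"
      have "e \<le> t + l A" using chain_starts_in_chain[OF u t] ut unfolding e_def by simp
      hence "\<not> starts A (t + l A)" using r(4)[of "t + l A"] ut nx by simp
      thus False using t starts_tile unfolding chain_starts_def by simp
    qed
  qed
qed

text \<open>The orientation of the run after the chain \<open>u\<close>, as a number that enters linear identities.\<close>
definition \<epsilon> :: "real \<Rightarrow> real" where "\<epsilon> u = (if starts B (chain_stop A u) then 0 else 1)"

lemma run:
  assumes u: "u \<in> chain_starts"
  shows "\<kappa> u \<in> chain_starts" "\<kappa>' u \<in> chain_starts" "next_chain u (nx u)"
    "\<kappa> u + l B = chain_stop A u + w C * \<epsilon> u" "\<kappa>' u + l C = chain_stop A u + w B * (1 - \<epsilon> u)"
    "chain_stop A u \<le> \<kappa> u + l B" "\<kappa> u + l B < nx u + l A"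
proof -
  interpret swap: half_tiling l w T \<tau> A C B by (rule swap)
  note bc = w_BC_le
  have "\<kappa> u \<in> chain_starts \<and> \<kappa>' u \<in> chain_starts \<and> next_chain u (nx u) \<and>
    \<kappa> u + l B = chain_stop A u + w C * \<epsilon> u \<and> \<kappa>' u + l C = chain_stop A u + w B * (1 - \<epsilon> u) \<and>
    chain_stop A u \<le> \<kappa> u + l B \<and> \<kappa> u + l B < nx u + l A"
  proof (cases "starts B (chain_stop A u)")
    case True
    note r = run_B[OF u True]
    have "\<epsilon> u = 0" unfolding \<epsilon>_def using True by simp
    moreover have "\<kappa> u + l B < nx u + l A" using r(4,6) bc by linarith
    ultimately show ?thesis using r by simp
  next
    case False
    hence "starts C (chain_stop A u)" using starts_stop(2)[OF u] by blast
    note r = swap.run_B[OF u this, unfolded \<kappa>_swap]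
    have "\<epsilon> u = 1" unfolding \<epsilon>_def using False by simp
    moreover have "\<kappa> u + l B < nx u + l A" "chain_stop A u \<le> \<kappa> u + l B" using r(5,6) bc by linarith+
    ultimately show ?thesis using r by simp
  qed
  thus "\<kappa> u \<in> chain_starts" "\<kappa>' u \<in> chain_starts" "next_chain u (nx u)"
    "\<kappa> u + l B = chain_stop A u + w C * \<epsilon> u" "\<kappa>' u + l C = chain_stop A u + w B * (1 - \<epsilon> u)"
    "chain_stop A u \<le> \<kappa> u + l B" "\<kappa> u + l B < nx u + l A" by auto
qed

lemma chain_starts_finite: "finite (chain_starts \<inter> {a..b})"
  by (rule finite_subset[OF _ finite_T[of a b]]) (auto simp: chain_starts_def)

lemma chain_starts_periodic: "u + \<tau> \<in> chain_starts \<longleftrightarrow> u \<in> chain_starts"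
  using T_periodic[of u] T_periodic[of "u - 1 / 2"] unfolding chain_starts_def by (simp add: algebra_simps)

lemma prev_chain:
  assumes v: "v \<in> chain_starts"
  obtains u where "next_chain u v"
proof -
  define G where "G = {u \<in> chain_starts \<inter> {v - \<tau>..v}. u < v}"
  have fin: "finite G"
    unfolding G_def by (rule finite_subset[OF _ chain_starts_finite[of "v - \<tau>" v]]) auto
  have "v - \<tau> \<in> G" unfolding G_def using chain_starts_periodic[of "v - \<tau>"] v \<tau>_pos by simp
  hence ne: "G \<noteq> {}" by auto
  have "Max G \<in> G" using fin ne by (rule Max_in)
  moreover have "\<not> (Max G < t \<and> t < v)" if "t \<in> chain_starts" for t
  proof
    assume t: "Max G < t \<and> t < v"
    hence "t \<in> G" using that \<open>Max G \<in> G\<close> unfolding G_def by auto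
    hence "t \<le> Max G" using fin by simp
    thus False using t by simp
  qed
  ultimately have "next_chain (Max G) v" using v unfolding G_def next_chain_def by blast
  thus ?thesis using that by blast
qed

lemma nx_iff: "u \<in> chain_starts \<Longrightarrow> next_chain u v \<longleftrightarrow> v = nx u"
  using run(3) next_chain_fun by blast

lemma nx_bij: "bij_betw nx chain_starts chain_starts"
  unfolding bij_betw_def
proof (intro conjI)
  show "inj_on nx chain_starts"
  proof (rule linorder_inj_onI')
    fix u v assume uv: "u \<in> chain_starts" "v \<in> chain_starts" "u < v"
    have "nx u \<le> v" using run(3)[OF uv(1)] uv unfolding next_chain_def by force
    moreover have "v < nx v" using run(3)[OF uv(2)] unfolding next_chain_def by simp
    ultimately show "nx u \<noteq> nx v" by simp
  qed
  show "nx ` chain_starts = chain_starts"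
  proof
    show "nx ` chain_starts \<subseteq> chain_starts" using run(3) unfolding next_chain_def by blast
    show "chain_starts \<subseteq> nx ` chain_starts"
    proof
      fix v assume "v \<in> chain_starts"
      then obtain u where "next_chain u v" using prev_chain by blast
      thus "v \<in> nx ` chain_starts" using nx_iff unfolding next_chain_def by blast
    qed
  qed
qed

lemma \<kappa>_mono:
  assumes "u \<in> chain_starts" "v \<in> chain_starts" "u < v"
  shows "\<kappa> u < \<kappa> v"
proof -
  have "nx u \<le> v" using run(3)[OF assms(1)] assms unfolding next_chain_def by force
  thus ?thesis using run(7)[OF assms(1)] run(6)[OF assms(2)] starts_stop(4)[OF assms(2)] by simp
qed

lemma chain_stopping_at:
  assumes A: "starts A (z - 1 / 2)" and z: "\<not> starts A z"
  obtains u where "u \<in> chain_starts" "chain_stop A u = z"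
proof -
  define t where "t = z - 1 / 2 - l A"
  have t: "t \<in> T" using A unfolding t_def starts_def .
  obtain u k where u: "u \<in> chain_starts" "t = u + real k / 2" "\<And>j. j \<le> k \<Longrightarrow> u + real j / 2 \<in> T"
    using chain_begins[OF t] by metis
  have e: "u + real (Suc k) / 2 = z - l A" using u(2) unfolding t_def by (simp add: field_simps)
  have "chain_length u = Suc k"
  proof (rule chain_length_eq)
    show "u + real j / 2 \<in> T" if "j < Suc k" for j using u(3) that by simp
    show "u + real (Suc k) / 2 \<notin> T" unfolding e using z unfolding starts_def .
  qed
  hence "chain_stop A u = z" using e unfolding chain_stop_def by simp
  thus ?thesis using u that by blast
qed

lemma \<kappa>_bij: "bij_betw \<kappa> chain_starts chain_starts"
  unfolding bij_betw_def
proof (intro conjI)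
  show "inj_on \<kappa> chain_starts"
    using \<kappa>_mono by (intro linorder_inj_onI') (auto dest: less_imp_neq)
  show "\<kappa> ` chain_starts = chain_starts"
  proof
    show "\<kappa> ` chain_starts \<subseteq> chain_starts" using run(1) by blast
    show "chain_starts \<subseteq> \<kappa> ` chain_starts"
    proof
      fix v assume v: "v \<in> chain_starts"
      define z where "z = v + l B"
      have B: "starts B z" unfolding z_def using v starts_tile unfolding chain_starts_def by simp
      have nB: "\<not> starts B (z - 1 / 2)" using v unfolding chain_starts_def starts_def z_def by simp
      obtain i where i: "starts i (z - w i)" using starts_prev[OF B] by blast
      have "i \<noteq> B" using no_repeat[OF _ i] B distinct by auto
      then consider "i = A" | "i = C" using letters[of i] by blast
      thus "v \<in> \<kappa> ` chain_starts"
      proof cases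
        case 1
        have "\<not> starts A z" using B starts_fun distinct by blast
        then obtain u where u: "u \<in> chain_starts" "chain_stop A u = z"
          using chain_stopping_at[of z] i 1 wA by auto
        have "\<kappa> u = v" using run_B(4)[OF u(1)] u B unfolding z_def by simp
        thus ?thesis using u by blast
      next
        case 2
        define y where "y = z - w C"
        have C: "starts C y" using i 2 unfolding y_def by simp
        obtain j where j: "starts j (y - w j)" using starts_prev[OF C] by blast
        have "j \<noteq> C" using no_repeat[OF _ j] C distinct by auto
        moreover have "j \<noteq> B"
        proof
          assume "j = B"
          moreover have "y - w B = z - 1 / 2" unfolding y_def using w_BC by simp
          ultimately show False using j nB by simp
        qed
        ultimately have "j = A" using letters[of j] by blast
        have "\<not> starts A y" using C starts_fun distinct by blast
        then obtain u where u: "u \<in> chain_starts" "chain_stop A u = y"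
          using chain_stopping_at[of y] j \<open>j = A\<close> wA by auto
        have "\<not> starts B y" using C starts_fun distinct by blast
        hence "\<kappa> u = v" using run(4)[OF u(1)] u unfolding \<epsilon>_def z_def y_def by simp
        thus ?thesis using u by blast
      qed
    qed
  qed
qed

text \<open>\<open>\<kappa>\<close> is an order isomorphism of the chain starts (\<open>\<kappa>_mono\<close>, \<open>\<kappa>_bij\<close>), so it commutes with
the successor.\<close>
lemma \<kappa>_nx:
  assumes u: "u \<in> chain_starts"
  shows "\<kappa> (nx u) = nx (\<kappa> u)"
proof -
  have n: "nx u \<in> chain_starts" "u < nx u" "\<And>t. t \<in> chain_starts \<Longrightarrow> \<not> (u < t \<and> t < nx u)"
    using run(3)[OF u] unfolding next_chain_def by auto
  have "next_chain (\<kappa> u) (\<kappa> (nx u))"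
    unfolding next_chain_def
  proof (intro conjI ballI)
    show "\<kappa> u \<in> chain_starts" "\<kappa> (nx u) \<in> chain_starts" using run(1) u n by auto
    show "\<kappa> u < \<kappa> (nx u)" using \<kappa>_mono u n by blast
    show "\<not> (\<kappa> u < y \<and> y < \<kappa> (nx u))" if y: "y \<in> chain_starts" for y
    proof
      assume lt: "\<kappa> u < y \<and> y < \<kappa> (nx u)"
      have "y \<in> \<kappa> ` chain_starts" using \<kappa>_bij y unfolding bij_betw_def by simp
      then obtain t where t: "t \<in> chain_starts" "y = \<kappa> t" by (rule imageE)
      have "\<not> t < u" "t \<noteq> u" using \<kappa>_mono[OF t(1) u] lt t by auto
      hence "u < t" by simp
      moreover have "\<not> nx u < t" "t \<noteq> nx u" using \<kappa>_mono[OF n(1) t(1)] lt t by auto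
      hence "t < nx u" by simp
      ultimately show False using n(3) t by blast
    qed
  qed
  thus ?thesis using nx_iff run(1)[OF u] by blast
qed

lemma chain_length_periodic: "chain_length (u + \<tau>) = chain_length u"
proof -
  have "u + \<tau> + real k / 2 \<in> T \<longleftrightarrow> u + real k / 2 \<in> T" for k
    using T_periodic[of "u + real k / 2"] by (simp add: algebra_simps)
  thus ?thesis unfolding chain_length_def by simp
qed

lemma chain_stop_periodic: "chain_stop i (u + \<tau>) = chain_stop i u + \<tau>"
  unfolding chain_stop_def chain_length_periodic by simp

lemma \<kappa>_periodic: "\<kappa> (u + \<tau>) = \<kappa> u + \<tau>" "\<kappa>' (u + \<tau>) = \<kappa>' u + \<tau>"
  unfolding \<kappa>_def \<kappa>'_def first_in_run_def chain_stop_periodic starts_periodic by simp_all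

lemma nx_periodic: "nx (u + \<tau>) = nx u + \<tau>"
  unfolding nx_def chain_stop_periodic \<kappa>_periodic chain_length_periodic by simp

lemma \<epsilon>_periodic: "\<epsilon> (u + \<tau>) = \<epsilon> u"
  unfolding \<epsilon>_def chain_stop_periodic starts_periodic ..

text \<open>Write \<open>p u\<close> for the number of tiles in the chain \<open>u\<close> and \<open>L u = b * p (\<kappa> u) + c * p (\<kappa>' u)\<close> for the length of
the run after it.  The step from one chain to the next is \<open>nx u - u = p u / 2 + L u\<close>, while
\<open>\<kappa> u - u\<close> and \<open>\<kappa>' u - u\<close> are \<open>p u / 2\<close> plus a constant plus a multiple of the orientation \<open>\<epsilon> u\<close>.
Since \<open>\<kappa>\<close> and \<open>\<kappa>'\<close> commute with \<open>nx\<close>, the step from \<open>\<kappa> u\<close> to \<open>\<kappa> (nx u)\<close> can be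
computed in two ways, and likewise for \<open>\<kappa>'\<close>.  The results are
\<open>L (\<kappa> u) = p (nx u) / 2 + c * \<theta> u\<close> and \<open>L (\<kappa>' u) = p (nx u) / 2 - b * \<theta> u\<close> with the same
defect \<open>\<theta> u\<close>.

Now sum squares over one period.  As \<open>b + c = 1 / 2\<close>, these two equations give
\<open>\<Sum>L\<^sup>2 = \<Sum>p\<^sup>2 / 4 + b * c * \<Sum>\<theta>\<^sup>2\<close>, whereas the definition of \<open>L\<close> gives
\<open>\<Sum>L\<^sup>2 = \<Sum>p\<^sup>2 / 4 - b * c * \<Sum>d\<^sup>2\<close> with \<open>d u = p (\<kappa> u) - p (\<kappa>' u)\<close>.  So \<open>\<theta>\<close> and
\<open>d\<close> vanish: each run has as many \<open>B\<close> as \<open>C\<close>, and consecutive runs have the same orientation.\<close>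
lemma energy:
  assumes u: "u \<in> chain_starts"
  shows "chain_length (\<kappa> u) = chain_length (\<kappa>' u)" "\<epsilon> (nx u) = \<epsilon> u"
proof -
  interpret swap: half_tiling l w T \<tau> A C B by (rule swap)
  define b c where "b = w B" and "c = w C"
  have bc: "0 < b" "0 < c" "b + c = 1 / 2" unfolding b_def c_def using w_BC_le w_BC by auto
  define p where "p v = real (chain_length v)" for v
  define L where "L v = b * p (\<kappa> v) + c * p (\<kappa>' v)" for v
  define d where "d v = p (\<kappa> v) - p (\<kappa>' v)" for v
  define \<theta> where "\<theta> v = \<epsilon> (nx v) - \<epsilon> v - d v" for v
  define K where "K = chain_starts \<inter> {0..<\<tau>}"
  have nx: "nx v = v + p v / 2 + L v" for v
    unfolding nx_def L_def p_def b_def c_def chain_stop_def by simp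
  have \<kappa>: "\<kappa> v = v + l A - l B + p v / 2 + c * \<epsilon> v" if "v \<in> chain_starts" for v
    using run(4)[OF that] unfolding chain_stop_def p_def c_def by simp
  have \<kappa>': "\<kappa>' v = v + l A - l C + p v / 2 + b * (1 - \<epsilon> v)" if "v \<in> chain_starts" for v
    using run(5)[OF that] unfolding chain_stop_def p_def b_def by simp
  have inK: "nx v \<in> chain_starts" if "v \<in> chain_starts" for v
    using run(3)[OF that] unfolding next_chain_def by simp
  have shift_eq: "y = n - v' + (r - r') / 2 + (f - f') - s / 2"
    if "x = x'" "x' = k + s / 2 + y" "x = n + a - a' + r / 2 + f" "k = v' + a - a' + r' / 2 + f'"
    for x x' k s y n a a' r r' f f' v' :: real
    using that by (simp add: field_simps)
  have E1: "L (\<kappa> v) = p (nx v) / 2 + c * \<theta> v" if v: "v \<in> chain_starts" for v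
  proof -
    have "L (\<kappa> v) = nx v - v + (p (nx v) - p v) / 2 + (c * \<epsilon> (nx v) - c * \<epsilon> v) - p (\<kappa> v) / 2"
      by (rule shift_eq[OF \<kappa>_nx[OF v] nx \<kappa>[OF inK[OF v]] \<kappa>[OF v]])
    also have "\<dots> = L v + p (nx v) / 2 + c * (\<epsilon> (nx v) - \<epsilon> v) - (b + c) * p (\<kappa> v)"
      unfolding bc using nx[of v] by (simp add: field_simps)
    also have "\<dots> = p (nx v) / 2 + c * \<theta> v"
      unfolding L_def \<theta>_def d_def by (simp add: algebra_simps)
    finally show ?thesis .
  qed
  have E2: "L (\<kappa>' v) = p (nx v) / 2 - b * \<theta> v" if v: "v \<in> chain_starts" for v
  proof -
    have "L (\<kappa>' v) = nx v - v + (p (nx v) - p v) / 2 - (b * \<epsilon> (nx v) - b * \<epsilon> v) - p (\<kappa>' v) / 2"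
      using shift_eq[OF swap.\<kappa>_nx[OF v, unfolded \<kappa>_swap] nx \<kappa>'[OF inK[OF v]] \<kappa>'[OF v]]
      by (simp add: right_diff_distrib)
    also have "\<dots> = L v + p (nx v) / 2 - b * (\<epsilon> (nx v) - \<epsilon> v) - (b + c) * p (\<kappa>' v)"
      unfolding bc using nx[of v] by (simp add: field_simps)
    also have "\<dots> = p (nx v) / 2 - b * \<theta> v"
      unfolding L_def \<theta>_def d_def by (simp add: algebra_simps)
    finally show ?thesis .
  qed
  have perp: "p (v + \<tau>) = p v" for v unfolding p_def chain_length_periodic ..
  have perL: "L (v + \<tau>) = L v" for v unfolding L_def \<kappa>_periodic perp ..
  have perd: "d (v + \<tau>) = d v" for v unfolding d_def \<kappa>_periodic perp ..
  have per\<theta>: "\<theta> (v + \<tau>) = \<theta> v" for v unfolding \<theta>_def nx_periodic \<epsilon>_periodic perd ..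
  note tr = sum_over_period[OF \<tau>_pos chain_starts_periodic, where E' = chain_starts, folded K_def]
  have transfer: "(\<Sum>v\<in>K. g (\<phi> v)) = (\<Sum>v\<in>K. g v)"
    if "\<phi> \<in> {nx, \<kappa>, \<kappa>'}" "\<And>v. g (v + \<tau>) = g v" for \<phi> and g :: "real \<Rightarrow> real"
  proof (rule tr)
    show "bij_betw \<phi> chain_starts chain_starts"
      using that(1) nx_bij \<kappa>_bij swap.\<kappa>_bij unfolding \<kappa>_swap by auto
    show "\<phi> (x + \<tau>) = \<phi> x + \<tau>" for x
      using that(1) nx_periodic \<kappa>_periodic by auto
  qed (use that in auto)
  have fin: "finite K"
    unfolding K_def by (rule finite_subset[OF _ chain_starts_finite[of 0 \<tau>]]) auto
  have KK: "v \<in> chain_starts" if "v \<in> K" for v using that unfolding K_def by simp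
  have "(\<Sum>v\<in>K. (L v)\<^sup>2) = 2 * b * (\<Sum>v\<in>K. (L v)\<^sup>2) + 2 * c * (\<Sum>v\<in>K. (L v)\<^sup>2)"
  proof -
    have "2 * b * S + 2 * c * S = 2 * (b + c) * S" for S :: real by (simp add: algebra_simps)
    thus ?thesis unfolding bc by simp
  qed
  also have "\<dots> = 2 * b * (\<Sum>v\<in>K. (L (\<kappa> v))\<^sup>2) + 2 * c * (\<Sum>v\<in>K. (L (\<kappa>' v))\<^sup>2)"
    using transfer[of \<kappa> "\<lambda>v. (L v)\<^sup>2"] transfer[of \<kappa>' "\<lambda>v. (L v)\<^sup>2"] perL by simp
  also have "\<dots> = (\<Sum>v\<in>K. (p (nx v) / 2)\<^sup>2 + b * c * (\<theta> v)\<^sup>2)"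
    unfolding sum_distrib_left sum.distrib[symmetric]
  proof (rule sum.cong[OF refl])
    fix v assume "v \<in> K"
    have "2 * b * (x + c * y)\<^sup>2 + 2 * c * (x - b * y)\<^sup>2 = 2 * (b + c) * (x\<^sup>2 + b * c * y\<^sup>2)" for x y :: real
      by (simp add: power2_eq_square algebra_simps)
    thus "2 * b * (L (\<kappa> v))\<^sup>2 + 2 * c * (L (\<kappa>' v))\<^sup>2 = (p (nx v) / 2)\<^sup>2 + b * c * (\<theta> v)\<^sup>2"
      unfolding E1[OF KK[OF \<open>v \<in> K\<close>]] E2[OF KK[OF \<open>v \<in> K\<close>]] bc by simp
  qed
  also have "\<dots> = (\<Sum>v\<in>K. (p v)\<^sup>2) / 4 + b * c * (\<Sum>v\<in>K. (\<theta> v)\<^sup>2)"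
    using transfer[of nx "\<lambda>v. (p v)\<^sup>2"] perp
    by (simp add: sum.distrib power_divide sum_divide_distrib[symmetric] sum_distrib_left)
  finally have up: "(\<Sum>v\<in>K. (L v)\<^sup>2) = (\<Sum>v\<in>K. (p v)\<^sup>2) / 4 + b * c * (\<Sum>v\<in>K. (\<theta> v)\<^sup>2)" .
  have "(\<Sum>v\<in>K. (L v)\<^sup>2) = (\<Sum>v\<in>K. b * (p (\<kappa> v))\<^sup>2 / 2 + c * (p (\<kappa>' v))\<^sup>2 / 2 - b * c * (d v)\<^sup>2)"
  proof (rule sum.cong[OF refl])
    fix v
    have sq: "(b * x + c * y)\<^sup>2 = (b + c) * (b * x\<^sup>2 + c * y\<^sup>2) - b * c * (x - y)\<^sup>2" for x y :: real
      by (simp add: power2_eq_square algebra_simps)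
    show "(L v)\<^sup>2 = b * (p (\<kappa> v))\<^sup>2 / 2 + c * (p (\<kappa>' v))\<^sup>2 / 2 - b * c * (d v)\<^sup>2"
      unfolding L_def d_def sq bc by (simp add: field_simps)
  qed
  also have "\<dots> = b / 2 * (\<Sum>v\<in>K. (p (\<kappa> v))\<^sup>2) + c / 2 * (\<Sum>v\<in>K. (p (\<kappa>' v))\<^sup>2) - b * c * (\<Sum>v\<in>K. (d v)\<^sup>2)"
    by (simp add: sum.distrib sum_subtractf sum_distrib_left)
  also have "\<dots> = (b + c) / 2 * (\<Sum>v\<in>K. (p v)\<^sup>2) - b * c * (\<Sum>v\<in>K. (d v)\<^sup>2)"
    using transfer[of \<kappa> "\<lambda>v. (p v)\<^sup>2"] transfer[of \<kappa>' "\<lambda>v. (p v)\<^sup>2"] perp by (simp add: field_simps)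
  also have "\<dots> = (\<Sum>v\<in>K. (p v)\<^sup>2) / 4 - b * c * (\<Sum>v\<in>K. (d v)\<^sup>2)"
    unfolding bc by simp
  finally have "b * c * ((\<Sum>v\<in>K. (\<theta> v)\<^sup>2) + (\<Sum>v\<in>K. (d v)\<^sup>2)) = 0"
    using up by (simp add: algebra_simps)
  hence zero: "(\<Sum>v\<in>K. (\<theta> v)\<^sup>2 + (d v)\<^sup>2) = 0" using bc by (simp add: sum.distrib)
  have *: "\<theta> v = 0 \<and> d v = 0" if "v \<in> K" for v
    using sum_nonneg_eq_0_iff[of K "\<lambda>v. (\<theta> v)\<^sup>2 + (d v)\<^sup>2"] fin zero that
    by (simp add: sum_power2_eq_zero_iff)
  define v where "v = u + of_int (- \<lfloor>u / \<tau>\<rfloor>) * \<tau>"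
  have "v \<in> {0..<\<tau>}" unfolding v_def by (rule period_representative[OF \<tau>_pos])
  moreover have "v \<in> chain_starts" unfolding v_def
    using int_shift_periodic[of \<tau> chain_starts] chain_starts_periodic u by blast
  ultimately have "v \<in> {v. \<theta> v = 0 \<and> d v = 0}" using * unfolding K_def by simp
  moreover have "v \<in> {v. \<theta> v = 0 \<and> d v = 0} \<longleftrightarrow> u \<in> {v. \<theta> v = 0 \<and> d v = 0}"
    unfolding v_def by (rule int_shift_periodic) (simp add: per\<theta> perd)
  ultimately have "u \<in> {v. \<theta> v = 0 \<and> d v = 0}" by blast
  hence "\<theta> u = 0" "d u = 0" by auto
  thus "chain_length (\<kappa> u) = chain_length (\<kappa>' u)" "\<epsilon> (nx u) = \<epsilon> u"
    unfolding \<theta>_def d_def p_def by simp_all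
qed

text \<open>Any two chains are joined by finitely many steps \<open>nx\<close>.\<close>
lemma chain_induct:
  assumes u: "u \<in> chain_starts" "Q u" and step: "\<And>u. u \<in> chain_starts \<Longrightarrow> Q (nx u) \<longleftrightarrow> Q u"
    and v: "v \<in> chain_starts"
  shows "Q v"
proof (rule ccontr)
  assume nQ: "\<not> Q v"
  show False
  proof (cases "u \<le> v")
    case True
    define G where "G = {x \<in> chain_starts \<inter> {u..v}. \<not> Q x}"
    have fin: "finite G"
      unfolding G_def by (rule finite_subset[OF _ chain_starts_finite[of u v]]) auto
    have ne: "G \<noteq> {}" unfolding G_def using True nQ v by auto
    have m: "Min G \<in> G" "\<And>x. x \<in> G \<Longrightarrow> Min G \<le> x" using fin ne by auto
    obtain y where y: "next_chain y (Min G)" using prev_chain[of "Min G"] m(1) unfolding G_def by blast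
    hence y': "y \<in> chain_starts" "y < Min G" "\<And>t. t \<in> chain_starts \<Longrightarrow> \<not> (y < t \<and> t < Min G)"
      unfolding next_chain_def by auto
    have "nx y = Min G" using nx_iff[OF y'(1)] y by simp
    have "Min G \<noteq> u" using m(1) u unfolding G_def by auto
    hence "u < Min G" using m(1) unfolding G_def by auto
    hence "u \<le> y" using y'(3)[OF u(1)] by auto
    hence "y \<in> G" using y' \<open>nx y = Min G\<close> step[of y] m(1) unfolding G_def by auto
    thus False using m(2) y'(2) by force
  next
    case False
    define G where "G = {x \<in> chain_starts \<inter> {v..u}. \<not> Q x}"
    have fin: "finite G"
      unfolding G_def by (rule finite_subset[OF _ chain_starts_finite[of v u]]) auto
    have "v \<in> G" unfolding G_def using False nQ v by simp
    hence ne: "G \<noteq> {}" by auto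
    have m: "Max G \<in> G" "\<And>x. x \<in> G \<Longrightarrow> x \<le> Max G" using fin ne by auto
    have y': "Max G \<in> chain_starts" using m(1) unfolding G_def by blast
    note n = run(3)[OF y', unfolded next_chain_def]
    have "Max G \<noteq> u" using m(1) u unfolding G_def by auto
    hence "Max G < u" using m(1) unfolding G_def by auto
    hence "nx (Max G) \<le> u" using n u by force
    hence "nx (Max G) \<in> G" using n step[of "Max G"] m(1) unfolding G_def by auto
    thus False using m(2) n by force
  qed
qed

text \<open>If one run starts with \<open>B\<close>, then by \<open>energy\<close> all runs are of the form \<open>B C \<dots> B C\<close>, and their
lengths, like those of the blocks of \<open>A\<close>, are multiples of \<open>1 / 2\<close>.  So all translations agree
modulo \<open>1 / 2\<close>, and up to shifts by multiples of \<open>1 / 2\<close> the interval of letter \<open>A\<close> is filled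
exactly by those of \<open>B\<close> and \<open>C\<close>, in this order.  Its left end is then covered by
translates of \<open>A\<close> and \<open>B\<close> only, the point \<open>w B\<close> further to the right by translates of \<open>A\<close> and
\<open>C\<close> only, which gives the two tilings of the integers.\<close>
lemma half_integer_tile_from_B:
  assumes u: "u \<in> chain_starts" and B: "starts B (chain_stop A u)"
  obtains m q :: int and F :: "int \<Rightarrow> bool" where
    "l B = l A + of_int m / 2" "l C = l A + w B + of_int q / 2"
    "\<And>k. F (k - m) = (\<not> F k)" "\<And>k. F (k - q) = (\<not> F k)"
proof -
  define H where "H x \<longleftrightarrow> (\<exists>k::int. x = of_int k / 2)" for x :: real
  have H_add: "H (x + y)" if H: "H x" "H y" for x y
  proof -
    obtain j k :: int where "x = of_int j / 2" "y = of_int k / 2" using H unfolding H_def by blast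
    thus ?thesis unfolding H_def by (intro exI[of _ "j + k"]) (simp add: add_divide_distrib)
  qed
  have H_uminus: "H (- x)" if H: "H x" for x
  proof -
    obtain j :: int where "x = of_int j / 2" using H unfolding H_def by blast
    thus ?thesis unfolding H_def by (intro exI[of _ "- j"]) simp
  qed
  have H_diff: "H (x - y)" if "H x" "H y" for x y using H_add[OF that(1) H_uminus[OF that(2)]] by simp
  have H_nat: "H (real k / 2)" for k unfolding H_def by (intro exI[of _ "int k"]) simp
  have H_step: "H (nx v - v)" if "v \<in> chain_starts" for v
  proof -
    have "nx v - v = real (chain_length v) / 2 + (w B + w C) * real (chain_length (\<kappa> v))"
      unfolding nx_def chain_stop_def energy(1)[OF that] by (simp add: algebra_simps)
    hence "nx v - v = real (chain_length v) / 2 + real (chain_length (\<kappa> v)) / 2"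
      unfolding w_BC by simp
    thus ?thesis using H_add H_nat by metis
  qed
  have nice: "\<epsilon> v = 0 \<and> H (v - u)" if v: "v \<in> chain_starts" for v
  proof (rule chain_induct[of u, OF u _ _ v])
    show "\<epsilon> u = 0 \<and> H (u - u)" using B H_nat[of 0] unfolding \<epsilon>_def by simp
    show "(\<epsilon> (nx v) = 0 \<and> H (nx v - u)) \<longleftrightarrow> (\<epsilon> v = 0 \<and> H (v - u))" if v: "v \<in> chain_starts" for v
      using energy(2)[OF v] H_add[OF H_step[OF v], of "v - u"] H_diff[of "nx v - u" "nx v - v"] H_step[OF v]
      by auto
  qed
  have HT: "H (t - u)" if t: "t \<in> T" for t
  proof -
    obtain v k where v: "v \<in> chain_starts" "t = v + real k / 2" using chain_begins[OF t] by metis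
    have "t - u = (v - u) + real k / 2" using v by simp
    thus ?thesis using H_add[OF _ H_nat[of k]] nice[OF v(1)] by metis
  qed
  define e where "e = chain_stop A u"
  have r: "\<kappa> u \<in> T" "\<kappa>' u \<in> T" "\<kappa> u + l B = e" "\<kappa>' u + l C = e + w B" "e = u + l A + real (chain_length u) / 2"
    using run_B[OF u B] unfolding e_def chain_starts_def chain_stop_def by auto
  have "l B - l A = real (chain_length u) / 2 - (\<kappa> u - u)" using r by simp
  hence "H (l B - l A)" using H_diff[OF H_nat HT[OF r(1)]] by simp
  then obtain m :: int where m: "l B - l A = of_int m / 2" unfolding H_def by blast
  have "l C - l A - w B = real (chain_length u) / 2 - (\<kappa>' u - u)" using r by simp
  hence "H (l C - l A - w B)" using H_diff[OF H_nat HT[OF r(2)]] by simp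
  then obtain q :: int where q: "l C - l A - w B = of_int q / 2" unfolding H_def by blast
  define F where "F k \<longleftrightarrow> u + of_int k / 2 \<in> T" for k :: int
  have lB: "l B = l A + of_int m / 2" and lC: "l C = l A + w B + of_int q / 2" using m q by auto
  note bc = w_BC w_BC_le
  have cov: "\<exists>i n. starts i (u + of_int n / 2 + l i) \<and> u + of_int n / 2 + l i \<le> z \<and> z < u + of_int n / 2 + l i + w i" for z
  proof -
    obtain i t where it: "t \<in> T" "t + l i \<le> z" "z < t + l i + w i" using cover by blast
    obtain n :: int where n: "t - u = of_int n / 2" using HT[OF it(1)] unfolding H_def by blast
    hence t: "t = u + of_int n / 2" by simp
    show ?thesis using it starts_tile[OF it(1), of i] unfolding t by blast
  qed
  have Fst: "starts i (u + of_int n / 2 + l i) \<longleftrightarrow> F n" for i n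
    unfolding starts_def F_def by simp
  have stB: "starts B (u + of_int k / 2 + l A) \<longleftrightarrow> F (k - m)" for k
    unfolding starts_def F_def lB by (simp add: algebra_simps diff_divide_distrib)
  have stC: "starts C (u + of_int k / 2 + l A + w B) \<longleftrightarrow> F (k - q)" for k
    unfolding starts_def F_def lC by (simp add: algebra_simps diff_divide_distrib)
  have between: "n = k" if "of_int n \<le> (of_int k :: real)" "of_int k < (of_int n + 1 :: real)" for n k :: int
    using that by linarith
  have Fm: "F (k - m) = (\<not> F k)" for k
  proof -
    have "\<not> (F k \<and> F (k - m))"
      using Fst[of A k] stB[of k] starts_fun distinct by blast
    moreover have "F k \<or> F (k - m)"
    proof -
      obtain i n where i: "starts i (u + of_int n / 2 + l i)" "u + of_int n / 2 + l i \<le> u + of_int k / 2 + l A"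
        "u + of_int k / 2 + l A < u + of_int n / 2 + l i + w i" using cov by blast
      have Fn: "F n" using i(1) Fst by blast
      consider "i = A" | "i = B" | "i = C" using letters[of i] by blast
      thus ?thesis
      proof cases
        case 1
        hence "n = k" using i wA by (intro between) auto
        thus ?thesis using Fn by simp
      next
        case 2
        hence "n + m = k" using i bc lB by (intro between) (auto simp: field_simps)
        hence "n = k - m" by simp
        thus ?thesis using Fn by simp
      next
        case 3
        have a: "real_of_int (n + q) < of_int k" "real_of_int k < of_int (n + q) + 1"
          using i bc unfolding 3 lC by (auto simp: field_simps)
        thus ?thesis using no_int_strictly_between[of "n + q" k] no_int_strictly_between[of k "n + m"] by auto
      qed
    qed
    ultimately show ?thesis by blast
  qed
  have Fq: "F (k - q) = (\<not> F k)" for k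
  proof -
    have "\<not> (F k \<and> F (k - q))"
      using starts_unique[of A "u + of_int k / 2 + l A" C "u + of_int k / 2 + l A + w B"
          "u + of_int k / 2 + l A + w B"] Fst[of A k] stC[of k] distinct bc wA by auto
    moreover have "F k \<or> F (k - q)"
    proof -
      obtain i n where i: "starts i (u + of_int n / 2 + l i)" "u + of_int n / 2 + l i \<le> u + of_int k / 2 + l A + w B"
        "u + of_int k / 2 + l A + w B < u + of_int n / 2 + l i + w i" using cov by blast
      have Fn: "F n" using i(1) Fst by blast
      consider "i = A" | "i = B" | "i = C" using letters[of i] by blast
      thus ?thesis
      proof cases
        case 1
        have "of_int n < (of_int k + 1 :: real)" "(of_int k :: real) < of_int n + 1"
          using i wA bc unfolding 1 by (auto simp: field_simps)
        hence "n = k" by linarith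
        thus ?thesis using Fn by simp
      next
        case 2
        have a: "real_of_int k < of_int (n + m)" "real_of_int (n + m) < of_int k + 1"
          using i bc unfolding 2 lB by (auto simp: field_simps)
        thus ?thesis using no_int_strictly_between[of "n + q" k] no_int_strictly_between[of k "n + m"] by auto
      next
        case 3
        hence "n + q = k" using i bc lC by (intro between) (auto simp: field_simps)
        hence "n = k - q" by simp
        thus ?thesis using Fn by simp
      qed
    qed
    ultimately show ?thesis by blast
  qed
  show ?thesis using that[of m q F] lB lC Fm Fq by blast
qed

lemma half_integer_tile:
  obtains B' C' :: letter and m q :: int and F :: "int \<Rightarrow> bool" where
    "A \<noteq> B'" "B' \<noteq> C'" "A \<noteq> C'"
    "l B' = l A + of_int m / 2" "l C' = l A + w B' + of_int q / 2"
    "\<And>k. F (k - m) = (\<not> F k)" "\<And>k. F (k - q) = (\<not> F k)"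
proof -
  interpret swap: half_tiling l w T \<tau> A C B by (rule swap)
  obtain t where "t \<in> T" using T_unbounded by blast
  then obtain u where u: "u \<in> chain_starts" using chain_begins by metis
  consider "starts B (chain_stop A u)" | "starts C (chain_stop A u)" using starts_stop(2)[OF u] by blast
  thus ?thesis
  proof cases
    case 1
    from half_integer_tile_from_B[OF u this] that[of B C] distinct show ?thesis by metis
  next
    case 2
    from swap.half_integer_tile_from_B[OF u this] that[of C B] distinct show ?thesis by metis
  qed
qed

end

section \<open>The three kinds of tilings\<close>

context interval_tiling
begin

text \<open>The conditions on divisibility say that \<open>m\<close> and \<open>q\<close> contain the same power of \<open>2\<close>, and that
\<open>m\<close>, \<open>q\<close> and \<open>m - q\<close> contain the same power of \<open>3\<close>, respectively.\<close>
theorem trichotomy: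
  obtains (unit) "\<And>t. t \<in> T \<Longrightarrow> t + 1 \<in> T"
  | (half) A B C :: letter and m q :: int where
      "A \<noteq> B" "B \<noteq> C" "A \<noteq> C" "w A = 1 / 2"
      "l B = l A + of_int m / 2" "l C = l A + w B + of_int q / 2"
      "\<not> 2 * gcd m q dvd m" "\<not> 2 * gcd m q dvd q"
  | (third) m q :: int where
      "\<And>i. w i = 1 / 3" "l LB = l LA + of_int m / 3" "l LC = l LA + of_int q / 3"
      "\<not> 3 * gcd m q dvd m" "\<not> 3 * gcd m q dvd q" "\<not> 3 * gcd m q dvd m - q"
proof -
  obtain \<tau> where \<tau>: "\<tau> > 0" "\<And>x. x + \<tau> \<in> T \<longleftrightarrow> x \<in> T" using periodic by blast
  interpret periodic_tiling l w T \<tau> by unfold_locales (use \<tau> in auto)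
  show ?thesis
  proof (cases "w LA = w LB \<and> w LB = w LC")
    case True
    hence w: "w i = 1 / 3" for i using w_sum by (cases i) auto
    obtain m q F where "l LB = l LA + of_int m / 3" "l LC = l LA + of_int q / 3"
      "\<And>k. of_bool (F k) + of_bool (F (k - m)) + of_bool (F (k - q)) = (1::int)"
      using equal_lengths_imp_integer_tile[OF w] by metis
    thus ?thesis using third[of m q] w three_element_tile[of F m q] by blast
  next
    case ne: False
    show ?thesis
    proof (cases "\<exists>i x. starts i x \<and> starts i (x + w i)")
      case False
      thus ?thesis using unit no_double_letter_imp_unit_translate[OF _ ne] by blast
    next
      case True
      then obtain A x where A: "starts A x" "starts A (x + w A)" by blast
      obtain B C where d: "A \<noteq> B" "B \<noteq> C" "A \<noteq> C"
      proof -
        have "\<exists>B C. A \<noteq> B \<and> B \<noteq> C \<and> A \<noteq> C" by (cases A) blast+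
        thus ?thesis using that by blast
      qed
      have "\<not> (w A = w B \<and> w B = w C)" using ne d by (cases A; cases B; cases C) auto
      hence wA: "w A = 1 / 2" using double_letter[OF d A] by blast
      interpret half_tiling l w T \<tau> A B C by unfold_locales (use d wA in auto)
      obtain B' C' m q F where
        "A \<noteq> B'" "B' \<noteq> C'" "A \<noteq> C'"
        "l B' = l A + of_int m / 2" "l C' = l A + w B' + of_int q / 2"
        "\<And>k. F (k - m) = (\<not> F k)" "\<And>k. F (k - q) = (\<not> F k)"
        using half_integer_tile by metis
      thus ?thesis using half[of A B' C' m q] two_element_tile[of F m q] wA by blast
    qed
  qed
qed

end

section \<open>Uniform approximation by trigonometric polynomials\<close>

text \<open>Linear combinations over the complex numbers of a family of functions, as an inductive predicate,
so that closure properties are proved by induction.\<close>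
inductive lin_comb :: "('i \<Rightarrow> real \<Rightarrow> complex) \<Rightarrow> 'i set \<Rightarrow> (real \<Rightarrow> complex) \<Rightarrow> bool"
  for e :: "'i \<Rightarrow> real \<Rightarrow> complex" and J :: "'i set" where
  zero: "lin_comb e J (\<lambda>x. 0)"
| add_term: "j \<in> J \<Longrightarrow> lin_comb e J f \<Longrightarrow> lin_comb e J (\<lambda>x. f x + c * e j x)"

lemma lin_comb_finite_sum:
  assumes "lin_comb e J f"
  shows "\<exists>F c. finite F \<and> F \<subseteq> J \<and> (\<forall>x. f x = (\<Sum>j\<in>F. c j * e j x))"
  using assms
proof induction
  case zero thus ?case by (intro exI[of _ "{}"]) auto
next
  case (add_term j f c)
  then obtain F d where F: "finite F" "F \<subseteq> J" "\<And>x. f x = (\<Sum>j\<in>F. d j * e j x)" by blast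
  define d' where "d' = (\<lambda>i. (if i \<in> F then d i else 0) + (if i = j then c else 0))"
  have "f x + c * e j x = (\<Sum>i\<in>insert j F. d' i * e i x)" for x
  proof -
    have "(\<Sum>i\<in>insert j F. d' i * e i x) =
      (\<Sum>i\<in>insert j F. (if i \<in> F then d i else 0) * e i x) + (\<Sum>i\<in>insert j F. (if i = j then c else 0) * e i x)"
      unfolding d'_def by (simp add: sum.distrib distrib_right)
    also have "(\<Sum>i\<in>insert j F. (if i \<in> F then d i else 0) * e i x) = (\<Sum>i\<in>F. d i * e i x)"
      using F(1) by (intro sum.mono_neutral_cong_right) auto
    also have "(\<Sum>i\<in>insert j F. (if i = j then c else 0) * e i x) = c * e j x"
      using F(1) by (subst sum.mono_neutral_cong_right[of "insert j F" "{j}" _ "\<lambda>i. c * e i x"]) auto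
    finally show ?thesis using F(3) by simp
  qed
  thus ?case using F add_term.hyps(1) by (intro exI[of _ "insert j F"] exI[of _ d']) auto
qed

lemma lin_comb_add: "lin_comb e J g \<Longrightarrow> lin_comb e J f \<Longrightarrow> lin_comb e J (\<lambda>x. f x + g x)"
proof (induction rule: lin_comb.induct)
  case (add_term j g c)
  have "lin_comb e J (\<lambda>x. (f x + g x) + c * e j x)" using add_term by (intro lin_comb.add_term) auto
  thus ?case by (simp add: add.assoc)
qed simp

lemma lin_comb_scale: "lin_comb e J f \<Longrightarrow> lin_comb e J (\<lambda>x. a * f x)"
proof (induction rule: lin_comb.induct)
  case (add_term j f c)
  have "lin_comb e J (\<lambda>x. a * f x + (a * c) * e j x)" using add_term by (intro lin_comb.add_term) auto
  thus ?case by (simp add: algebra_simps)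
qed (simp add: lin_comb.zero)

lemma lin_comb_single: "j \<in> J \<Longrightarrow> lin_comb e J (\<lambda>x. c * e j x)"
  using lin_comb.add_term[OF _ lin_comb.zero, of j J e c] by simp

lemma lin_comb_sum: "finite A \<Longrightarrow> (\<And>i. i \<in> A \<Longrightarrow> lin_comb e J (f i)) \<Longrightarrow> lin_comb e J (\<lambda>x. \<Sum>i\<in>A. f i x)"
proof (induction rule: finite_induct)
  case (insert i A)
  have "lin_comb e J (\<lambda>x. f i x + (\<Sum>i\<in>A. f i x))" using insert by (intro lin_comb_add) auto
  thus ?case using insert by simp
qed (simp add: lin_comb.zero)

abbreviation trig_poly :: "(real \<Rightarrow> complex) \<Rightarrow> bool" where
  "trig_poly \<equiv> lin_comb (\<lambda>(k::int) x. cis (2 * pi * of_int k * x)) UNIV"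

lemma trig_poly_mult: "trig_poly f \<Longrightarrow> trig_poly g \<Longrightarrow> trig_poly (\<lambda>x. f x * g x)"
proof (induction rule: lin_comb.induct)
  case (add_term k f c)
  have "trig_poly (\<lambda>x. (c * cis (2 * pi * of_int k * x)) * g x)"
    using \<open>trig_poly g\<close>
  proof (induction rule: lin_comb.induct)
    case (add_term j g d)
    have "trig_poly (\<lambda>x. c * cis (2 * pi * of_int k * x) * g x + (c * d) * cis (2 * pi * of_int (k + j) * x))"
      using add_term.IH by (rule lin_comb.add_term[rotated]) simp
    moreover have "c * cis (2 * pi * of_int k * x) * g x + (c * d) * cis (2 * pi * of_int (k + j) * x) =
      c * cis (2 * pi * of_int k * x) * (g x + d * cis (2 * pi * of_int j * x))" for x
      by (simp add: algebra_simps cis_mult)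
    ultimately show ?case by simp
  qed (simp add: lin_comb.zero)
  from lin_comb_add[OF this add_term.IH[OF add_term.prems]]
  show ?case by (simp add: algebra_simps)
qed (simp add: lin_comb.zero)

lemma trig_poly_cis: "trig_poly (\<lambda>x. c * cis (2 * pi * of_int k * x))"
  by (rule lin_comb_single) simp

lemma trig_poly_const: "trig_poly (\<lambda>x. c)"
  using trig_poly_cis[of c 0] by simp

text \<open>Real and imaginary part of the point \<open>cis (2 * pi * x)\<close> of the circle are trigonometric
polynomials in \<open>x\<close>, and these are closed under sums and products.\<close>
lemma real_polynomial_function_on_circle:
  fixes h :: "complex \<Rightarrow> real"
  assumes "real_polynomial_function h"
  shows "trig_poly (\<lambda>x. of_real (h (cis (2 * pi * x))))"
  using assms
proof (induction rule: real_polynomial_function.induct)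
  case (linear h)
  interpret bounded_linear h by fact
  have eq: "of_real (h (cis (2 * pi * x))) =
      ((h 1 - \<i> * h \<i>) / 2) * cis (2 * pi * of_int 1 * x) + ((h 1 + \<i> * h \<i>) / 2) * cis (2 * pi * of_int (- 1) * x)" for x
  proof -
    have "cis (2 * pi * x) = cos (2 * pi * x) *\<^sub>R 1 + sin (2 * pi * x) *\<^sub>R \<i>"
      by (simp add: complex_eq_iff)
    hence "h (cis (2 * pi * x)) = cos (2 * pi * x) * h 1 + sin (2 * pi * x) * h \<i>"
      by (simp add: add scale)
    thus ?thesis by (simp add: complex_eq_iff field_simps)
  qed
  show ?case unfolding eq by (intro lin_comb_add trig_poly_cis)
next
  case (const c) show ?case by (rule trig_poly_const)
next
  case (add f g) thus ?case using lin_comb_add by (simp add: add.commute)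
next
  case (mult f g) thus ?case using trig_poly_mult by simp
qed

text \<open>A function of period \<open>1\<close> is a function on the unit circle, where the Stone--Weierstrass theorem
applies.  Continuity on the circle is checked with two branches of the argument, cut along the
negative and along the positive real axis.\<close>
theorem periodic_trig_approximation:
  fixes F :: "real \<Rightarrow> complex"
  assumes cont: "continuous_on UNIV F" and per: "\<And>x. F (x + 1) = F x" and "\<epsilon> > 0"
  obtains P where "trig_poly P" "\<And>x. norm (F x - P x) < \<epsilon>"
proof -
  have perI: "F (x + of_int k) = F x" for x k
    using periodic_int_multiple[of F 1, OF per] by simp
  have perE: "F (a / (2 * pi)) = F (b / (2 * pi))" if "cis a = cis b" for a b
  proof -
    have "exp (\<i> * of_real a) = exp (\<i> * of_real b)" using that by (simp add: cis_conv_exp)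
    then obtain n :: int where "\<i> * of_real a = \<i> * of_real b + (of_int (2 * n) * pi) * \<i>"
      by (auto simp: exp_eq)
    hence "a = b + 2 * of_int n * pi" by (auto simp: complex_eq_iff)
    hence "a / (2 * pi) = b / (2 * pi) + of_int n" by (simp add: field_simps)
    thus ?thesis using perI by simp
  qed
  have contF: "isCont F x" for x using cont by (simp add: continuous_on_eq_continuous_at)
  define \<phi> where "\<phi> z = F (Arg z / (2 * pi))" for z
  define \<psi> where "\<psi> z = F ((Arg (- z) + pi) / (2 * pi))" for z
  have cis_Arg1: "cis (Arg z) = z" if "norm z = 1" for z
    using that by (metis complex_norm_eq_1_exp cis_conv_exp is_Arg_def Arg_eq mult.left_neutral of_real_1 norm_zero zero_neq_one)
  have eq: "\<phi> z = \<psi> z" if "norm z = 1" for z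
    unfolding \<phi>_def \<psi>_def
  proof (rule perE)
    have "cis (Arg (- z) + pi) = cis (Arg (- z)) * cis pi" by (rule cis_mult[symmetric])
    also have "\<dots> = z" using cis_Arg1[of "- z"] that by simp
    finally show "cis (Arg z) = cis (Arg (- z) + pi)" using cis_Arg1[OF that] by simp
  qed
  have "continuous_on (sphere 0 1) \<phi>"
    unfolding continuous_on_eq_continuous_within
  proof
    fix z :: complex assume z: "z \<in> sphere 0 1"
    show "continuous (at z within sphere 0 1) \<phi>"
    proof (cases "z \<in> \<real>\<^sub>\<le>\<^sub>0")
      case False
      have "isCont \<phi> z" unfolding \<phi>_def
        by (rule isCont_o2[OF _ contF]) (use False in \<open>auto intro!: continuous_intros continuous_at_Arg\<close>)
      thus ?thesis by (rule continuous_at_imp_continuous_within)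
    next
      case True
      moreover have "z \<noteq> 0" using z by auto
      ultimately have "- z \<notin> \<real>\<^sub>\<le>\<^sub>0" by (auto simp: complex_nonpos_Reals_iff complex_eq_iff)
      hence "isCont (\<lambda>z. Arg (- z)) z"
        by (intro isCont_o2[of z uminus Arg] continuous_at_Arg) (auto intro!: continuous_intros)
      hence "isCont \<psi> z" unfolding \<psi>_def
        by (intro isCont_o2[OF _ contF] continuous_intros) auto
      hence "continuous (at z within sphere 0 1) \<psi>" by (rule continuous_at_imp_continuous_within)
      thus ?thesis
        by (rule continuous_transform_within[OF _ zero_less_one z]) (use eq in auto)
    qed
  qed
  then obtain g where g: "polynomial_function g" "\<And>z. z \<in> sphere 0 1 \<Longrightarrow> norm (\<phi> z - g z) < \<epsilon>"
    using Stone_Weierstrass_polynomial_function[of "sphere 0 1" \<phi> \<epsilon>] \<open>\<epsilon> > 0\<close> by auto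
  define P where "P x = g (cis (2 * pi * x))" for x
  have re: "real_polynomial_function (Re \<circ> g)" and im: "real_polynomial_function (Im \<circ> g)"
    using g(1) bounded_linear_Re bounded_linear_Im unfolding polynomial_function_def by blast+
  have "trig_poly (\<lambda>x. of_real (Re (g (cis (2 * pi * x)))) + \<i> * of_real (Im (g (cis (2 * pi * x)))))"
    using real_polynomial_function_on_circle[OF re] real_polynomial_function_on_circle[OF im]
    by (intro lin_comb_add lin_comb_scale) auto
  hence "trig_poly P" unfolding P_def using complex_eq by simp
  moreover have "norm (F x - P x) < \<epsilon>" for x
  proof -
    have n: "norm (cis (2 * pi * x)) = 1" by simp
    have "F (Arg (cis (2 * pi * x)) / (2 * pi)) = F ((2 * pi * x) / (2 * pi))"
      by (rule perE) (rule cis_Arg1[OF n])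
    hence "\<phi> (cis (2 * pi * x)) = F x" unfolding \<phi>_def by simp
    thus ?thesis using g(2)[of "cis (2 * pi * x)"] unfolding P_def by simp
  qed
  ultimately show ?thesis using that by blast
qed

lemma sum_roots_of_unity:
  assumes N: "N > (0::nat)" and k: "\<not> int N dvd k"
  shows "(\<Sum>j<N. cis (2 * pi * real j * (of_int k / real N))) = 0"
proof -
  define z where "z = cis (2 * pi * (of_int k / real N))"
  have pw: "cis (2 * pi * real j * (of_int k / real N)) = z ^ j" for j
    by (simp only: z_def Complex.DeMoivre mult_ac)
  have "z ^ N = 1"
  proof -
    have "z ^ N = cis (2 * pi * of_int k)" unfolding z_def Complex.DeMoivre using N by simp
    thus ?thesis by (simp add: cis_multiple_2pi)
  qed
  moreover have "z \<noteq> 1"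
  proof
    assume "z = 1"
    hence "cos (2 * pi * (of_int k / real N)) = 1" unfolding z_def by (simp add: complex_eq_iff)
    then obtain n :: int where "2 * pi * (of_int k / real N) = of_int n * 2 * pi"
      by (auto simp: cos_one_2pi_int)
    hence "of_int k = (of_int (n * int N) :: real)" using N by (simp add: field_simps)
    hence "k = n * int N" by (simp only: of_int_eq_iff)
    thus False using k by simp
  qed
  ultimately show ?thesis unfolding pw using geometric_sum[of z N] by simp
qed

section \<open>Approximation in mean square\<close>

definition L2_sq :: "real set \<Rightarrow> (real \<Rightarrow> complex) \<Rightarrow> real" where
  "L2_sq \<Omega> f = (\<integral>x. (norm (f x))\<^sup>2 \<partial>lebesgue_on \<Omega>)"

lemma norm_add_sq_le: "(norm (a + b))\<^sup>2 \<le> 2 * (norm a)\<^sup>2 + 2 * (norm (b::complex))\<^sup>2"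
proof -
  have "(norm (a + b))\<^sup>2 \<le> (norm a + norm b)\<^sup>2" by (simp add: norm_triangle_ineq power_mono)
  also have "\<dots> \<le> 2 * (norm a)\<^sup>2 + 2 * (norm b)\<^sup>2"
    using sum_squares_bound[of "norm a" "norm b"] by (simp add: power2_sum)
  finally show ?thesis .
qed

lemma L2_add:
  assumes "f \<in> L2_on \<Omega>" "g \<in> L2_on \<Omega>"
  shows "(\<lambda>x. f x + g x) \<in> L2_on \<Omega>" "L2_sq \<Omega> (\<lambda>x. f x + g x) \<le> 2 * L2_sq \<Omega> f + 2 * L2_sq \<Omega> g"
proof -
  have [measurable]: "f \<in> borel_measurable (lebesgue_on \<Omega>)" "g \<in> borel_measurable (lebesgue_on \<Omega>)"
    and int: "integrable (lebesgue_on \<Omega>) (\<lambda>x. (norm (f x))\<^sup>2)" "integrable (lebesgue_on \<Omega>) (\<lambda>x. (norm (g x))\<^sup>2)"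
    using assms unfolding L2_on_def by auto
  have i2: "integrable (lebesgue_on \<Omega>) (\<lambda>x. 2 * (norm (f x))\<^sup>2 + 2 * (norm (g x))\<^sup>2)"
    using int by auto
  have i1: "integrable (lebesgue_on \<Omega>) (\<lambda>x. (norm (f x + g x))\<^sup>2)"
    by (rule Bochner_Integration.integrable_bound[OF i2]) (auto simp: norm_add_sq_le)
  show "(\<lambda>x. f x + g x) \<in> L2_on \<Omega>" unfolding L2_on_def using i1 by auto
  have "L2_sq \<Omega> (\<lambda>x. f x + g x) \<le> (\<integral>x. 2 * (norm (f x))\<^sup>2 + 2 * (norm (g x))\<^sup>2 \<partial>lebesgue_on \<Omega>)"
    unfolding L2_sq_def by (rule integral_mono[OF i1 i2]) (rule norm_add_sq_le)
  thus "L2_sq \<Omega> (\<lambda>x. f x + g x) \<le> 2 * L2_sq \<Omega> f + 2 * L2_sq \<Omega> g"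
    using int unfolding L2_sq_def by simp
qed

lemma L2_scale:
  assumes "f \<in> L2_on \<Omega>"
  shows "(\<lambda>x. c * f x) \<in> L2_on \<Omega>" "L2_sq \<Omega> (\<lambda>x. c * f x) = (norm c)\<^sup>2 * L2_sq \<Omega> f"
  using assms unfolding L2_on_def L2_sq_def by (auto simp: norm_mult power_mult_distrib)

lemma L2_diff: "f \<in> L2_on \<Omega> \<Longrightarrow> g \<in> L2_on \<Omega> \<Longrightarrow> (\<lambda>x. f x - g x) \<in> L2_on \<Omega>"
  using L2_add(1)[of f \<Omega> "\<lambda>x. (- 1) * g x"] L2_scale(1)[of g \<Omega> "- 1"] by simp

lemma L2_zero: "(\<lambda>x. 0) \<in> L2_on \<Omega>"
  unfolding L2_on_def by simp

lemma L2_bounded: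
  assumes "\<Omega> \<in> lmeasurable" "f \<in> borel_measurable (lebesgue_on \<Omega>)" "\<And>x. x \<in> \<Omega> \<Longrightarrow> norm (f x) \<le> B"
  shows "f \<in> L2_on \<Omega>"
proof -
  interpret finite_measure "lebesgue_on \<Omega>" by (rule finite_measure_lebesgue_on[OF assms(1)])
  have "AE x in lebesgue_on \<Omega>. norm ((norm (f x))\<^sup>2) \<le> B\<^sup>2"
    by (rule AE_I2) (use assms(3) in \<open>auto intro!: power_mono simp: space_restrict_space\<close>)
  hence "integrable (lebesgue_on \<Omega>) (\<lambda>x. (norm (f x))\<^sup>2)"
    by (rule integrable_const_bound) (use assms(2) in measurable)
  thus ?thesis using assms(2) unfolding L2_on_def by simp
qed

lemma L2_lin_comb:
  assumes "\<And>j. j \<in> J \<Longrightarrow> e j \<in> L2_on \<Omega>" "lin_comb e J f"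
  shows "f \<in> L2_on \<Omega>"
  using assms(2)
  by (induction rule: lin_comb.induct) (auto intro!: L2_zero L2_add(1) L2_scale(1) assms(1))

lemma L2_sq_cong: "(\<And>x. x \<in> \<Omega> \<Longrightarrow> f x = g x) \<Longrightarrow> L2_sq \<Omega> f = L2_sq \<Omega> g"
  unfolding L2_sq_def by (intro Bochner_Integration.integral_cong) (auto simp: space_restrict_space)

lemma L2_on_cong: "(\<And>x. x \<in> \<Omega> \<Longrightarrow> f x = g x) \<Longrightarrow> f \<in> L2_on \<Omega> \<longleftrightarrow> g \<in> L2_on \<Omega>"
proof -
  assume eq: "\<And>x. x \<in> \<Omega> \<Longrightarrow> f x = g x"
  have "f \<in> borel_measurable (lebesgue_on \<Omega>) \<longleftrightarrow> g \<in> borel_measurable (lebesgue_on \<Omega>)"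
    by (rule measurable_cong) (simp add: eq space_restrict_space)
  moreover have "integrable (lebesgue_on \<Omega>) (\<lambda>x. (norm (f x))\<^sup>2) \<longleftrightarrow> integrable (lebesgue_on \<Omega>) (\<lambda>x. (norm (g x))\<^sup>2)"
    by (rule Bochner_Integration.integrable_cong) (simp_all add: eq space_restrict_space)
  ultimately show ?thesis unfolding L2_on_def by simp
qed

definition approximable :: "real set \<Rightarrow> ((real \<Rightarrow> complex) \<Rightarrow> bool) \<Rightarrow> (real \<Rightarrow> complex) \<Rightarrow> bool" where
  "approximable \<Omega> G f \<longleftrightarrow> (\<forall>\<epsilon>>0. \<exists>g. G g \<and> L2_sq \<Omega> (\<lambda>x. f x - g x) < \<epsilon>)"

text \<open>To approximate all square integrable functions it suffices to approximate continuous functions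
that vanish outside an open set of full measure; the lemmas below pass from these to indicator
functions, to simple functions and to limits.  Distances are measured by squares, for which
\<open>norm_add_sq_le\<close> replaces the triangle inequality.\<close>
locale L2_family =
  fixes \<Omega> :: "real set" and e :: "'i \<Rightarrow> real \<Rightarrow> complex" and J :: "'i set"
  assumes Om: "\<Omega> \<in> lmeasurable" and e_L2: "\<And>j. j \<in> J \<Longrightarrow> e j \<in> L2_on \<Omega>"
begin

abbreviation "approx \<equiv> approximable \<Omega> (lin_comb e J)"

lemmas lin_comb_L2 = L2_lin_comb[OF e_L2]

lemma approx_add:
  assumes f: "f \<in> L2_on \<Omega>" "approx f" and g: "g \<in> L2_on \<Omega>" "approx g"
  shows "approx (\<lambda>x. f x + g x)"
  unfolding approximable_def
proof (intro allI impI)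
  fix \<epsilon> :: real assume "\<epsilon> > 0"
  hence \<epsilon>: "\<epsilon> / 4 > 0" by simp
  obtain f' g' where f': "lin_comb e J f'" "L2_sq \<Omega> (\<lambda>x. f x - f' x) < \<epsilon> / 4"
    and g': "lin_comb e J g'" "L2_sq \<Omega> (\<lambda>x. g x - g' x) < \<epsilon> / 4"
    using f(2) g(2) \<epsilon> unfolding approximable_def by meson
  have "L2_sq \<Omega> (\<lambda>x. (f x - f' x) + (g x - g' x)) < \<epsilon>"
    using L2_add(2)[OF L2_diff[OF f(1) lin_comb_L2[OF _ f'(1)]] L2_diff[OF g(1) lin_comb_L2[OF _ g'(1)]]] f'(2) g'(2)
    by fastforce
  moreover have "(f x - f' x) + (g x - g' x) = (f x + g x) - (f' x + g' x)" for x by simp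
  ultimately show "\<exists>h. lin_comb e J h \<and> L2_sq \<Omega> (\<lambda>x. f x + g x - h x) < \<epsilon>"
    using lin_comb_add[OF g'(1) f'(1)] by (intro exI[of _ "\<lambda>x. f' x + g' x"]) simp
qed

lemma approx_scale:
  assumes f: "f \<in> L2_on \<Omega>" "approx f"
  shows "approx (\<lambda>x. c * f x)"
  unfolding approximable_def
proof (intro allI impI)
  fix \<epsilon> :: real assume \<epsilon>: "\<epsilon> > 0"
  define \<delta> where "\<delta> = \<epsilon> / ((norm c)\<^sup>2 + 1)"
  have pos: "(norm c)\<^sup>2 + 1 > 0" by (simp add: add_nonneg_pos)
  hence "\<delta> > 0" unfolding \<delta>_def using \<epsilon> by simp
  then obtain g where g: "lin_comb e J g" "L2_sq \<Omega> (\<lambda>x. f x - g x) < \<delta>"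
    using f(2) unfolding approximable_def by meson
  have "L2_sq \<Omega> (\<lambda>x. c * (f x - g x)) = (norm c)\<^sup>2 * L2_sq \<Omega> (\<lambda>x. f x - g x)"
    by (rule L2_scale(2)[OF L2_diff[OF f(1) lin_comb_L2[OF _ g(1)]]])
  also have "\<dots> \<le> (norm c)\<^sup>2 * \<delta>" using g(2) by (intro mult_left_mono) auto
  also have "\<dots> < \<epsilon>" unfolding \<delta>_def using pos \<epsilon> by (simp add: field_simps)
  finally show "\<exists>h. lin_comb e J h \<and> L2_sq \<Omega> (\<lambda>x. c * f x - h x) < \<epsilon>"
    using lin_comb_scale[OF g(1), of c] by (intro exI[of _ "\<lambda>x. c * g x"]) (simp add: right_diff_distrib)
qed

lemma approx_zero: "approx (\<lambda>x. 0)"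
  unfolding approximable_def
proof (intro allI impI)
  fix \<epsilon> :: real assume "\<epsilon> > 0"
  thus "\<exists>g. lin_comb e J g \<and> L2_sq \<Omega> (\<lambda>x. 0 - g x) < \<epsilon>"
    by (intro exI[of _ "\<lambda>x. 0"]) (auto simp: L2_sq_def lin_comb.zero)
qed

lemma approx_limit:
  assumes f: "f \<in> L2_on \<Omega>" and lim: "\<And>\<epsilon>. \<epsilon> > 0 \<Longrightarrow> \<exists>g\<in>L2_on \<Omega>. approx g \<and> L2_sq \<Omega> (\<lambda>x. f x - g x) < \<epsilon>"
  shows "approx f"
  unfolding approximable_def
proof (intro allI impI)
  fix \<epsilon> :: real assume "\<epsilon> > 0"
  hence \<epsilon>: "\<epsilon> / 4 > 0" by simp
  obtain g where g: "g \<in> L2_on \<Omega>" "approx g" "L2_sq \<Omega> (\<lambda>x. f x - g x) < \<epsilon> / 4" using lim[OF \<epsilon>] by blast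
  obtain h where h: "lin_comb e J h" "L2_sq \<Omega> (\<lambda>x. g x - h x) < \<epsilon> / 4"
    using g(2) \<epsilon> unfolding approximable_def by meson
  have "L2_sq \<Omega> (\<lambda>x. (f x - g x) + (g x - h x)) < \<epsilon>"
    using L2_add(2)[OF L2_diff[OF f g(1)] L2_diff[OF g(1) lin_comb_L2[OF _ h(1)]]] g(3) h(2) by fastforce
  thus "\<exists>h. lin_comb e J h \<and> L2_sq \<Omega> (\<lambda>x. f x - h x) < \<epsilon>" using h(1) by auto
qed

lemma approx_sum:
  assumes "finite A" "\<And>i. i \<in> A \<Longrightarrow> f i \<in> L2_on \<Omega> \<and> approx (f i)"
  shows "(\<lambda>x. \<Sum>i\<in>A. f i x) \<in> L2_on \<Omega> \<and> approx (\<lambda>x. \<Sum>i\<in>A. f i x)"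
  using assms
proof (induction rule: finite_induct)
  case (insert i A)
  thus ?case using L2_add(1)[of "f i" \<Omega> "\<lambda>x. \<Sum>i\<in>A. f i x"] approx_add[of "f i" "\<lambda>x. \<Sum>i\<in>A. f i x"] by simp
qed (simp add: L2_zero approx_zero)

lemma approx_cong: "(\<And>x. x \<in> \<Omega> \<Longrightarrow> f x = g x) \<Longrightarrow> approx f \<Longrightarrow> approx g"
proof -
  assume eq: "\<And>x. x \<in> \<Omega> \<Longrightarrow> f x = g x" and "approx f"
  moreover have "L2_sq \<Omega> (\<lambda>x. f x - h x) = L2_sq \<Omega> (\<lambda>x. g x - h x)" for h
    by (rule L2_sq_cong) (simp add: eq)
  ultimately show ?thesis unfolding approximable_def by simp
qed

lemma approx_indicators_imp_approx:
  assumes ind: "\<And>E. E \<in> sets lebesgue \<Longrightarrow> E \<subseteq> \<Omega> \<Longrightarrow> approx (indicator E)"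
    and f: "f \<in> L2_on \<Omega>"
  shows "approx f"
proof -
  have Om': "\<Omega> \<in> sets lebesgue" using Om by (rule fmeasurableD)
  have fm[measurable]: "f \<in> borel_measurable (lebesgue_on \<Omega>)"
    and fint: "integrable (lebesgue_on \<Omega>) (\<lambda>x. (norm (f x))\<^sup>2)" using f unfolding L2_on_def by auto
  from borel_measurable_implies_sequence_metric[OF fm, of 0] obtain F where
    F0: "\<forall>i. simple_function (lebesgue_on \<Omega>) (F i)"
      "\<forall>x\<in>space (lebesgue_on \<Omega>). (\<lambda>i. F i x) \<longlonglongrightarrow> f x"
      "\<forall>i. \<forall>x\<in>space (lebesgue_on \<Omega>). dist (F i x) 0 \<le> 2 * dist (f x) 0"
    by blast
  have F: "simple_function (lebesgue_on \<Omega>) (F i)"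
      "x \<in> \<Omega> \<Longrightarrow> (\<lambda>i. F i x) \<longlonglongrightarrow> f x" "x \<in> \<Omega> \<Longrightarrow> dist (F i x) 0 \<le> 2 * dist (f x) 0" for i x
    using F0 by (simp_all add: space_restrict_space)
  have Fm[measurable]: "F i \<in> borel_measurable (lebesgue_on \<Omega>)" for i
    using F(1) by (rule borel_measurable_simple_function)
  have Fapp: "F i \<in> L2_on \<Omega> \<and> approx (F i)" for i
  proof -
    define V where "V = F i ` \<Omega>"
    have finV: "finite V" unfolding V_def using simple_functionD(1)[OF F(1)[of i]] by (simp add: space_restrict_space)
    define E where "E y = F i -` {y} \<inter> \<Omega>" for y
    have Es: "E y \<in> sets lebesgue" for y
      using simple_functionD(2)[OF F(1)[of i], of "{y}"] sets_restrict_space_subset[OF Om']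
      unfolding E_def by (auto simp: space_restrict_space)
    have eq: "(\<Sum>y\<in>V. y * indicator (E y) x) = F i x" if x: "x \<in> \<Omega>" for x
    proof -
      have "(\<Sum>y\<in>V. y * indicator (E y) x) = (\<Sum>y\<in>V. if y = F i x then y else 0)"
        using x by (intro sum.cong) (auto simp: E_def indicator_def)
      thus ?thesis using finV x unfolding V_def by simp
    qed
    have "(\<lambda>x. y * indicator (E y) x) \<in> L2_on \<Omega> \<and> approx (\<lambda>x. y * indicator (E y) x)" for y
    proof -
      have m: "(indicator (E y) :: real \<Rightarrow> complex) \<in> borel_measurable (lebesgue_on \<Omega>)"
        using Es by (intro borel_measurable_indicator) (auto simp: sets_restrict_space E_def)
      have L2: "indicator (E y) \<in> L2_on \<Omega>"
        by (rule L2_bounded[OF Om m, of 1]) (auto simp: indicator_def)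
      have app: "approx (indicator (E y))" by (rule ind[OF Es]) (auto simp: E_def)
      show ?thesis using approx_scale[OF L2 app, of y] L2_scale(1)[OF L2, of y] by simp
    qed
    from approx_sum[OF finV this] have *: "(\<lambda>x. \<Sum>y\<in>V. y * indicator (E y) x) \<in> L2_on \<Omega>"
      "approx (\<lambda>x. \<Sum>y\<in>V. y * indicator (E y) x)" by auto
    show ?thesis using approx_cong[OF eq *(2)] L2_on_cong[OF eq, THEN iffD1, OF _ *(1)] by simp
  qed
  have "(\<lambda>i. \<integral>x. (norm (f x - F i x))\<^sup>2 \<partial>lebesgue_on \<Omega>) \<longlonglongrightarrow> (\<integral>x. 0 \<partial>lebesgue_on \<Omega>)"
  proof (rule integral_dominated_convergence)
    show "integrable (lebesgue_on \<Omega>) (\<lambda>x. 9 * (norm (f x))\<^sup>2)" using fint by simp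
    show "AE x in lebesgue_on \<Omega>. (\<lambda>i. (norm (f x - F i x))\<^sup>2) \<longlonglongrightarrow> 0"
    proof (rule AE_I2)
      fix x assume "x \<in> space (lebesgue_on \<Omega>)"
      hence "x \<in> \<Omega>" by (simp add: space_restrict_space)
      from tendsto_diff[OF tendsto_const F(2)[OF this]]
      have "(\<lambda>i. f x - F i x) \<longlonglongrightarrow> f x - f x" .
      hence "(\<lambda>i. (norm (f x - F i x))\<^sup>2) \<longlonglongrightarrow> (norm (f x - f x))\<^sup>2"
        by (intro tendsto_power tendsto_norm)
      thus "(\<lambda>i. (norm (f x - F i x))\<^sup>2) \<longlonglongrightarrow> 0" by simp
    qed
    show "AE x in lebesgue_on \<Omega>. norm ((norm (f x - F i x))\<^sup>2) \<le> 9 * (norm (f x))\<^sup>2" for i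
    proof (rule AE_I2)
      fix x assume "x \<in> space (lebesgue_on \<Omega>)"
      hence "norm (F i x) \<le> 2 * norm (f x)" using F(3)[of x i] by (simp add: space_restrict_space)
      hence "norm (f x - F i x) \<le> 3 * norm (f x)" using norm_triangle_ineq4[of "f x" "F i x"] by simp
      hence "(norm (f x - F i x))\<^sup>2 \<le> (3 * norm (f x))\<^sup>2" by (rule power_mono) simp
      thus "norm ((norm (f x - F i x))\<^sup>2) \<le> 9 * (norm (f x))\<^sup>2" by (simp add: power_mult_distrib)
    qed
  qed auto
  hence lim: "(\<lambda>i. L2_sq \<Omega> (\<lambda>x. f x - F i x)) \<longlonglongrightarrow> 0" unfolding L2_sq_def by simp
  show ?thesis
  proof (rule approx_limit[OF f])
    fix \<epsilon> :: real assume "\<epsilon> > 0"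
    hence "\<forall>\<^sub>F i in sequentially. L2_sq \<Omega> (\<lambda>x. f x - F i x) < \<epsilon>"
      using order_tendstoD(2)[OF lim] by blast
    then obtain i where "L2_sq \<Omega> (\<lambda>x. f x - F i x) < \<epsilon>" by (auto simp: eventually_sequentially)
    thus "\<exists>g\<in>L2_on \<Omega>. approx g \<and> L2_sq \<Omega> (\<lambda>x. f x - g x) < \<epsilon>" using Fapp by blast
  qed
qed

text \<open>By regularity of Lebesgue measure, a measurable set lies between a closed and an open set of nearly
the same measure, and Urysohn's lemma provides a continuous function between the two indicator
functions.\<close>
lemma approx_continuous_imp_approx:
  assumes U: "open U" "U \<subseteq> \<Omega>" "\<Omega> - U \<in> null_sets lebesgue"
    and cont: "\<And>h :: real \<Rightarrow> real. continuous_on UNIV h \<Longrightarrow> (\<And>x. x \<notin> U \<Longrightarrow> h x = 0) \<Longrightarrow>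
      (\<And>x. 0 \<le> h x \<and> h x \<le> 1) \<Longrightarrow> approx (\<lambda>x. of_real (h x))"
    and f: "f \<in> L2_on \<Omega>"
  shows "approx f"
proof (rule approx_indicators_imp_approx[OF _ f])
  fix E assume E: "E \<in> sets lebesgue" "E \<subseteq> \<Omega>"
  have Om': "\<Omega> \<in> sets lebesgue" using Om by (rule fmeasurableD)
  have mE: "(indicator E :: real \<Rightarrow> complex) \<in> borel_measurable (lebesgue_on \<Omega>)"
    using E by (intro borel_measurable_indicator) (auto simp: sets_restrict_space)
  have EL2: "indicator E \<in> L2_on \<Omega>"
    by (rule L2_bounded[OF Om mE, of 1]) (auto simp: indicator_def)
  show "approx (indicator E)"
  proof (rule approx_limit[OF EL2])
    fix \<epsilon> :: real assume "\<epsilon> > 0"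
    hence \<epsilon>: "\<epsilon> / 2 > 0" by simp
    have EU: "E \<inter> U \<in> sets lebesgue" using E(1) U(1) by (intro sets.Int) (auto intro: sets_completionI_sets)
    obtain K where K: "closed K" "K \<subseteq> E \<inter> U" "E \<inter> U - K \<in> lmeasurable" "emeasure lebesgue (E \<inter> U - K) < ennreal (\<epsilon> / 2)"
      using sets_lebesgue_inner_closed[OF EU \<epsilon>] by blast
    obtain V where V: "open V" "E \<inter> U \<subseteq> V" "V - E \<inter> U \<in> lmeasurable" "emeasure lebesgue (V - E \<inter> U) < ennreal (\<epsilon> / 2)"
      using sets_lebesgue_outer_open[OF EU \<epsilon>] by blast
    have "closedin (top_of_set UNIV) K" "closedin (top_of_set UNIV) (- (V \<inter> U))" "K \<inter> - (V \<inter> U) = {}"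
      using K V U(1) by (auto simp: closed_closedin[symmetric])
    from Urysohn_local[OF this, of "1 :: real" "0 :: real"]
    obtain h :: "real \<Rightarrow> real" where h: "continuous_on UNIV h" "\<And>x. h x \<in> closed_segment 1 0"
      "\<And>x. x \<in> K \<Longrightarrow> h x = 1" "\<And>x. x \<in> - (V \<inter> U) \<Longrightarrow> h x = 0" by auto
    have h01: "0 \<le> h x \<and> h x \<le> 1" for x using h(2)[of x] by (auto simp: closed_segment_eq_real_ivl)
    have app: "approx (\<lambda>x. of_real (h x))"
      by (rule cont[OF h(1) _ h01]) (use h(4) in auto)
    have "h \<in> borel_measurable borel" using h(1) by (rule borel_measurable_continuous_onI)
    hence "(\<lambda>x. complex_of_real (h x)) \<in> borel_measurable borel" by simp
    hence "(\<lambda>x. complex_of_real (h x)) \<in> borel_measurable lebesgue"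
      by (simp add: measurable_completion)
    hence mh: "(\<lambda>x. complex_of_real (h x)) \<in> borel_measurable (lebesgue_on \<Omega>)"
      by (rule measurable_restrict_space1)
    have hL2: "(\<lambda>x. complex_of_real (h x)) \<in> L2_on \<Omega>"
      by (rule L2_bounded[OF Om mh, of 1]) (use h01 in auto)
    define D where "D = (E \<inter> U - K) \<union> (V - E \<inter> U) \<union> (\<Omega> - U)"
    have nullm: "\<Omega> - U \<in> lmeasurable" using U(3) by (rule fmeasurableI_null_sets)
    have D: "D \<in> lmeasurable" unfolding D_def using K(3) V(3) nullm by (intro fmeasurable.Un)
    have "L2_sq \<Omega> (\<lambda>x. indicator E x - of_real (h x)) \<le> (\<integral>x. indicator D x \<partial>lebesgue_on \<Omega>)"
      unfolding L2_sq_def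
    proof (rule integral_mono)
      show "integrable (lebesgue_on \<Omega>) (\<lambda>x. (norm (indicator E x - complex_of_real (h x)))\<^sup>2)"
        using L2_diff[OF EL2 hL2] unfolding L2_on_def by simp
      interpret finite_measure "lebesgue_on \<Omega>" by (rule finite_measure_lebesgue_on[OF Om])
      have "(indicator D :: real \<Rightarrow> real) \<in> borel_measurable lebesgue"
        using D by (intro borel_measurable_indicator) (auto dest: fmeasurableD)
      hence "(indicator D :: real \<Rightarrow> real) \<in> borel_measurable (lebesgue_on \<Omega>)" by (rule measurable_restrict_space1)
      thus "integrable (lebesgue_on \<Omega>) (indicator D :: real \<Rightarrow> real)"
        by (intro integrable_const_bound[of _ 1]) (auto simp: indicator_def)
      fix x assume "x \<in> space (lebesgue_on \<Omega>)"
      hence x: "x \<in> \<Omega>" by (simp add: space_restrict_space)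
      show "(norm (indicator E x - complex_of_real (h x)))\<^sup>2 \<le> indicator D x"
      proof (cases "x \<in> D")
        case True
        have ind: "(indicator E x :: complex) = complex_of_real (indicator E x)"
          by (simp add: indicator_def)
        have "norm (indicator E x - complex_of_real (h x)) = \<bar>indicator E x - h x\<bar>"
          unfolding ind of_real_diff[symmetric] by (rule norm_of_real)
        also have "\<dots> \<le> 1" using h01[of x] by (auto simp: indicator_def)
        finally show ?thesis using True by (simp add: power_le_one)
      next
        case False
        hence "x \<in> E \<inter> U \<longleftrightarrow> x \<in> K" "x \<notin> E \<inter> U \<longrightarrow> x \<notin> V" "x \<in> U"
          using x K(2) unfolding D_def by auto
        hence "indicator E x = complex_of_real (h x)"
          using h(3,4)[of x] K(2) by (cases "x \<in> K") (auto simp: indicator_def)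
        thus ?thesis by simp
      qed
    qed
    also have "\<dots> \<le> measure lebesgue D"
    proof -
      have "(\<integral>x. indicator D x \<partial>lebesgue_on \<Omega>) = measure (lebesgue_on \<Omega>) (D \<inter> \<Omega>)"
        by (simp add: space_restrict_space)
      also have "\<dots> = measure lebesgue (D \<inter> \<Omega>)"
        using Om' by (intro measure_restrict_space) auto
      also have "\<dots> \<le> measure lebesgue D"
        using D Om' by (intro measure_mono_fmeasurable) (auto dest: fmeasurableD)
      finally show ?thesis .
    qed
    also have "\<dots> \<le> measure lebesgue (E \<inter> U - K) + measure lebesgue (V - E \<inter> U) + measure lebesgue (\<Omega> - U)"
      unfolding D_def using K(3) V(3) nullm
      by (intro order_trans[OF measure_Un_le] add_mono measure_Un_le) (auto dest: fmeasurableD)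
    also have "\<dots> < \<epsilon>"
    proof -
      have "measure lebesgue (E \<inter> U - K) < \<epsilon> / 2"
        using K(4) emeasure_eq_measure2[OF K(3)] \<epsilon> by (simp add: ennreal_less_iff)
      moreover have "measure lebesgue (V - E \<inter> U) < \<epsilon> / 2"
        using V(4) emeasure_eq_measure2[OF V(3)] \<epsilon> by (simp add: ennreal_less_iff)
      moreover have "measure lebesgue (\<Omega> - U) = 0" using U(3) by (simp add: measure_eq_0_null_sets)
      ultimately show ?thesis by simp
    qed
    finally show "\<exists>g\<in>L2_on \<Omega>. approx g \<and> L2_sq \<Omega> (\<lambda>x. indicator E x - g x) < \<epsilon>"
      using app hL2 by blast
  qed
qed

end

section \<open>A criterion for spectral sets\<close>

text \<open>The translates of \<open>[0, 1 / N)\<close> by multiples of \<open>1 / N\<close> partition the line, and moving each of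
them back to \<open>[0, 1 / N)\<close> preserves its share of the integral.\<close>
lemma fold_integral:
  fixes Q :: "real \<Rightarrow> 'b::{banach, second_countable_topology}" and M :: int
  assumes int: "integrable lborel Q" and N: "0 < N"
    and supp: "\<And>x. x \<notin> {- of_int M / real N..<of_int M / real N} \<Longrightarrow> Q x = 0"
  shows "(\<integral>x. Q x \<partial>lborel) = (\<integral>x. indicator {0..<1 / real N} x *\<^sub>R (\<Sum>m\<in>{- M..<M}. Q (x + of_int m / real N)) \<partial>lborel)"
    and "integrable lborel (\<lambda>x. indicator {0..<1 / real N} x *\<^sub>R (\<Sum>m\<in>{- M..<M}. Q (x + of_int m / real N)))"
proof -
  define I where "I m = {of_int m / real N..<(of_int m + 1) / real N}" for m :: int
  have split: "Q x = (\<Sum>m\<in>{- M..<M}. indicator (I m) x *\<^sub>R Q x)" for x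
  proof (cases "x \<in> {- of_int M / real N..<of_int M / real N}")
    case True
    define k where "k = \<lfloor>real N * x\<rfloor>"
    have mem: "x \<in> I m \<longleftrightarrow> m = k" for m
    proof -
      have "\<lfloor>real N * x\<rfloor> = m \<longleftrightarrow> x \<in> I m"
        unfolding I_def floor_eq_iff using N by (auto simp: field_simps)
      thus ?thesis unfolding k_def by auto
    qed
    have "- of_int M \<le> real N * x" "real N * x < of_int M" using True N by (auto simp: field_simps)
    hence k: "k \<in> {- M..<M}" unfolding k_def by (auto simp: le_floor_iff floor_less_iff)
    have "(\<Sum>m\<in>{- M..<M}. indicator (I m) x *\<^sub>R Q x) = (\<Sum>m\<in>{- M..<M}. if m = k then Q x else 0)"
      by (intro sum.cong) (auto simp: indicator_def mem)
    thus ?thesis using k by simp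
  qed (simp add: supp)
  have piece_int: "integrable lborel (\<lambda>x. indicator (I m) x *\<^sub>R Q x)" for m
    using int by (intro integrable_mult_indicator) (auto simp: I_def)
  have ind: "indicator (I m) (of_int m / real N + 1 * x) = (indicator {0..<1 / real N} x :: real)" for m x
    unfolding I_def by (auto simp: indicator_def add_divide_distrib)
  have shift_int: "integrable lborel (\<lambda>x. indicator {0..<1 / real N} x *\<^sub>R Q (x + of_int m / real N))" for m
    using lborel_integrable_real_affine[OF piece_int[of m], of 1 "of_int m / real N"]
    unfolding ind by (simp add: add.commute)
  have piece: "(\<integral>x. indicator (I m) x *\<^sub>R Q x \<partial>lborel) = (\<integral>x. indicator {0..<1 / real N} x *\<^sub>R Q (x + of_int m / real N) \<partial>lborel)" for m
    using lborel_integral_real_affine[of 1 "\<lambda>x. indicator (I m) x *\<^sub>R Q x" "of_int m / real N"]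
    unfolding ind by (simp add: add.commute)
  have "(\<integral>x. Q x \<partial>lborel) = (\<integral>x. (\<Sum>m\<in>{- M..<M}. indicator (I m) x *\<^sub>R Q x) \<partial>lborel)"
    by (rule Bochner_Integration.integral_cong[OF refl]) (rule split)
  also have "\<dots> = (\<Sum>m\<in>{- M..<M}. \<integral>x. indicator (I m) x *\<^sub>R Q x \<partial>lborel)"
    by (rule Bochner_Integration.integral_sum) (rule piece_int)
  also have "\<dots> = (\<Sum>m\<in>{- M..<M}. \<integral>x. indicator {0..<1 / real N} x *\<^sub>R Q (x + of_int m / real N) \<partial>lborel)"
    by (simp add: piece)
  also have "\<dots> = (\<integral>x. (\<Sum>m\<in>{- M..<M}. indicator {0..<1 / real N} x *\<^sub>R Q (x + of_int m / real N)) \<partial>lborel)"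
    by (rule Bochner_Integration.integral_sum[symmetric]) (rule shift_int)
  finally show "(\<integral>x. Q x \<partial>lborel) = (\<integral>x. indicator {0..<1 / real N} x *\<^sub>R (\<Sum>m\<in>{- M..<M}. Q (x + of_int m / real N)) \<partial>lborel)"
    by (simp add: scaleR_sum_right)
  show "integrable lborel (\<lambda>x. indicator {0..<1 / real N} x *\<^sub>R (\<Sum>m\<in>{- M..<M}. Q (x + of_int m / real N)))"
    unfolding scaleR_sum_right by (rule Bochner_Integration.integrable_sum) (rule shift_int)
qed

lemma integral_cis_period:
  assumes N: "0 < N" and k: "k \<noteq> (0::int)"
  shows "(\<integral>x. indicator {0..<1 / real N} x *\<^sub>R cis (2 * pi * real N * of_int k * x) \<partial>lborel) = 0"
proof -
  define a where "a = 2 * pi * real N * of_int k"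
  have a: "a \<noteq> 0" unfolding a_def using N k by simp
  define G where "G x = cis (a * x) / (\<i> * of_real a)" for x
  have G: "(G has_vector_derivative cis (a * x)) (at x within S)" for x S
  proof -
    have "((\<lambda>z. exp (\<i> * of_real a * z)) has_field_derivative (\<i> * of_real a * exp (\<i> * of_real a * of_real x))) (at (of_real x))"
      by (auto intro!: derivative_eq_intros)
    from has_vector_derivative_real_field[OF this, of S]
    have "((\<lambda>x. cis (a * x)) has_vector_derivative (\<i> * of_real a * cis (a * x))) (at x within S)"
      by (simp add: cis_conv_exp mult.assoc)
    from has_vector_derivative_divide[OF this, of "\<i> * of_real a"]
    show ?thesis unfolding G_def using a by simp
  qed
  have meas: "(\<lambda>x. cis (a * x)) \<in> borel_measurable borel"
    by (intro borel_measurable_continuous_onI continuous_intros)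
  have "(\<integral>x. indicator {0..1 / real N} x *\<^sub>R cis (a * x) \<partial>lborel) = G (1 / real N) - G 0"
    by (rule integral_FTC_Icc) (use G in \<open>auto intro!: continuous_intros\<close>)
  also have "\<dots> = 0"
  proof -
    have "a * (1 / real N) = 2 * pi * of_int k" unfolding a_def using N by simp
    hence "cis (a * (1 / real N)) = cis (2 * pi * of_int k)" by (rule arg_cong)
    also have "\<dots> = 1" by (rule cis_multiple_2pi) simp
    finally show ?thesis unfolding G_def by simp
  qed
  also have "(\<integral>x. indicator {0..1 / real N} x *\<^sub>R cis (a * x) \<partial>lborel) = (\<integral>x. indicator {0..<1 / real N} x *\<^sub>R cis (a * x) \<partial>lborel)"
  proof (rule integral_cong_AE)
    have "AE x in lborel. x \<noteq> 1 / real N" by (rule AE_lborel_singleton)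
    thus "AE x in lborel. indicator {0..1 / real N} x *\<^sub>R cis (a * x) = indicator {0..<1 / real N} x *\<^sub>R cis (a * x)"
      by eventually_elim (auto simp: indicator_def)
  qed (intro borel_measurable_scaleR borel_measurable_indicator; simp add: meas)+
  finally show ?thesis unfolding a_def .
qed

text \<open>The sum of \<open>h\<close> over the fibre of \<open>x\<close> modulo \<open>1 / N\<close>, for \<open>h\<close> that vanishes outside \<open>[- R, R]\<close>.
Restricting the sum to this window makes it finite.\<close>
definition periodize :: "nat \<Rightarrow> real \<Rightarrow> (real \<Rightarrow> complex) \<Rightarrow> real \<Rightarrow> complex" where
  "periodize N R h x = (\<Sum>m\<in>{m::int. \<bar>x + of_int m / real N\<bar> \<le> R}. h (x + of_int m / real N))"

lemma finite_window:
  assumes "0 < N"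
  shows "finite {m::int. \<bar>x + of_int m / real N\<bar> \<le> R}"
proof (rule finite_subset)
  show "{m::int. \<bar>x + of_int m / real N\<bar> \<le> R} \<subseteq> {\<lfloor>(- R - x) * real N\<rfloor>..\<lceil>(R - x) * real N\<rceil>}"
  proof
    fix m :: int assume "m \<in> {m. \<bar>x + of_int m / real N\<bar> \<le> R}"
    hence "- R - x \<le> of_int m / real N" "of_int m / real N \<le> R - x" by auto
    hence "(- R - x) * real N \<le> of_int m" "of_int m \<le> (R - x) * real N" using assms by (auto simp: field_simps)
    thus "m \<in> {\<lfloor>(- R - x) * real N\<rfloor>..\<lceil>(R - x) * real N\<rceil>}" by (auto simp: floor_le_iff le_ceiling_iff)
  qed
qed auto

lemma periodize_periodic:
  assumes N: "0 < N"
  shows "periodize N R h (x + 1 / real N) = periodize N R h x"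
  unfolding periodize_def
  by (rule sum.reindex_bij_witness[of _ "\<lambda>m. m - 1" "\<lambda>m. m + 1"])
    (auto simp: add_divide_distrib diff_divide_distrib add_ac)

lemma periodize_continuous:
  assumes N: "0 < N" and h: "continuous_on UNIV h" and supp: "\<And>x. R < \<bar>x\<bar> \<Longrightarrow> h x = 0"
  shows "continuous_on UNIV (periodize N R h)"
  unfolding continuous_on_eq_continuous_at[OF open_UNIV]
proof
  fix x :: real
  define F where "F = {m::int. \<bar>x + of_int m / real N\<bar> \<le> R + 1}"
  have fin: "finite F" unfolding F_def by (rule finite_window[OF N])
  have eq: "periodize N R h y = (\<Sum>m\<in>F. h (y + of_int m / real N))" if "dist y x < 1" for y
    unfolding periodize_def
    by (rule sum.mono_neutral_left[OF fin]) (use that supp in \<open>auto simp: F_def dist_real_def\<close>)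
  have "continuous_on UNIV (\<lambda>y. \<Sum>m\<in>F. h (y + of_int m / real N))"
    by (intro continuous_on_sum continuous_on_compose2[OF h] continuous_intros) auto
  hence "isCont (\<lambda>y. \<Sum>m\<in>F. h (y + of_int m / real N)) x"
    by (simp add: continuous_on_eq_continuous_at)
  thus "isCont (periodize N R h) x"
    by (rule continuous_transform_within[OF _ zero_less_one]) (use eq in auto)
qed

text \<open>Two points of \<open>U\<close> in one fibre modulo \<open>1 / N\<close> differ by some \<open>m / N\<close>, and \<open>s * m\<close> modulo
\<open>N\<close> separates the points of the fibre.  So a fibre has at most \<open>N\<close> points, and
since \<open>\<Omega>\<close> has measure \<open>1\<close>, almost every fibre has exactly \<open>N\<close>.\<close>
locale packed_set =
  fixes \<Omega> U :: "real set" and N :: nat and s :: real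
  assumes fin_meas: "\<Omega> \<in> lmeasurable" and unit_meas: "measure lebesgue \<Omega> = 1"
    and U: "open U" "bounded U" "U \<subseteq> \<Omega>" "\<Omega> - U \<in> null_sets lebesgue"
    and N: "0 < N"
    and packed: "\<And>x m::int. x \<in> U \<Longrightarrow> x + of_int m / real N \<in> U \<Longrightarrow> m \<noteq> 0 \<Longrightarrow>
      \<exists>k::int. s * of_int m = of_int k \<and> \<not> int N dvd k"
begin

definition spectrum :: "real set" where
  "spectrum = {s * real j + real N * of_int k |j (k::int). j < N}"

lemma spectral_exp_eq: "spectral_exp \<Omega> l x = indicator \<Omega> x * cis (2 * pi * l * x)"
  unfolding spectral_exp_def unit_meas cis_conv_exp by (simp add: mult_ac)

lemma cis_measurable: "(\<lambda>x. cis (a * x)) \<in> borel_measurable lebesgue"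
proof -
  have "(\<lambda>x. cis (a * x)) \<in> borel_measurable borel"
    by (intro borel_measurable_continuous_onI continuous_intros)
  thus ?thesis by (simp add: measurable_completion)
qed

lemma spectral_exp_L2: "spectral_exp \<Omega> l \<in> L2_on \<Omega>"
proof (rule L2_bounded[OF fin_meas, of _ 1])
  have "(indicator \<Omega> :: real \<Rightarrow> complex) \<in> borel_measurable lebesgue"
    using fin_meas by (intro borel_measurable_indicator) (rule fmeasurableD)
  hence "(\<lambda>x. indicator \<Omega> x * cis (2 * pi * l * x)) \<in> borel_measurable lebesgue"
    by (intro borel_measurable_times cis_measurable)
  thus "spectral_exp \<Omega> l \<in> borel_measurable (lebesgue_on \<Omega>)"
    unfolding spectral_exp_eq[abs_def] by (rule measurable_restrict_space1)
  show "norm (spectral_exp \<Omega> l x) \<le> 1" for x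
    unfolding spectral_exp_eq by (simp add: indicator_def norm_mult)
qed

sublocale L2_family \<Omega> "spectral_exp \<Omega>" spectrum
  by unfold_locales (use fin_meas spectral_exp_L2 in auto)

lemma U_radius: obtains R where "0 < R" "\<And>x. x \<in> U \<Longrightarrow> \<bar>x\<bar> < R"
proof -
  obtain R where "0 < R" "\<forall>x\<in>U. norm x < R" using U(2) bounded_pos_less by metis
  thus ?thesis using that by auto
qed

text \<open>A frequency \<open>s * j\<close> times a trigonometric polynomial of period \<open>1 / N\<close> only involves
frequencies from the spectrum.\<close>
lemma lin_comb_trig_poly:
  assumes j: "j < N" and P: "trig_poly P"
  shows "lin_comb (spectral_exp \<Omega>) spectrum (\<lambda>x. indicator \<Omega> x * (cis (2 * pi * s * real j * x) * P (real N * x)))"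
  using P
proof (induction rule: lin_comb.induct)
  case zero show ?case by (simp add: lin_comb.zero)
next
  case (add_term k P c)
  define l where "l = s * real j + real N * of_int k"
  have l: "l \<in> spectrum" unfolding l_def spectrum_def using j by blast
  have "indicator \<Omega> x * (cis (2 * pi * s * real j * x) * (P (real N * x) + c * cis (2 * pi * of_int k * (real N * x)))) =
    indicator \<Omega> x * (cis (2 * pi * s * real j * x) * P (real N * x)) + c * spectral_exp \<Omega> l x" for x
  proof -
    have "cis (2 * pi * l * x) = cis (2 * pi * s * real j * x) * cis (2 * pi * of_int k * (real N * x))"
      unfolding l_def by (simp add: cis_mult algebra_simps)
    thus ?thesis unfolding spectral_exp_eq by (simp add: algebra_simps)
  qed
  thus ?case using lin_comb.add_term[OF l add_term.IH, of c] by simp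
qed

text \<open>Fourier inversion on the fibre through \<open>y\<close>: the sum over \<open>j\<close> cancels all other points of the
fibre, because \<open>s * m\<close> is never divisible by \<open>N\<close> there.\<close>
lemma fibre_decomposition:
  assumes supp: "\<And>x. x \<notin> U \<Longrightarrow> g x = 0" and R: "\<And>x. x \<in> U \<Longrightarrow> \<bar>x\<bar> \<le> R" and y: "y \<in> U"
  shows "(\<Sum>j<N. cis (2 * pi * s * real j * y) * periodize N R (\<lambda>x. g x * cis (- (2 * pi * s * real j * x))) y) = of_nat N * g y"
proof -
  define W where "W = {m::int. \<bar>y + of_int m / real N\<bar> \<le> R}"
  have W: "finite W" "0 \<in> W" unfolding W_def using finite_window[OF N] R[OF y] by auto
  define z where "z m = y + of_int m / real N" for m :: int
  have summand: "cis (2 * pi * s * real j * y) * (g (z m) * cis (- (2 * pi * s * real j * z m))) =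
      g (z m) * cis (- (2 * pi * real j * (s * of_int m / real N)))" for j m
  proof -
    have "cis (2 * pi * s * real j * y) * cis (- (2 * pi * s * real j * z m)) =
        cis (- (2 * pi * real j * (s * of_int m / real N)))"
      unfolding cis_mult z_def by (rule arg_cong[of _ _ cis]) (simp add: algebra_simps)
    thus ?thesis by (simp add: algebra_simps)
  qed
  have per: "periodize N R h y = (\<Sum>m\<in>W. h (z m))" for h
    unfolding periodize_def W_def z_def ..
  have "(\<Sum>j<N. cis (2 * pi * s * real j * y) * periodize N R (\<lambda>x. g x * cis (- (2 * pi * s * real j * x))) y)
      = (\<Sum>j<N. \<Sum>m\<in>W. g (z m) * cis (- (2 * pi * real j * (s * of_int m / real N))))"
    unfolding per sum_distrib_left summand ..
  also have "\<dots> = (\<Sum>m\<in>W. g (z m) * (\<Sum>j<N. cis (- (2 * pi * real j * (s * of_int m / real N)))))"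
    by (subst sum.swap) (simp add: sum_distrib_left)
  also have "\<dots> = (\<Sum>m\<in>W. if m = 0 then of_nat N * g y else 0)"
  proof (rule sum.cong[OF refl])
    fix m assume "m \<in> W"
    show "g (z m) * (\<Sum>j<N. cis (- (2 * pi * real j * (s * of_int m / real N)))) = (if m = 0 then of_nat N * g y else 0)"
    proof (cases "m = 0 \<or> z m \<notin> U")
      case True thus ?thesis using supp by (auto simp: z_def)
    next
      case False
      then obtain k :: int where k: "s * of_int m = of_int k" "\<not> int N dvd k"
        using packed[OF y, of m] unfolding z_def by auto
      have "(\<Sum>j<N. cis (2 * pi * real j * (of_int (- k) / real N))) = 0"
        by (rule sum_roots_of_unity[OF N]) (use k in simp)
      moreover have "cis (2 * pi * real j * (of_int (- k) / real N)) = cis (- (2 * pi * real j * (s * of_int m / real N)))" for j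
        unfolding k(1) by simp
      ultimately show ?thesis using False by simp
    qed
  qed
  also have "\<dots> = of_nat N * g y" using W by simp
  finally show ?thesis .
qed

text \<open>The coefficients in \<open>fibre_decomposition\<close> are continuous functions of period \<open>1 / N\<close>, so they are
uniformly close to trigonometric polynomials.\<close>
lemma approx_continuous:
  assumes g: "continuous_on UNIV g" and supp: "\<And>x. x \<notin> U \<Longrightarrow> g x = 0"
  shows "approx g"
  unfolding approximable_def
proof (intro allI impI)
  fix \<epsilon> :: real assume \<epsilon>: "\<epsilon> > 0"
  define \<delta> where "\<delta> = sqrt \<epsilon> / 2"
  have \<delta>: "\<delta> > 0" "\<delta>\<^sup>2 < \<epsilon>" unfolding \<delta>_def using \<epsilon> by (auto simp: power_divide)
  obtain R where R: "0 < R" "\<And>x. x \<in> U \<Longrightarrow> \<bar>x\<bar> < R" using U_radius by blast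
  define F where "F j = periodize N R (\<lambda>x. g x * cis (- (2 * pi * s * real j * x)))" for j
  have "\<exists>P. trig_poly P \<and> (\<forall>x. norm (F j x - P (real N * x)) < \<delta>)" for j
  proof -
    have contF: "continuous_on UNIV (F j)" unfolding F_def
    proof (rule periodize_continuous[OF N])
      show "continuous_on UNIV (\<lambda>x. g x * cis (- (2 * pi * s * real j * x)))"
        by (intro continuous_intros g)
      show "g x * cis (- (2 * pi * s * real j * x)) = 0" if "R < \<bar>x\<bar>" for x
        using supp[of x] R(2)[of x] that by auto
    qed
    have "continuous_on UNIV (\<lambda>x. F j (x / real N))"
      by (rule continuous_on_compose2[OF contF]) (use N in \<open>auto intro!: continuous_intros\<close>)
    moreover have "F j ((x + 1) / real N) = F j (x / real N)" for x
      using periodize_periodic[OF N, of R _ "x / real N"] N unfolding F_def by (simp add: add_divide_distrib)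
    ultimately obtain P where P: "trig_poly P" "\<And>x. norm (F j (x / real N) - P x) < \<delta>"
      using periodic_trig_approximation[of "\<lambda>x. F j (x / real N)" \<delta>] \<delta>(1) by blast
    have "norm (F j x - P (real N * x)) < \<delta>" for x using P(2)[of "real N * x"] N by simp
    thus ?thesis using P(1) by blast
  qed
  then obtain P where P: "\<And>j. trig_poly (P j)" "\<And>j x. norm (F j x - P j (real N * x)) < \<delta>" by metis
  define p where "p x = (\<Sum>j<N. (1 / of_nat N) * (indicator \<Omega> x * (cis (2 * pi * s * real j * x) * P j (real N * x))))" for x
  have p: "lin_comb (spectral_exp \<Omega>) spectrum p"
    unfolding p_def by (intro lin_comb_sum lin_comb_scale lin_comb_trig_poly P) auto
  have near: "norm (g y - p y) \<le> \<delta>" if y: "y \<in> U" for y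
  proof -
    have y\<Omega>: "y \<in> \<Omega>" using y U by blast
    have "of_nat N * g y = (\<Sum>j<N. cis (2 * pi * s * real j * y) * F j y)"
      unfolding F_def by (rule fibre_decomposition[symmetric]) (use supp R(2) y in \<open>auto intro: less_imp_le\<close>)
    hence "of_nat N * (g y - p y) = (\<Sum>j<N. cis (2 * pi * s * real j * y) * (F j y - P j (real N * y)))"
      unfolding p_def using N y\<Omega>
      by (simp add: right_diff_distrib sum_subtractf sum_distrib_left)
    hence "real N * norm (g y - p y) = norm (\<Sum>j<N. cis (2 * pi * s * real j * y) * (F j y - P j (real N * y)))"
      by (metis norm_mult norm_of_nat)
    also have "\<dots> \<le> (\<Sum>j<N. \<delta>)"
      using P(2) by (intro sum_norm_le) (auto simp: norm_mult less_imp_le)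
    finally show ?thesis using N by simp
  qed
  have gL2: "g \<in> L2_on \<Omega>"
  proof -
    have "bounded (g ` cball 0 R)"
      by (intro compact_imp_bounded compact_continuous_image continuous_on_subset[OF g]) auto
    then obtain B where B: "\<And>x. x \<in> cball 0 R \<Longrightarrow> norm (g x) \<le> B" unfolding bounded_iff by blast
    have "norm (g x) \<le> max B 0" for x
      using B[of x] R(2)[of x] supp[of x] by (cases "x \<in> U") (auto intro: less_imp_le)
    moreover have "g \<in> borel_measurable borel" using g by (rule borel_measurable_continuous_onI)
    hence "g \<in> borel_measurable lebesgue" by (simp add: measurable_completion)
    hence "g \<in> borel_measurable (lebesgue_on \<Omega>)" by (rule measurable_restrict_space1)
    ultimately show ?thesis using L2_bounded[OF fin_meas] by blast
  qed
  interpret finite_measure "lebesgue_on \<Omega>" by (rule finite_measure_lebesgue_on[OF fin_meas])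
  have Om': "\<Omega> \<in> sets lebesgue" using fin_meas by (rule fmeasurableD)
  have "L2_sq \<Omega> (\<lambda>x. g x - p x) \<le> (\<integral>x. \<delta>\<^sup>2 \<partial>lebesgue_on \<Omega>)"
    unfolding L2_sq_def
  proof (rule integral_mono_AE)
    show "integrable (lebesgue_on \<Omega>) (\<lambda>x. (norm (g x - p x))\<^sup>2)"
      using L2_diff[OF gL2 lin_comb_L2[OF _ p]] unfolding L2_on_def by simp
    show "integrable (lebesgue_on \<Omega>) (\<lambda>x. \<delta>\<^sup>2)" by simp
    have "AE x in lebesgue. x \<notin> \<Omega> - U" using U(4) by (rule AE_not_in)
    hence "AE x in lebesgue. x \<in> \<Omega> \<longrightarrow> (norm (g x - p x))\<^sup>2 \<le> \<delta>\<^sup>2"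
      by eventually_elim (use near in \<open>auto intro!: power_mono\<close>)
    thus "AE x in lebesgue_on \<Omega>. (norm (g x - p x))\<^sup>2 \<le> \<delta>\<^sup>2"
      using Om' by (simp add: AE_restrict_space_iff)
  qed
  also have "\<dots> = \<delta>\<^sup>2" using unit_meas Om' by (simp add: measure_restrict_space)
  finally have "L2_sq \<Omega> (\<lambda>x. g x - p x) < \<epsilon>" using \<delta>(2) by simp
  thus "\<exists>h. lin_comb (spectral_exp \<Omega>) spectrum h \<and> L2_sq \<Omega> (\<lambda>x. g x - h x) < \<epsilon>" using p by blast
qed

lemma complete: "f \<in> L2_on \<Omega> \<Longrightarrow> approx f"
proof (rule approx_continuous_imp_approx[OF U(1,3,4)])
  fix h :: "real \<Rightarrow> real"
  assume "continuous_on UNIV h" "\<And>x. x \<notin> U \<Longrightarrow> h x = 0"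
  thus "approx (\<lambda>x. of_real (h x))" by (intro approx_continuous continuous_intros) auto
qed

lemma integral_over_U:
  fixes q :: "real \<Rightarrow> 'b::{banach, second_countable_topology}"
  assumes q: "continuous_on UNIV q"
  shows "(\<integral>x. q x \<partial>lebesgue_on \<Omega>) = (\<integral>x. indicator U x *\<^sub>R q x \<partial>lborel)"
proof -
  have Om': "\<Omega> \<in> sets lebesgue" using fin_meas by (rule fmeasurableD)
  have qm: "q \<in> borel_measurable borel" using q by (rule borel_measurable_continuous_onI)
  have Ub: "U \<in> sets borel" using U(1) by simp
  have b: "(\<lambda>x. indicator U x *\<^sub>R q x) \<in> borel_measurable borel"
    using qm Ub by simp
  have "(\<integral>x. q x \<partial>lebesgue_on \<Omega>) = (\<integral>x. indicator \<Omega> x *\<^sub>R q x \<partial>lebesgue)"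
    using Om' by (intro integral_restrict_space) simp
  also have "\<dots> = (\<integral>x. indicator U x *\<^sub>R q x \<partial>lebesgue)"
  proof (rule integral_cong_AE)
    have ql: "q \<in> borel_measurable lebesgue" using qm by (simp add: measurable_completion)
    thus "(\<lambda>x. indicator \<Omega> x *\<^sub>R q x) \<in> borel_measurable lebesgue"
      using Om' by (intro borel_measurable_scaleR borel_measurable_indicator)
    show "(\<lambda>x. indicator U x *\<^sub>R q x) \<in> borel_measurable lebesgue"
      using b by (simp add: measurable_completion)
    have "AE x in lebesgue. x \<notin> \<Omega> - U" using U(4) by (rule AE_not_in)
    thus "AE x in lebesgue. indicator \<Omega> x *\<^sub>R q x = indicator U x *\<^sub>R q x"
      by eventually_elim (use U(3) in \<open>auto simp: indicator_def\<close>)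
  qed
  also have "\<dots> = (\<integral>x. indicator U x *\<^sub>R q x \<partial>lborel)"
    using b by (intro integral_completion) simp
  finally show ?thesis .
qed

definition fibre :: "int \<Rightarrow> real \<Rightarrow> int set" where
  "fibre M x = {m \<in> {- M..<M}. x + of_int m / real N \<in> U}"

text \<open>The residues of \<open>s * m\<close> modulo \<open>N\<close>, taken relative to one point of the fibre, are distinct.  A
fibre with \<open>N\<close> points therefore realises every residue once, and the sum is one over all
\<open>N\<close>-th roots of unity.\<close>
lemma fibre_residues:
  assumes "card (fibre M x) \<noteq> 0"
  shows "card (fibre M x) \<le> N"
    and "card (fibre M x) = N \<Longrightarrow> \<not> int N dvd j \<Longrightarrow> (\<Sum>m\<in>fibre M x. cis (2 * pi * of_int j * (s * of_int m / real N))) = 0"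
proof -
  have fin: "finite (fibre M x)"
    by (rule finite_subset[of _ "{- M..<M}"]) (auto simp: fibre_def)
  obtain m0 where m0: "m0 \<in> fibre M x" using assms by fastforce
  have ex: "\<exists>k::int. s * of_int (m - m') = of_int k \<and> (m \<noteq> m' \<longrightarrow> \<not> int N dvd k)"
    if "m \<in> fibre M x" "m' \<in> fibre M x" for m m'
  proof (cases "m = m'")
    case False
    have e: "x + of_int m' / real N + of_int (m - m') / real N = x + of_int m / real N"
      by (simp add: diff_divide_distrib)
    have "x + of_int m' / real N \<in> U" "x + of_int m' / real N + of_int (m - m') / real N \<in> U"
      unfolding e using that unfolding fibre_def by simp_all
    from packed[OF this] False show ?thesis by auto
  qed simp
  hence "\<forall>m\<in>fibre M x. \<exists>k::int. s * of_int (m - m0) = of_int k" using m0 by blast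
  from bchoice[OF this] obtain k where k: "\<And>m. m \<in> fibre M x \<Longrightarrow> s * of_int (m - m0) = of_int (k m)"
    by blast
  define r where "r m = nat (k m mod int N)" for m
  have r: "r m < N" "int (r m) = k m mod int N" for m
    unfolding r_def using N by (auto simp: nat_less_iff)
  have inj: "inj_on r (fibre M x)"
  proof (rule inj_onI, rule ccontr)
    fix m m' assume m: "m \<in> fibre M x" "m' \<in> fibre M x" "r m = r m'" "m \<noteq> m'"
    have "int (r m) = int (r m')" using m(3) by simp
    hence "k m mod int N = k m' mod int N" unfolding r(2) .
    hence dvd: "int N dvd k m - k m'" by (simp add: mod_eq_dvd_iff)
    obtain n :: int where n: "s * of_int (m - m') = of_int n" "\<not> int N dvd n" using ex[OF m(1,2)] m(4) by blast
    have "of_int n = (of_int (k m - k m') :: real)"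
      using k[OF m(1)] k[OF m(2)] n(1) by (simp add: algebra_simps)
    hence "n = k m - k m'" by (simp only: of_int_eq_iff)
    thus False using n(2) dvd by simp
  qed
  have sub: "r ` fibre M x \<subseteq> {..<N}" using r by auto
  show "card (fibre M x) \<le> N" using card_inj_on_le[OF inj sub] by simp
  assume card: "card (fibre M x) = N" and j: "\<not> int N dvd j"
  have "r ` fibre M x = {..<N}"
    using card_subset_eq[OF _ sub] card_image[OF inj] card by simp
  hence bij: "bij_betw r (fibre M x) {..<N}" using inj unfolding bij_betw_def by simp
  define a where "a = cis (2 * pi * of_int j * (s * of_int m0 / real N))"
  have "cis (2 * pi * of_int j * (s * of_int m / real N)) = a * cis (2 * pi * real (r m) * (of_int j / real N))"
    if m: "m \<in> fibre M x" for m
  proof -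
    define d where "d = k m div int N"
    have km: "k m = int (r m) + int N * d" unfolding d_def r(2) by simp
    have "s * of_int m = s * of_int m0 + of_int (k m)" using k[OF m] by (simp add: algebra_simps)
    also have "\<dots> = s * of_int m0 + real (r m) + real N * of_int d" unfolding km by simp
    finally have sm: "s * of_int m = s * of_int m0 + real (r m) + real N * of_int d" .
    have "2 * pi * of_int j * (s * of_int m / real N) =
      2 * pi * of_int j * (s * of_int m0 / real N) + 2 * pi * real (r m) * (of_int j / real N) + 2 * pi * of_int (j * d)"
      unfolding sm using N by (simp add: field_simps)
    hence "cis (2 * pi * of_int j * (s * of_int m / real N)) = a * cis (2 * pi * real (r m) * (of_int j / real N)) * cis (2 * pi * of_int (j * d))"
      unfolding a_def cis_mult by simp
    also have "cis (2 * pi * of_int (j * d)) = 1" by (rule cis_multiple_2pi) simp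
    finally show ?thesis by simp
  qed
  hence "(\<Sum>m\<in>fibre M x. cis (2 * pi * of_int j * (s * of_int m / real N))) =
    a * (\<Sum>m\<in>fibre M x. cis (2 * pi * real (r m) * (of_int j / real N)))"
    by (simp add: sum_distrib_left)
  also have "(\<Sum>m\<in>fibre M x. cis (2 * pi * real (r m) * (of_int j / real N))) = (\<Sum>i<N. cis (2 * pi * real i * (of_int j / real N)))"
    by (rule sum.reindex_bij_betw[OF bij])
  also have "\<dots> = 0" by (rule sum_roots_of_unity[OF N j])
  finally show "(\<Sum>m\<in>fibre M x. cis (2 * pi * of_int j * (s * of_int m / real N))) = 0" by simp
qed

lemma U_window: obtains M :: int where "\<And>x. x \<in> U \<Longrightarrow> x \<in> {- of_int M / real N..<of_int M / real N}"
proof -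
  obtain R where R: "0 < R" "\<And>x. x \<in> U \<Longrightarrow> \<bar>x\<bar> < R" using U_radius by blast
  define M where "M = \<lceil>R * real N\<rceil>"
  have "R * real N \<le> of_int M" unfolding M_def by (rule le_of_int_ceiling)
  hence "R \<le> of_int M / real N" using N by (simp add: field_simps)
  hence "x \<in> {- of_int M / real N..<of_int M / real N}" if "x \<in> U" for x using R(2)[OF that] by auto
  thus ?thesis using that by blast
qed

lemma fold_continuous:
  fixes q :: "real \<Rightarrow> 'b::{banach, second_countable_topology}"
  assumes q: "continuous_on UNIV q" and B: "\<And>x. norm (q x) \<le> B"
    and M: "\<And>x. x \<in> U \<Longrightarrow> x \<in> {- of_int M / real N..<of_int M / real N}"
  shows "(\<integral>x. q x \<partial>lebesgue_on \<Omega>) =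
      (\<integral>x. indicator {0..<1 / real N} x *\<^sub>R (\<Sum>m\<in>fibre M x. q (x + of_int m / real N)) \<partial>lborel)"
    and "integrable lborel (\<lambda>x. indicator {0..<1 / real N} x *\<^sub>R (\<Sum>m\<in>fibre M x. q (x + of_int m / real N)))"
proof -
  define Q where "Q x = indicator U x *\<^sub>R q x" for x
  have "integrable lborel Q"
  proof -
    have fin: "emeasure lborel U < \<infinity>" using emeasure_bounded_finite[OF U(2)] .
    have "integrable lborel (\<lambda>x. indicator U x * B)"
      using U(1) fin by (intro integrable_mult_left) (simp add: integrable_indicator_iff)
    thus ?thesis
    proof (rule Bochner_Integration.integrable_bound)
      have "q \<in> borel_measurable borel" using q by (rule borel_measurable_continuous_onI)
      thus "Q \<in> borel_measurable lborel" unfolding Q_def[abs_def] using U(1) by simp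
      have "norm (Q x) \<le> norm (indicator U x * B)" for x
        using order_trans[OF B[of x] abs_ge_self] unfolding Q_def by (simp add: indicator_def)
      thus "AE x in lborel. norm (Q x) \<le> norm (indicator U x * B)" by simp
    qed
  qed
  moreover have "Q x = 0" if "x \<notin> {- of_int M / real N..<of_int M / real N}" for x
    using M that unfolding Q_def by (auto simp: indicator_def)
  moreover
  have sum: "(\<Sum>m\<in>{- M..<M}. Q (x + of_int m / real N)) = (\<Sum>m\<in>fibre M x. q (x + of_int m / real N))" for x
    unfolding Q_def fibre_def
    by (subst sum.inter_filter) (auto simp: indicator_def intro!: sum.cong)
  ultimately have Q: "integrable lborel Q" "\<And>x. x \<notin> {- of_int M / real N..<of_int M / real N} \<Longrightarrow> Q x = 0"
    by blast+
  have iQ: "(\<integral>x. q x \<partial>lebesgue_on \<Omega>) = (\<integral>x. Q x \<partial>lborel)"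
    unfolding Q_def by (rule integral_over_U[OF q])
  have f: "(\<integral>x. Q x \<partial>lborel) = (\<integral>x. indicator {0..<1 / real N} x *\<^sub>R (\<Sum>m\<in>{- M..<M}. Q (x + of_int m / real N)) \<partial>lborel)"
    "integrable lborel (\<lambda>x. indicator {0..<1 / real N} x *\<^sub>R (\<Sum>m\<in>{- M..<M}. Q (x + of_int m / real N)))"
    by (rule fold_integral[OF Q(1) N], rule Q(2), assumption)+
  show "(\<integral>x. q x \<partial>lebesgue_on \<Omega>) =
      (\<integral>x. indicator {0..<1 / real N} x *\<^sub>R (\<Sum>m\<in>fibre M x. q (x + of_int m / real N)) \<partial>lborel)"
    using f(1) unfolding iQ sum .
  show "integrable lborel (\<lambda>x. indicator {0..<1 / real N} x *\<^sub>R (\<Sum>m\<in>fibre M x. q (x + of_int m / real N)))"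
    using f(2) unfolding sum .
qed

text \<open>The number of points in a fibre is at most \<open>N\<close>, and its integral over \<open>[0, 1 / N)\<close> is the
measure \<open>1\<close> of \<open>\<Omega>\<close>, the same as the integral of the constant \<open>N\<close>.\<close>
lemma AE_card_fibre:
  assumes M: "\<And>x. x \<in> U \<Longrightarrow> x \<in> {- of_int M / real N..<of_int M / real N}"
  shows "AE x in lborel. x \<in> {0..<1 / real N} \<longrightarrow> card (fibre M x) = N"
proof -
  define I where "I = {0..<1 / real N}"
  note f = fold_continuous[of "\<lambda>x. 1 :: real" 1, OF _ _ M, folded I_def]
  have cint: "integrable lborel (\<lambda>x. indicator I x * real (card (fibre M x)))" using f(2) by simp
  have "(\<integral>x. 1 \<partial>lebesgue_on \<Omega>) = (1 :: real)"
    using unit_meas fmeasurableD[OF fin_meas] by (simp add: measure_restrict_space)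
  hence c1: "(\<integral>x. indicator I x * real (card (fibre M x)) \<partial>lborel) = 1" using f(1) by simp
  have Iint: "integrable lborel (\<lambda>x. indicator I x * real N)"
    unfolding I_def by (intro integrable_mult_left) (simp add: integrable_indicator_iff)
  have "(\<integral>x. indicator I x * real N \<partial>lborel) = 1"
    unfolding I_def using N by simp
  hence zero: "(\<integral>x. indicator I x * real N - indicator I x * real (card (fibre M x)) \<partial>lborel) = 0"
    using c1 Iint cint by simp
  have le: "card (fibre M x) \<le> N" for x using fibre_residues(1)[of M x] by (cases "card (fibre M x) = 0") auto
  have "AE x in lborel. indicator I x * real N - indicator I x * real (card (fibre M x)) = 0"
    using integral_nonneg_eq_0_iff_AE[THEN iffD1, OF _ _ zero] Iint cint le
    by (auto simp: indicator_def)
  thus ?thesis unfolding I_def[symmetric] by eventually_elim (auto simp: indicator_def split: if_splits)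
qed

text \<open>Folded modulo \<open>1 / N\<close>, the integrand is \<open>cis (2 * pi * l * x)\<close> times a sum over the fibre.
The sum vanishes for \<open>j \<noteq> 0\<close> (\<open>fibre_residues\<close>); for \<open>j = 0\<close> it is \<open>N\<close>
almost everywhere, and the exponential goes through full periods.\<close>
lemma integral_exponential:
  assumes jk: "\<bar>j\<bar> < int N" "j \<noteq> 0 \<or> k \<noteq> 0"
  shows "(\<integral>x. cis (2 * pi * (s * of_int j + real N * of_int k) * x) \<partial>lebesgue_on \<Omega>) = 0"
proof -
  define l where "l = s * of_int j + real N * of_int k"
  obtain M where M: "\<And>x. x \<in> U \<Longrightarrow> x \<in> {- of_int M / real N..<of_int M / real N}" using U_window by blast
  define I where "I = {0..<1 / real N}"
  define S where "S x = (\<Sum>m\<in>fibre M x. cis (2 * pi * l * (x + of_int m / real N)))" for x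
  have summand: "cis (2 * pi * l * (x + of_int m / real N)) = cis (2 * pi * l * x) * cis (2 * pi * of_int j * (s * of_int m / real N))" for x m
  proof -
    have "2 * pi * l * (x + of_int m / real N) =
      2 * pi * l * x + 2 * pi * of_int j * (s * of_int m / real N) + 2 * pi * of_int (k * m)"
      unfolding l_def using N by (simp add: field_simps)
    hence "cis (2 * pi * l * (x + of_int m / real N)) =
      cis (2 * pi * l * x) * cis (2 * pi * of_int j * (s * of_int m / real N)) * cis (2 * pi * of_int (k * m))"
      unfolding cis_mult by simp
    also have "cis (2 * pi * of_int (k * m)) = 1" by (rule cis_multiple_2pi) simp
    finally show ?thesis by simp
  qed
  have Seq: "S x = cis (2 * pi * l * x) * (\<Sum>m\<in>fibre M x. cis (2 * pi * of_int j * (s * of_int m / real N)))" for x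
    unfolding S_def summand sum_distrib_left ..
  have cont: "continuous_on UNIV (\<lambda>x. cis (2 * pi * l * x))" by (intro continuous_intros)
  note fold = fold_continuous[OF cont, of 1, OF _ M, folded S_def I_def]
  have int: "(\<integral>x. cis (2 * pi * l * x) \<partial>lebesgue_on \<Omega>) = (\<integral>x. indicator I x *\<^sub>R S x \<partial>lborel)"
    "integrable lborel (\<lambda>x. indicator I x *\<^sub>R S x)" using fold by auto
  have card: "AE x in lborel. x \<in> I \<longrightarrow> card (fibre M x) = N"
    unfolding I_def by (rule AE_card_fibre) (rule M)
  have "(\<integral>x. indicator I x *\<^sub>R S x \<partial>lborel) = 0"
  proof (cases "j = 0")
    case False
    have nd: "\<not> int N dvd j"
    proof
      assume "int N dvd j"
      hence "\<bar>int N\<bar> \<le> \<bar>j\<bar>" using False by (intro dvd_imp_le_int)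
      thus False using jk(1) by simp
    qed
    have "AE x in lborel. indicator I x *\<^sub>R S x = 0"
      using card
    proof eventually_elim
      fix x assume c: "x \<in> I \<longrightarrow> card (fibre M x) = N"
      show "indicator I x *\<^sub>R S x = 0"
      proof (cases "x \<in> I")
        case True
        hence "card (fibre M x) = N" using c by simp
        hence "(\<Sum>m\<in>fibre M x. cis (2 * pi * of_int j * (s * of_int m / real N))) = 0"
          using fibre_residues(2)[of M x j] nd N by simp
        thus ?thesis unfolding Seq by simp
      qed simp
    qed
    thus ?thesis by (rule integral_eq_zero_AE)
  next
    case True
    hence k: "k \<noteq> 0" using jk by simp
    have "(\<integral>x. indicator I x *\<^sub>R S x \<partial>lborel) =
        (\<integral>x. of_nat N * (indicator I x *\<^sub>R cis (2 * pi * real N * of_int k * x)) \<partial>lborel)"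
    proof (rule integral_cong_AE)
      show "(\<lambda>x. indicator I x *\<^sub>R S x) \<in> borel_measurable lborel" using int(2) by auto
      have "(\<lambda>x. cis (2 * pi * real N * of_int k * x)) \<in> borel_measurable borel"
        by (intro borel_measurable_continuous_onI continuous_intros)
      thus "(\<lambda>x. of_nat N * (indicator I x *\<^sub>R cis (2 * pi * real N * of_int k * x))) \<in> borel_measurable lborel"
        unfolding I_def by simp
      show "AE x in lborel. indicator I x *\<^sub>R S x = of_nat N * (indicator I x *\<^sub>R cis (2 * pi * real N * of_int k * x))"
        using card
        by eventually_elim (use True in \<open>auto simp: Seq l_def indicator_def mult_ac\<close>)
    qed
    also have "\<dots> = of_nat N * (\<integral>x. indicator I x *\<^sub>R cis (2 * pi * real N * of_int k * x) \<partial>lborel)"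
      by (rule integral_mult_right_zero)
    also have "\<dots> = 0" unfolding I_def integral_cis_period[OF N k] by simp
    finally show ?thesis .
  qed
  thus ?thesis using int(1) unfolding l_def by simp
qed

lemma inner_spectral_exp:
  assumes "l \<in> spectrum" "l' \<in> spectrum"
  shows "L2_inner \<Omega> (spectral_exp \<Omega> l) (spectral_exp \<Omega> l') = (if l = l' then 1 else 0)"
proof -
  obtain j k j' k' where l: "l = s * real j + real N * of_int k" "j < N" "l' = s * real j' + real N * of_int k'" "j' < N"
    using assms unfolding spectrum_def by blast
  have "L2_inner \<Omega> (spectral_exp \<Omega> l) (spectral_exp \<Omega> l') = (\<integral>x. cis (2 * pi * (l - l') * x) \<partial>lebesgue_on \<Omega>)"
    unfolding L2_inner_def
  proof (rule Bochner_Integration.integral_cong[OF refl])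
    fix x assume "x \<in> space (lebesgue_on \<Omega>)"
    hence "x \<in> \<Omega>" by (simp add: space_restrict_space)
    thus "spectral_exp \<Omega> l x * cnj (spectral_exp \<Omega> l' x) = cis (2 * pi * (l - l') * x)"
      unfolding spectral_exp_eq by (simp add: cis_cnj cis_mult algebra_simps)
  qed
  also have "\<dots> = (if l = l' then 1 else 0)"
  proof (cases "l = l'")
    case True
    thus ?thesis using unit_meas fmeasurableD[OF fin_meas] by (simp add: measure_restrict_space)
  next
    case False
    define d where "d = int j - int j'"
    have e: "l - l' = s * of_int d + real N * of_int (k - k')"
      unfolding l d_def by (simp add: algebra_simps)
    have "\<bar>d\<bar> < int N" unfolding d_def using l by simp
    moreover have "d \<noteq> 0 \<or> k - k' \<noteq> 0" using False e by auto
    ultimately show ?thesis using integral_exponential[of d "k - k'"] False unfolding e by simp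
  qed
  finally show ?thesis .
qed

theorem spectral: "spectral_set \<Omega>"
  unfolding spectral_set_def
proof (intro conjI exI)
  show "finite_positive_measure \<Omega>" unfolding finite_positive_measure_def using fin_meas unit_meas by simp
  show "orthonormal_basis_L2 \<Omega> spectrum (spectral_exp \<Omega>)"
    unfolding orthonormal_basis_L2_def
  proof (intro conjI ballI allI impI)
    show "spectral_exp \<Omega> l \<in> L2_on \<Omega>" for l by (rule spectral_exp_L2)
    show "L2_inner \<Omega> (spectral_exp \<Omega> l) (spectral_exp \<Omega> l') = (if l = l' then 1 else 0)"
      if "l \<in> spectrum" "l' \<in> spectrum" for l l' using inner_spectral_exp[OF that] .
    fix f and \<epsilon> :: real assume f: "f \<in> L2_on \<Omega>" and \<epsilon>: "\<epsilon> > 0"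
    obtain g where g: "lin_comb (spectral_exp \<Omega>) spectrum g" "L2_sq \<Omega> (\<lambda>x. f x - g x) < \<epsilon>\<^sup>2"
      using complete[OF f] \<epsilon> unfolding approximable_def by (meson zero_less_power)
    obtain F c where F: "finite F" "F \<subseteq> spectrum" "\<And>x. g x = (\<Sum>l\<in>F. c l * spectral_exp \<Omega> l x)"
      using lin_comb_finite_sum[OF g(1)] by blast
    have "L2_norm_on \<Omega> (\<lambda>x. f x - (\<Sum>l\<in>F. c l * spectral_exp \<Omega> l x)) < \<epsilon>"
      using g(2) \<epsilon> unfolding L2_norm_on_def L2_sq_def F(3)[symmetric] by (simp add: real_sqrt_less_iff real_less_lsqrt)
    thus "\<exists>F c. finite F \<and> F \<subseteq> spectrum \<and> L2_norm_on \<Omega> (\<lambda>x. f x - (\<Sum>l\<in>F. c l * spectral_exp \<Omega> l x)) < \<epsilon>"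
      using F by blast
  qed
qed

end

section \<open>From tilings almost everywhere to exact tilings\<close>

lemma interval_not_null:
  fixes a b :: real
  assumes "a < b" "{a<..<b} \<subseteq> S"
  shows "S \<notin> null_sets lebesgue"
proof
  assume "S \<in> null_sets lebesgue"
  hence "emeasure lebesgue S = 0" "S \<in> sets lebesgue" by auto
  hence "emeasure lebesgue {a<..<b} = 0" using emeasure_mono[OF assms(2), of lebesgue] by simp
  hence "measure lebesgue {a<..<b} = 0" unfolding measure_def by simp
  thus False using assms(1) by simp
qed

lemma bounded_interval_endpoints:
  assumes "bounded_interval I"
  obtains a b where "a < b" "{a<..<b} \<subseteq> I" "I \<subseteq> {a..b}" "I \<in> lmeasurable" "measure lebesgue I = b - a"
proof -
  have I: "is_interval I" "bounded I" "0 < measure lebesgue I"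
    using assms unfolding bounded_interval_def by auto
  have ne: "I \<noteq> {}" using I(3) by auto
  define a b where "a = Inf I" and "b = Sup I"
  have bd: "bdd_below I" "bdd_above I" using I(2) bounded_imp_bdd_below bounded_imp_bdd_above by auto
  have sub: "I \<subseteq> {a..b}" unfolding a_def b_def using bd by (auto intro: cInf_lower cSup_upper)
  have sup: "{a<..<b} \<subseteq> I"
  proof
    fix x assume x: "x \<in> {a<..<b}"
    obtain y where "y \<in> I" "y < x" using x ne bd cInf_less_iff[of I x] unfolding a_def by auto
    moreover obtain z where "z \<in> I" "x < z" using x ne bd less_cSup_iff[of I x] unfolding b_def by auto
    ultimately show "x \<in> I" using I(1) unfolding is_interval_1 by (meson less_imp_le)
  qed
  have "I = {a<..<b} \<union> (I \<inter> {a, b})" using sub sup by force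
  moreover have "finite (I \<inter> {a, b})" by simp
  hence "I \<inter> {a, b} \<in> sets borel" by (rule borel_closed[OF finite_imp_closed])
  ultimately have "I \<in> sets borel" by (metis borel_open open_greaterThanLessThan sets.Un)
  hence Is: "I \<in> sets lebesgue" by (auto intro: sets_completionI_sets)
  have Il: "I \<in> lmeasurable"
    by (rule fmeasurableI2[OF _ sub Is]) simp
  have "measure lebesgue I \<le> measure lebesgue {a..b}"
    using sub Is by (intro measure_mono_fmeasurable) auto
  hence ab: "a < b" using I(3) by (cases "a \<le> b") auto
  have "measure lebesgue {a<..<b} \<le> measure lebesgue I"
    using sup Il by (intro measure_mono_fmeasurable) auto
  hence "measure lebesgue I = b - a"
    using \<open>measure lebesgue I \<le> measure lebesgue {a..b}\<close> ab by simp
  thus ?thesis using that ab sup sub Il by blast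
qed

text \<open>If the half-open versions of two intervals share a point, then the intervals share an open interval,
so disjointness almost everywhere is exact disjointness.  It also makes the set of translations
locally finite; therefore, if a point \<open>x\<close> is not covered, neither is some interval just to the right of \<open>x\<close>,
which is not a null set.\<close>
lemma tiling_by_intervals:
  fixes l w :: "letter \<Rightarrow> real" and J :: "letter \<Rightarrow> real set"
  assumes w: "\<And>i. 0 < w i" "w LA + w LB + w LC = 1"
    and J: "\<And>i. {l i<..<l i + w i} \<subseteq> J i" "\<And>i. J i \<subseteq> {l i..l i + w i}"
    and disj: "\<And>i j. i \<noteq> j \<Longrightarrow> J i \<inter> J j = {}"
    and pack: "\<And>s t. s \<in> T \<Longrightarrow> t \<in> T \<Longrightarrow> s \<noteq> t \<Longrightarrow>
      (+) s ` (\<Union>i. J i) \<inter> (+) t ` (\<Union>i. J i) \<in> null_sets lebesgue"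
    and cov: "UNIV - (\<Union>t\<in>T. (+) t ` (\<Union>i. J i)) \<in> null_sets lebesgue"
  shows "interval_tiling l w T"
proof -
  have mem: "x \<in> (+) t ` S \<longleftrightarrow> x - t \<in> S" for x t and S :: "real set"
    by (auto simp: image_iff) (metis add.commute diff_add_cancel)
  have inJ: "x \<in> J i" if "l i < x" "x < l i + w i" for x i using J(1)[of i] that by auto
  have unique: "i = j \<and> t = s"
    if "t \<in> T" "t + l i \<le> x" "x < t + l i + w i" "s \<in> T" "s + l j \<le> x" "x < s + l j + w j" for t i x s j
  proof -
    define a b where "a = max (t + l i) (s + l j)" and "b = min (t + l i + w i) (s + l j + w j)"
    have ab: "a < b" unfolding a_def b_def using that w(1)[of i] w(1)[of j] by auto
    have both: "y - t \<in> J i" "y - s \<in> J j" if "y \<in> {a<..<b}" for y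
      using that unfolding a_def b_def by (auto intro!: inJ)
    have ts: "t = s"
    proof (rule ccontr)
      assume "t \<noteq> s"
      moreover have "{a<..<b} \<subseteq> (+) t ` (\<Union>i. J i) \<inter> (+) s ` (\<Union>i. J i)"
        using both unfolding subset_iff Int_iff mem by blast
      ultimately show False using pack[OF that(1,4)] interval_not_null[OF ab] by blast
    qed
    have "(a + b) / 2 \<in> {a<..<b}" using ab by auto
    from both[OF this] have "J i \<inter> J j \<noteq> {}" using ts by auto
    thus ?thesis using disj ts by blast
  qed
  have sep: "s + w LA \<le> t" if "s \<in> T" "t \<in> T" "s < t" for s t
    using unique[of s LA "t + l LA" t LA] that w(1)[of LA] by force
  have fin: "finite (T \<inter> {a..b})" for a b
    by (rule finite_separated_Int[OF w(1)]) (rule sep)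
  have cover: "\<exists>i t. t \<in> T \<and> t + l i \<le> x \<and> x < t + l i + w i" for x
  proof (rule ccontr)
    assume none: "\<nexists>i t. t \<in> T \<and> t + l i \<le> x \<and> x < t + l i + w i"
    define L where "L = (\<Sum>i\<in>UNIV. \<bar>l i\<bar> + w i)"
    have L: "\<bar>l i\<bar> + w i \<le> L" for i
      unfolding L_def using w(1) by (intro member_le_sum) (auto simp: less_imp_le add_nonneg_nonneg)
    define D where "D = {d. d > 0 \<and> (\<exists>i. \<exists>t\<in>T \<inter> {x - L - 1..x + L + 1}. d = t + l i - x)}"
    have "D \<subseteq> (\<lambda>(i, t). t + l i - x) ` (UNIV \<times> (T \<inter> {x - L - 1..x + L + 1}))"
      unfolding D_def by auto
    hence Dfin: "finite D" by (rule finite_subset) (simp add: UNIV_letter fin)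
    define \<delta> where "\<delta> = Min (insert 1 D)"
    have \<delta>: "0 < \<delta>" "\<delta> \<le> 1" "\<And>d. d \<in> D \<Longrightarrow> \<delta> \<le> d"
      unfolding \<delta>_def using Dfin by (auto simp: D_def Min_gr_iff)
    have "{x<..<x + \<delta>} \<subseteq> UNIV - (\<Union>t\<in>T. (+) t ` (\<Union>i. J i))"
    proof
      fix y assume y: "y \<in> {x<..<x + \<delta>}"
      have False if t: "t \<in> T" and i: "y - t \<in> J i" for t i
      proof -
        have yi: "t + l i \<le> y" "y \<le> t + l i + w i" using J(2)[of i] i by auto
        have "t \<in> {x - L - 1..x + L + 1}" using yi y \<delta>(2) L[of i] by auto
        hence "t + l i - x \<in> D" if "x < t + l i"
          unfolding D_def using that t by (intro CollectI conjI exI[of _ i] bexI[of _ t]) auto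
        hence "t + l i \<le> x" using \<delta>(3)[of "t + l i - x"] yi y by force
        moreover have "x < t + l i + w i" using yi y by auto
        ultimately show False using none t by blast
      qed
      thus "y \<in> UNIV - (\<Union>t\<in>T. (+) t ` (\<Union>i. J i))" by (auto simp: mem)
    qed
    thus False using cov interval_not_null[of x "x + \<delta>"] \<delta>(1) by auto
  qed
  show ?thesis
    by unfold_locales (use w cover unique in auto)
qed

lemma quotient_by_gcd:
  fixes m q d :: int
  assumes "gcd m q dvd d" "\<not> n * gcd m q dvd d"
  shows "\<exists>k::int. 1 / of_int (gcd m q) * of_int d = (of_int k :: real) \<and> \<not> n dvd k"
proof -
  obtain k where k: "d = gcd m q * k" using assms(1) by blast
  have "gcd m q \<noteq> 0" using assms k by auto
  moreover have "\<not> n dvd k" using assms(2) k by (auto simp: mult_dvd_mono mult.commute)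
  ultimately show ?thesis using k by (intro exI[of _ k]) simp
qed

section \<open>Tiling implies spectral for three intervals\<close>

context interval_tiling
begin

definition open_pieces :: "real set" where
  "open_pieces = (\<Union>i. {l i<..<l i + w i})"

text \<open>In the first case \<open>N = 1\<close>: two points at an integer distance \<open>m > 0\<close> would give a common point of
two tiles that differ by \<open>m\<close>.  In the other cases \<open>N\<close> is \<open>2\<close> or \<open>3\<close>, the offsets \<open>m\<close> and
\<open>q\<close> are those of \<open>trichotomy\<close>, and \<open>s = 1 / gcd m q\<close>.  Two points of the same fibre then differ
by \<open>m / N\<close>, \<open>q / N\<close> or, for \<open>N = 3\<close>, \<open>(m - q) / N\<close> up to sign.\<close>
lemma open_pieces_spectral:
  assumes Om: "\<Omega> \<in> lmeasurable" "measure lebesgue \<Omega> = 1"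
    and U: "open_pieces \<subseteq> \<Omega>" "\<Omega> - open_pieces \<in> null_sets lebesgue"
  shows "spectral_set \<Omega>"
proof -
  have bd: "bounded open_pieces" unfolding open_pieces_def by (simp add: UNIV_letter)
  have op: "open open_pieces" unfolding open_pieces_def by auto
  have crit: "spectral_set \<Omega>"
    if N: "0 < N" and packed: "\<And>i j x m. l i < x \<Longrightarrow> x < l i + w i \<Longrightarrow> l j < x + of_int m / real N \<Longrightarrow>
        x + of_int m / real N < l j + w j \<Longrightarrow> m \<noteq> 0 \<Longrightarrow> \<exists>k::int. s * of_int m = of_int k \<and> \<not> int N dvd k"
    for N :: nat and s :: real
  proof -
    interpret packed_set \<Omega> open_pieces N s
    proof
      show "\<exists>k::int. s * of_int m = of_int k \<and> \<not> int N dvd k"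
        if "x \<in> open_pieces" "x + of_int m / real N \<in> open_pieces" "m \<noteq> 0" for x m
        using that packed unfolding open_pieces_def by auto
    qed (use Om U bd op N in auto)
    show ?thesis by (rule spectral)
  qed
  show ?thesis
  proof (rule trichotomy)
    assume unit: "\<And>t. t \<in> T \<Longrightarrow> t + 1 \<in> T"
    obtain t where t: "t \<in> T" using T_unbounded by blast
    have shift: "t + real n \<in> T" for n
    proof (induction n)
      case (Suc n)
      have e: "t + real (Suc n) = (t + real n) + 1" by simp
      show ?case unfolding e by (rule unit[OF Suc])
    qed (use t in simp)
    have no: False if x: "l i < x" "x < l i + w i" and y: "l j < x + of_int m" "x + of_int m < l j + w j" and m: "m > 0" for i j x and m :: int
      using unique[OF t, of j "t + x + of_int m" "t + real (nat m)" i] shift[of "nat m"] x y m by auto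
    show ?thesis
    proof (rule crit[of 1 0])
      fix i j x and m :: int
      assume x: "l i < x" "x < l i + w i" and y: "l j < x + of_int m / real 1" "x + of_int m / real 1 < l j + w j" and m: "m \<noteq> 0"
      have False
        using no[OF x, of j m] no[of j "x + of_int m" i "- m"] x y m by (cases "m > 0") auto
      thus "\<exists>k::int. 0 * of_int m = of_int k \<and> \<not> int 1 dvd k" ..
    qed simp
  next
    fix A B C :: letter and m q :: int
    assume d: "A \<noteq> B" "B \<noteq> C" "A \<noteq> C" and wA: "w A = 1 / 2"
      and lB: "l B = l A + of_int m / 2" and lC: "l C = l A + w B + of_int q / 2"
      and mq: "\<not> 2 * gcd m q dvd m" "\<not> 2 * gcd m q dvd q"
    have w: "0 < w B" "0 < w C" "w B + w C = 1 / 2" using w_pos w_sum_perm[OF d] wA by auto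
    have int: "a = b" if "of_int a - of_int b < (1 :: real)" "of_int b - of_int a < (1 :: real)" for a b :: int
      using that by linarith
    show ?thesis
    proof (rule crit[of 2 "1 / of_int (gcd m q)"])
      fix i j x and n :: int
      assume x: "l i < x" "x < l i + w i" and y: "l j < x + of_int n / real 2" "x + of_int n / real 2 < l j + w j" and n: "n \<noteq> 0"
      have ni: "\<not> (of_int n < (1 :: real) \<and> - of_int n < (1 :: real))" using n int[of n 0] by auto
      have nBC: "\<not> (of_int (q - m) < real_of_int n \<and> of_int n < real_of_int (q - m) + 1)"
        "\<not> (of_int (m - q) - 1 < real_of_int n \<and> of_int n < real_of_int (m - q))"
        using no_int_strictly_between[of "q - m" n] no_int_strictly_between[of "m - q - 1" n] by auto
      have "n \<in> {m, - m, q, - q}"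
        using letter_cases3[OF d, of i] letter_cases3[OF d, of j]
      proof (elim disjE)
        assume "i = A" "j = B"
        hence "n = m" using x y wA w lB by (intro int) auto
        thus ?thesis by simp
      next
        assume "i = B" "j = A"
        hence "n = - m" using x y wA w lB by (intro int) auto
        thus ?thesis by simp
      next
        assume "i = A" "j = C"
        hence "n = q" using x y wA w lC by (intro int) auto
        thus ?thesis by simp
      next
        assume "i = C" "j = A"
        hence "n = - q" using x y wA w lC by (intro int) auto
        thus ?thesis by simp
      next
        assume "i = B" "j = C"
        hence False using x y w lB lC nBC by auto
        thus ?thesis ..
      next
        assume "i = C" "j = B"
        hence False using x y w lB lC nBC by auto
        thus ?thesis ..
      qed (use x y wA w ni in auto)
      hence "gcd m q dvd n \<and> \<not> 2 * gcd m q dvd n" using mq by auto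
      thus "\<exists>k::int. 1 / of_int (gcd m q) * of_int n = (of_int k :: real) \<and> \<not> int 2 dvd k"
        using quotient_by_gcd[of m q n 2] by simp
    qed simp
  next
    fix m q :: int
    assume w: "\<And>i. w i = 1 / 3" and lB: "l LB = l LA + of_int m / 3" and lC: "l LC = l LA + of_int q / 3"
      and mq: "\<not> 3 * gcd m q dvd m" "\<not> 3 * gcd m q dvd q" "\<not> 3 * gcd m q dvd m - q"
    define r where "r = (\<lambda>i. case i of LA \<Rightarrow> 0 | LB \<Rightarrow> m | LC \<Rightarrow> q)"
    have l: "l i = l LA + of_int (r i) / 3" for i unfolding r_def using lB lC by (cases i) auto
    show ?thesis
    proof (rule crit[of 3 "1 / of_int (gcd m q)"])
      fix i j x and n :: int
      assume x: "l i < x" "x < l i + w i" and y: "l j < x + of_int n / real 3" "x + of_int n / real 3 < l j + w j" and n: "n \<noteq> 0"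
      have "real_of_int n < of_int (r j - r i) + 1" "of_int (r j - r i) < real_of_int n + 1"
        using x y unfolding l[of i] l[of j] w by (auto simp: field_simps)
      hence nr: "n = r j - r i" by linarith
      have mq': "\<not> 3 * gcd m q dvd q - m" using mq(3) by (metis dvd_minus_iff minus_diff_eq)
      have "gcd m q dvd n \<and> \<not> 3 * gcd m q dvd n"
        using mq mq' n unfolding nr r_def by (cases i; cases j) auto
      thus "\<exists>k::int. 1 / of_int (gcd m q) * of_int n = (of_int k :: real) \<and> \<not> int 3 dvd k"
        using quotient_by_gcd[of m q n 3] by simp
    qed simp
  qed
qed

end

theorem theorem2p1:
  fixes A B C :: "real set"
  assumes "bounded_interval A" and "bounded_interval B" and "bounded_interval C"
    and "A \<inter> B = {}" and "A \<inter> C = {}" and "B \<inter> C = {}"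
    and "measure lebesgue A + measure lebesgue B + measure lebesgue C = 1"
    and "tiles_by_translations (A \<union> B \<union> C)"
  shows "spectral_set (A \<union> B \<union> C)"
proof -
  define J where "J i = (case i of LA \<Rightarrow> A | LB \<Rightarrow> B | LC \<Rightarrow> C)" for i
  have J_simps [simp]: "J LA = A" "J LB = B" "J LC = C" unfolding J_def by simp_all
  have union: "(\<Union>i. J i) = A \<union> B \<union> C" by (auto simp: UNIV_letter)
  have "bounded_interval (J i)" for i using assms(1-3) by (cases i) auto
  hence "\<forall>i. \<exists>a b. a < b \<and> {a<..<b} \<subseteq> J i \<and> J i \<subseteq> {a..b} \<and> J i \<in> lmeasurable \<and> measure lebesgue (J i) = b - a"
    using bounded_interval_endpoints by metis
  then obtain l r where lr: "\<And>i. l i < r i" "\<And>i. {l i<..<r i} \<subseteq> J i" "\<And>i. J i \<subseteq> {l i..r i}"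
    "\<And>i. J i \<in> lmeasurable" "\<And>i. measure lebesgue (J i) = r i - l i"
    by metis
  define w where "w i = r i - l i" for i
  have r: "r i = l i + w i" for i unfolding w_def by simp
  have w: "0 < w i" "measure lebesgue (J i) = w i" for i unfolding w_def using lr by auto
  have wsum: "w LA + w LB + w LC = 1" using assms(7) w(2)[of LA] w(2)[of LB] w(2)[of LC] by simp
  have disj: "J i \<inter> J j = {}" if "i \<noteq> j" for i j
    using that assms(4-6) by (cases i; cases j) auto
  obtain T :: "real set" where T: "\<And>s t. s \<in> T \<Longrightarrow> t \<in> T \<Longrightarrow> s \<noteq> t \<Longrightarrow>
      (+) s ` (\<Union>i. J i) \<inter> (+) t ` (\<Union>i. J i) \<in> null_sets lebesgue"
    "UNIV - (\<Union>t\<in>T. (+) t ` (\<Union>i. J i)) \<in> null_sets lebesgue"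
    using assms(8) unfolding tiles_by_translations_def union by blast
  interpret interval_tiling l w T
    by (rule tiling_by_intervals[where J = J]) (use w wsum lr disj T in \<open>auto simp: r\<close>)
  have meas: "A \<in> lmeasurable" "B \<in> lmeasurable" "C \<in> lmeasurable"
    using lr(4)[of LA] lr(4)[of LB] lr(4)[of LC] by auto
  show ?thesis
  proof (rule open_pieces_spectral)
    show "A \<union> B \<union> C \<in> lmeasurable" using meas by auto
    have fin: "emeasure lebesgue S \<noteq> \<infinity>" if "S \<in> lmeasurable" for S :: "real set"
      unfolding infinity_ennreal_def by (rule fmeasurableD2[OF that])
    have "measure lebesgue (A \<union> B \<union> C) = measure lebesgue (A \<union> B) + measure lebesgue C"
      using meas assms(5,6) by (intro measure_Union fin fmeasurableD fmeasurable.Un) auto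
    also have "measure lebesgue (A \<union> B) = measure lebesgue A + measure lebesgue B"
      using meas assms(4) by (intro measure_Union fin fmeasurableD) auto
    finally show "measure lebesgue (A \<union> B \<union> C) = 1" using assms(7) by simp
    show "open_pieces \<subseteq> A \<union> B \<union> C"
      unfolding open_pieces_def union[symmetric] using lr(2) unfolding r by blast
    have "A \<union> B \<union> C - open_pieces \<subseteq> (\<Union>i. {l i, r i})"
    proof
      fix x assume x: "x \<in> A \<union> B \<union> C - open_pieces"
      then obtain i where i: "x \<in> J i" unfolding union[symmetric] by blast
      have "\<not> (l i < x \<and> x < r i)" using x unfolding open_pieces_def r by auto
      hence "x = l i \<or> x = r i" using i lr(3)[of i] by force
      thus "x \<in> (\<Union>i. {l i, r i})" by blast
    qed
    moreover have "finite (\<Union>i. {l i, r i})" by (simp add: UNIV_letter)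
    ultimately have "finite (A \<union> B \<union> C - open_pieces)" by (rule finite_subset)
    thus "A \<union> B \<union> C - open_pieces \<in> null_sets lebesgue"
      unfolding negligible_iff_null_sets[symmetric] by (rule negligible_finite)
  qed
qed

end
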